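(* Suppose that $(X,d,\mu)$ is a geometrically doubling metric measure space with $\sup\{\mu(B(x,1)):x\in X\}<\infty$. Moreover, assume that $\mu$ is lower Ahlfors $Q(\cdot)$-regular for some $Q\in\mathcal{P}_b^{\log}(X)$. Suppose that $H\subseteq\mathrm{Iso}_\mu(X,d)$ is such that there exist $x_0\in X$ and $r\in(0,\infty)$ satisfying $$\lim_{R\to\infty}\ \inf_{x\in X\setminus B(x_0,R)}M_H(x,r)=\infty.$$ Let $p\in\mathcal{P}_b^{\log}(X)\cap\mathcal{P}_H(X)$, $q\in\mathcal{P}(X)$ and $s\in\mathcal{P}_b^{\log}(X)$ be such that $s^+\le1$ and $sp\ll Q$. (i) We have the compact embedding $$M^{s(\cdot),H}_{p(\cdot),q(\cdot)}(X,d,\mu)\hookrightarrow\hookrightarrow L^{\beta(\cdot)}(X,\mu)$$ for every $\beta\in\mathcal{P}_b(X)$ satisfying $p\ll\beta\ll\gamma$, where $\gamma=Qp/(Q-sp)$. (ii) For all $t\in\mathcal{P}_b^{\log}(X)$ satisfying $t\ll s$ we have the compact embedding $$N^{s(\cdot),H}_{p(\cdot),q(\cdot)}(X,d,\mu)\hookrightarrow\hookrightarrow L^{\beta(\cdot)}(X,\mu)$$ for every $\beta\in\mathcal{P}_b(X)$ satisfying $p\ll\beta\ll\sigma$, where $\sigma=Qp/(Q-tp)$.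
   Context: A metric measure space $(X,d,\mu)$ is a metric space $(X,d)$ with a Borel measure $\mu$ such that $0<\mu(B(x,r))<\infty$ for every open ball $B(x,r)$, $x\in X$, $r\in(0,\infty)$ (in particular $X$ is separable). $(X,d)$ is geometrically doubling if there is a constant $M$ such that every ball $B(x,r)$ can be covered by at most $M$ balls of radius $r/2$. Exponents: for measurable $p$ on $X$, $p^+=\operatorname{ess\,sup}_X p$, $p^-=\operatorname{ess\,inf}_X p$. $\mathcal{P}(X)$ is the set of measurable $p:X\to(0,\infty]$ with $p^->0$; $\mathcal{P}_b(X)=\mathcal{P}(X)\cap L^\infty(X,\mu)$. $p_1\ll p_2$ means $(p_2-p_1)^->0$. $\mathcal{P}_b^{\log}(X)$ is the set of $p\in\mathcal{P}_b(X)$ such that $1/p$ is locally log-Hölder continuous: there is $C\in(0,\infty)$ with $|1/p(x)-1/p(y)|\le C/\log(e+1/d(x,y))$ for all $x,y\in X$. $\mu$ is lower Ahlfors $Q(\cdot)$-regular if there is $b_1\in(0,\infty)$ such that $\mu(B(x,r))\ge b_1r^{Q(x)}$ for all $x\in X$, $r\in(0,1]$. Isometries: $\mathrm{Iso}_\mu(X,d)$ is the group of isometries $\varphi$ of $(X,d)$ (onto itself) with $\varphi_\#\mu=\mu$, where $\varphi_\#\mu(A)=\mu(\varphi^{-1}(A))$ for Borel $A$. For $H\subseteq\mathrm{Iso}_\mu(X,d)$, $H(x)=\{h(x):h\in H\}$ and $M_H(x,r)=\sup\{\#A: A\subseteq H(x),\ B(\xi,r)\cap B(\eta,r)=\emptyset\text{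 for all distinct }\xi,\eta\in A\}$. $\mathcal{P}_H(X)=\{p\in\mathcal{P}(X):p\circ\varphi=p\ \text{for all }\varphi\in H\}$. The infimum over the empty set is $+\infty$. Lebesgue spaces: for $p\in\mathcal{P}_b(X)$ let $\rho_{p(\cdot)}(u)=\int_X|u(x)|^{p(x)}\,d\mu(x)$. $L^{p(\cdot)}(X,\mu)$ is the space of measurable $u$ with $\rho_{p(\cdot)}(\lambda u)<\infty$ for some $\lambda>0$, with quasi-norm $\|u\|_{L^{p(\cdot)}}=\inf\{\lambda>0:\rho_{p(\cdot)}(u/\lambda)\le1\}$. Mixed spaces ($p\in\mathcal{P}_b(X)$, $q\in\mathcal{P}(X)$): for sequences $\{u_k\}_{k\in\mathbb{Z}}$ of measurable functions, $\|\{u_k\}\|_{L^{p(\cdot)}(\ell^{q(\cdot)})}=\big\|\,\|\{u_k(\cdot)\}_k\|_{\ell^{q(\cdot)}}\big\|_{L^{p(\cdot)}}$ (pointwise $\ell^{q(x)}(\mathbb{Z})$ quasi-norm, supremum if $q(x)=\infty$). Let $\rho_{\ell^{q(\cdot)}(L^{p(\cdot)})}(\{u_k\})=\sum_{k\in\mathbb{Z}}\inf\{\lambda_k>0:\rho_{p(\cdot)}(u_k/\lambda_k^{1/q(\cdot)})\le1\}$ (with $\lambda^{1/\infty}=1$) and $\|\{u_k\}\|_{\ell^{q(\cdot)}(L^{p(\cdot)})}=\inf\{m>0:\rho_{\ell^{q(\cdot)}(L^{p(\cdot)})}(\{u_k\}/m)\le1\}$. Gradients: let $s\in\mathcal{P}_b(X)$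 and $u:X\to\overline{\mathbb{R}}$ be measurable and finite a.e. A sequence $\{g_k\}_{k\in\mathbb{Z}}$ of non-negative measurable functions is a vector $s(\cdot)$-gradient of $u$ (written $\{g_k\}\in\mathbb{D}^{s(\cdot)}(u)$) if there is a $\mu$-null set $N_u$ such that $|u(x)-u(y)|\le d(x,y)^{s(x)}g_k(x)+d(x,y)^{s(y)}g_k(y)$ for all $k\in\mathbb{Z}$ and all $x,y\in X\setminus N_u$ with $2^{-k-1}\le d(x,y)<2^{-k}$. Function spaces: $\|u\|_{\dot M^{s(\cdot)}_{p(\cdot),q(\cdot)}}=\inf_{g\in\mathbb{D}^{s(\cdot)}(u)}\|g\|_{L^{p(\cdot)}(\ell^{q(\cdot)})}$ and $\|u\|_{\dot N^{s(\cdot)}_{p(\cdot),q(\cdot)}}=\inf_{g\in\mathbb{D}^{s(\cdot)}(u)}\|g\|_{\ell^{q(\cdot)}(L^{p(\cdot)})}$. For $A\in\{M,N\}$, $A^{s(\cdot)}_{p(\cdot),q(\cdot)}(X,d,\mu)$ is the space of $u\in L^{p(\cdot)}(X,\mu)$ with $\|u\|_{\dot A^{s(\cdot)}_{p(\cdot),q(\cdot)}}<\infty$, with quasi-norm $\|u\|_{L^{p(\cdot)}}+\|u\|_{\dot A^{s(\cdot)}_{p(\cdot),q(\cdot)}}$; $A^{s(\cdot),H}_{p(\cdot),q(\cdot)}(X,d,\mu)$ is its subspace of $u$ with $u\circ\varphi=u$ for all $\varphi\in H$. $Y\hookrightarrow\hookrightarrow Z$ (compact embedding) means $Y\subseteq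 Z$ with continuous inclusion mapping bounded subsets of $Y$ to totally bounded subsets of $Z$. *)

theory Defs
  imports "HOL-Analysis.Analysis" "HOL-Probability.Essential_Supremum"
begin

text \<open>The underlying metric space \<open>X\<close> is a type of class \<open>metric_space\<close>, and \<open>M\<close> is the
  measure \<open>\<mu>\<close> on its Borel sets. All (quasi-)norms and modulars take values in \<open>ennreal\<close>,
  so that an infimum over the empty set is \<open>\<infinity>\<close>.\<close>

definition metric_measure_space :: "'a::metric_space measure \<Rightarrow> bool" where
  "metric_measure_space M \<longleftrightarrow>
     sets M = sets borel \<and>
     (\<forall>x. \<forall>r>0. 0 < emeasure M (ball x r) \<and> emeasure M (ball x r) < \<infinity>)"

definition geometrically_doubling :: "'a::metric_space itself \<Rightarrow> bool" where
  "geometrically_doubling _ \<longleftrightarrow>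
     (\<exists>m::nat. \<forall>(x::'a) r. r > 0 \<longrightarrow>
        (\<exists>C. finite C \<and> card C \<le> m \<and> ball x r \<subseteq> (\<Union>c\<in>C. ball c (r/2))))"

definition essinf :: "'a measure \<Rightarrow> ('a \<Rightarrow> ereal) \<Rightarrow> ereal" where
  "essinf M f = - esssup M (\<lambda>x. - f x)"

definition exponents :: "'a measure \<Rightarrow> ('a \<Rightarrow> ereal) set" where
  "exponents M = {p \<in> borel_measurable M. (\<forall>x. 0 < p x) \<and> 0 < essinf M p}"

definition bdd_exponents :: "'a measure \<Rightarrow> ('a \<Rightarrow> ereal) set" where
  "bdd_exponents M = {p \<in> exponents M. esssup M p < \<infinity>}"

text \<open>Here \<open>1 / p x\<close> is division in \<open>ereal\<close>, so \<open>1 / \<infinity> = 0\<close>. For \<open>x = y\<close> the convention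
  \<open>1 / 0 = 0\<close> on the reals makes the bound \<open>0 \<le> C\<close>.\<close>
definition log_exponents :: "'a::metric_space measure \<Rightarrow> ('a \<Rightarrow> ereal) set" where
  "log_exponents M = {p \<in> bdd_exponents M.
     \<exists>C>0. \<forall>x y. \<bar>1 / p x - 1 / p y\<bar> \<le> ereal (C / ln (exp 1 + 1 / dist x y))}"

definition well_below :: "'a measure \<Rightarrow> ('a \<Rightarrow> ereal) \<Rightarrow> ('a \<Rightarrow> ereal) \<Rightarrow> bool" where
  "well_below M p1 p2 \<longleftrightarrow> 0 < essinf M (\<lambda>x. p2 x - p1 x)"

text \<open>In this and the following definitions \<open>real_of_ereal\<close> is applied to bounded exponents, which are
  finite almost everywhere (and to \<open>q\<close> only where it is finite, or to \<open>1 / q\<close>). A log-Hoelder continuous bounded exponent on a metric measure space is finite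
  at every point, since null sets have dense complement and \<open>1 / p\<close> is continuous.\<close>
definition lower_Ahlfors_regular :: "'a::metric_space measure \<Rightarrow> ('a \<Rightarrow> ereal) \<Rightarrow> bool" where
  "lower_Ahlfors_regular M Q \<longleftrightarrow>
     (\<exists>b>0. \<forall>x r. 0 < r \<and> r \<le> 1 \<longrightarrow>
        ennreal (b * r powr real_of_ereal (Q x)) \<le> emeasure M (ball x r))"

definition Iso :: "'a::metric_space measure \<Rightarrow> ('a \<Rightarrow> 'a) set" where
  "Iso M = {\<phi>. surj \<phi> \<and> (\<forall>x y. dist (\<phi> x) (\<phi> y) = dist x y) \<and> distr M M \<phi> = M}"

definition orbit_of :: "('a \<Rightarrow> 'a) set \<Rightarrow> 'a \<Rightarrow> 'a set" where
  "orbit_of H x = (\<lambda>h. h x) ` H"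

definition orbit_packing :: "('a::metric_space \<Rightarrow> 'a) set \<Rightarrow> 'a \<Rightarrow> real \<Rightarrow> enat" where
  "orbit_packing H x r =
     (SUP A \<in> {A. A \<subseteq> orbit_of H x \<and> (\<forall>\<xi>\<in>A. \<forall>\<eta>\<in>A. \<xi> \<noteq> \<eta> \<longrightarrow> ball \<xi> r \<inter> ball \<eta> r = {})}.
        if finite A then enat (card A) else \<infinity>)"

definition invariant_exponents ::
    "'a measure \<Rightarrow> ('a \<Rightarrow> 'a) set \<Rightarrow> ('a \<Rightarrow> ereal) set" where
  "invariant_exponents M H = {p \<in> exponents M. \<forall>\<phi>\<in>H. p \<circ> \<phi> = p}"

text \<open>Intended for exponents \<open>t > 0\<close>.\<close>
definition enn_powr :: "ennreal \<Rightarrow> real \<Rightarrow> ennreal" where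
  "enn_powr a t = (if a = \<infinity> then \<infinity> else ennreal (enn2real a powr t))"

text \<open>Modulars and norms are defined on \<open>[0, \<infinity>]\<close>-valued functions; an extended real valued \<open>u\<close>
  enters through \<open>abs_fun u\<close>.\<close>
definition abs_fun :: "('a \<Rightarrow> ereal) \<Rightarrow> 'a \<Rightarrow> ennreal" where
  "abs_fun u x = e2ennreal \<bar>u x\<bar>"

definition modular :: "'a measure \<Rightarrow> ('a \<Rightarrow> ereal) \<Rightarrow> ('a \<Rightarrow> ennreal) \<Rightarrow> ennreal" where
  "modular M p f = (\<integral>\<^sup>+x. enn_powr (f x) (real_of_ereal (p x)) \<partial>M)"

definition Lp_norm :: "'a measure \<Rightarrow> ('a \<Rightarrow> ereal) \<Rightarrow> ('a \<Rightarrow> ennreal) \<Rightarrow> ennreal" where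
  "Lp_norm M p f = Inf {ennreal c |c. c > 0 \<and> modular M p (\<lambda>x. f x / ennreal c) \<le> 1}"

definition Lp_space :: "'a measure \<Rightarrow> ('a \<Rightarrow> ereal) \<Rightarrow> ('a \<Rightarrow> ereal) set" where
  "Lp_space M p =
     {u \<in> borel_measurable M. \<exists>c>0. modular M p (\<lambda>x. ennreal c * abs_fun u x) < \<infinity>}"

definition lq_norm :: "ereal \<Rightarrow> (int \<Rightarrow> ennreal) \<Rightarrow> ennreal" where
  "lq_norm q a =
     (if q = \<infinity> then (SUP k. a k)
      else enn_powr (\<Sum>\<^sub>\<infinity>k. enn_powr (a k) (real_of_ereal q)) (1 / real_of_ereal q))"

definition Lp_lq_norm ::
    "'a measure \<Rightarrow> ('a \<Rightarrow> ereal) \<Rightarrow> ('a \<Rightarrow> ereal) \<Rightarrow> (int \<Rightarrow> 'a \<Rightarrow> ennreal) \<Rightarrow> ennreal" where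
  "Lp_lq_norm M p q g = Lp_norm M p (\<lambda>x. lq_norm (q x) (\<lambda>k. g k x))"

text \<open>At points with \<open>q x = \<infinity>\<close> the exponent \<open>1 / q x\<close> is \<open>0\<close>, and \<open>c powr 0 = 1\<close> as \<open>c > 0\<close>.\<close>
definition lq_Lp_modular ::
    "'a measure \<Rightarrow> ('a \<Rightarrow> ereal) \<Rightarrow> ('a \<Rightarrow> ereal) \<Rightarrow> (int \<Rightarrow> 'a \<Rightarrow> ennreal) \<Rightarrow> ennreal" where
  "lq_Lp_modular M p q g =
     (\<Sum>\<^sub>\<infinity>k. Inf {ennreal c |c. c > 0 \<and>
        modular M p (\<lambda>x. g k x / ennreal (c powr real_of_ereal (1 / q x))) \<le> 1})"

definition lq_Lp_norm ::
    "'a measure \<Rightarrow> ('a \<Rightarrow> ereal) \<Rightarrow> ('a \<Rightarrow> ereal) \<Rightarrow> (int \<Rightarrow> 'a \<Rightarrow> ennreal) \<Rightarrow> ennreal" where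
  "lq_Lp_norm M p q g =
     Inf {ennreal m |m. m > 0 \<and> lq_Lp_modular M p q (\<lambda>k x. g k x / ennreal m) \<le> 1}"

text \<open>Where \<open>u x\<close> and \<open>u y\<close> are equal infinite values, \<open>u x - u y\<close> is the \<open>ereal\<close> value \<open>\<infinity>\<close>; for
  \<open>u\<close> finite almost everywhere such points can be absorbed into the null set.\<close>
definition vector_gradients ::
    "'a::metric_space measure \<Rightarrow> ('a \<Rightarrow> ereal) \<Rightarrow> ('a \<Rightarrow> ereal) \<Rightarrow> (int \<Rightarrow> 'a \<Rightarrow> ennreal) set" where
  "vector_gradients M s u =
     {g. (\<forall>k. g k \<in> borel_measurable M) \<and>
         (\<exists>N\<in>null_sets M. \<forall>k. \<forall>x\<in>-N. \<forall>y\<in>-N.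
            2 powi (-k-1) \<le> dist x y \<and> dist x y < 2 powi (-k) \<longrightarrow>
            e2ennreal \<bar>u x - u y\<bar>
              \<le> ennreal (dist x y powr real_of_ereal (s x)) * g k x
                + ennreal (dist x y powr real_of_ereal (s y)) * g k y)}"

definition M_seminorm ::
    "'a::metric_space measure \<Rightarrow> ('a \<Rightarrow> ereal) \<Rightarrow> ('a \<Rightarrow> ereal) \<Rightarrow> ('a \<Rightarrow> ereal) \<Rightarrow> ('a \<Rightarrow> ereal) \<Rightarrow> ennreal" where
  "M_seminorm M s p q u = (INF g \<in> vector_gradients M s u. Lp_lq_norm M p q g)"

definition N_seminorm ::
    "'a::metric_space measure \<Rightarrow> ('a \<Rightarrow> ereal) \<Rightarrow> ('a \<Rightarrow> ereal) \<Rightarrow> ('a \<Rightarrow> ereal) \<Rightarrow> ('a \<Rightarrow> ereal) \<Rightarrow> ennreal" where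
  "N_seminorm M s p q u = (INF g \<in> vector_gradients M s u. lq_Lp_norm M p q g)"

definition M_norm ::
    "'a::metric_space measure \<Rightarrow> ('a \<Rightarrow> ereal) \<Rightarrow> ('a \<Rightarrow> ereal) \<Rightarrow> ('a \<Rightarrow> ereal) \<Rightarrow> ('a \<Rightarrow> ereal) \<Rightarrow> ennreal" where
  "M_norm M s p q u = Lp_norm M p (abs_fun u) + M_seminorm M s p q u"

definition N_norm ::
    "'a::metric_space measure \<Rightarrow> ('a \<Rightarrow> ereal) \<Rightarrow> ('a \<Rightarrow> ereal) \<Rightarrow> ('a \<Rightarrow> ereal) \<Rightarrow> ('a \<Rightarrow> ereal) \<Rightarrow> ennreal" where
  "N_norm M s p q u = Lp_norm M p (abs_fun u) + N_seminorm M s p q u"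

definition M_space ::
    "'a::metric_space measure \<Rightarrow> ('a \<Rightarrow> ereal) \<Rightarrow> ('a \<Rightarrow> ereal) \<Rightarrow> ('a \<Rightarrow> ereal) \<Rightarrow> ('a \<Rightarrow> ereal) set" where
  "M_space M s p q = {u \<in> Lp_space M p. M_seminorm M s p q u < \<infinity>}"

definition N_space ::
    "'a::metric_space measure \<Rightarrow> ('a \<Rightarrow> ereal) \<Rightarrow> ('a \<Rightarrow> ereal) \<Rightarrow> ('a \<Rightarrow> ereal) \<Rightarrow> ('a \<Rightarrow> ereal) set" where
  "N_space M s p q = {u \<in> Lp_space M p. N_seminorm M s p q u < \<infinity>}"

text \<open>Elements of the function spaces are classes modulo equality almost everywhere, so invariance
  of \<open>u\<close> under an isometry is an identity almost everywhere.\<close>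
definition H_invariant :: "'a measure \<Rightarrow> ('a \<Rightarrow> 'a) set \<Rightarrow> ('a \<Rightarrow> ereal) \<Rightarrow> bool" where
  "H_invariant M H u \<longleftrightarrow> (\<forall>\<phi>\<in>H. AE x in M. u (\<phi> x) = u x)"

definition M_space_inv ::
    "'a::metric_space measure \<Rightarrow> ('a \<Rightarrow> ereal) \<Rightarrow> ('a \<Rightarrow> ereal) \<Rightarrow> ('a \<Rightarrow> ereal) \<Rightarrow> ('a \<Rightarrow> 'a) set \<Rightarrow> ('a \<Rightarrow> ereal) set" where
  "M_space_inv M s p q H = {u \<in> M_space M s p q. H_invariant M H u}"

definition N_space_inv ::
    "'a::metric_space measure \<Rightarrow> ('a \<Rightarrow> ereal) \<Rightarrow> ('a \<Rightarrow> ereal) \<Rightarrow> ('a \<Rightarrow> ereal) \<Rightarrow> ('a \<Rightarrow> 'a) set \<Rightarrow> ('a \<Rightarrow> ereal) set" where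
  "N_space_inv M s p q H = {u \<in> N_space M s p q. H_invariant M H u}"

text \<open>The sets \<open>Y\<close> and \<open>Z\<close> consist of representatives; \<open>nY\<close> and \<open>nZ\<close> are the quasi-norms.\<close>
definition compactly_embedded ::
    "'b::minus set \<Rightarrow> ('b \<Rightarrow> ennreal) \<Rightarrow> 'b set \<Rightarrow> ('b \<Rightarrow> ennreal) \<Rightarrow> bool" where
  "compactly_embedded Y nY Z nZ \<longleftrightarrow>
     Y \<subseteq> Z \<and>
     (\<forall>u\<in>Y. \<forall>\<epsilon>>0. \<exists>\<delta>>0. \<forall>v\<in>Y. nY (v - u) < \<delta> \<longrightarrow> nZ (v - u) < \<epsilon>) \<and>
     (\<forall>F\<subseteq>Y. (\<exists>K<\<infinity>. \<forall>u\<in>F. nY u \<le> K) \<longrightarrow>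
        (\<forall>\<epsilon>>0. \<exists>G. finite G \<and> G \<subseteq> Z \<and> (\<forall>u\<in>F. \<exists>v\<in>G. nZ (u - v) < \<epsilon>)))"

end

theory Submission
  imports Defs
begin

text \<open>The theorem reduces to one statement about pairs of real functions. Call \<open>(U, G)\<close> admissible if
  \<open>\<bar>U\<bar> \<le> G\<close>, the integral of \<open>G powr P\<close> is bounded by a fixed constant, and off a null set
  \<open>\<bar>U x - U y\<bar> \<le> dist x y powr S x * G x + dist x y powr S y * G y\<close> whenever \<open>dist x y < 1\<close>. A function
  \<open>u\<close> of the first kind of space gives such a pair through \<open>G = max \<bar>u\<bar> (SUP k. g k)\<close>, as every
  term of a sequence is below its \<open>q\<close>-norm. For the second kind the integrals of \<open>g k powr p\<close> are only
  bounded uniformly in \<open>k\<close>; giving up some smoothness, \<open>t \<lless> s\<close>, inserts a factor that decays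
  geometrically in \<open>k\<close>, and the supremum becomes integrable. Both embeddings therefore follow from the same
  compactness theorem, \<open>compactly_embedded_of_admissible\<close>, with smoothness \<open>s\<close> or \<open>t\<close>.

  Boundedness in \<open>L\<^sup>\<beta>\<close> rests on a pointwise estimate (\<open>pointwise_bound\<close>):
  \<open>\<bar>U x\<bar> \<le> C * (1 + G x) powr (1 - S x * P x / Q x + \<epsilon>)\<close> almost everywhere. By Chebyshev the set where
  \<open>G\<close> exceeds a level \<open>l\<close> has measure about \<open>l powr (-P)\<close>, so by lower regularity every ball of
  radius about \<open>l powr (-P/Q)\<close> contains a point with \<open>G \<le> l\<close>. Halving the level repeatedly one walks
  from \<open>x\<close> to a point where \<open>G\<close>, hence \<open>U\<close>, is bounded; the radii form a geometric series, so the walk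
  stays in a small ball, where the exponents are almost constant by uniform continuity, and the increments
  of \<open>U\<close> form a geometric series whose largest term is the right-hand side. Raising the estimate to a power \<open>\<beta> \<ge> P\<close>
  below the critical one, \<open>\<gamma> = P / (1 - S P / Q)\<close>, gives \<open>\<bar>U\<bar> powr \<beta> \<le> C * G powr P\<close>
  (\<open>higher_integrability\<close>).

  Since there is room both between \<open>P\<close> and \<open>\<beta>\<close> and between \<open>\<beta>\<close> and \<open>\<gamma>\<close>, an interpolation inequality for powers
  reduces total boundedness in \<open>L\<^sup>\<beta>\<close> to total boundedness in measure (\<open>totally_bounded_in_measure\<close>).
  Partition the space into cells of small diameter. On the set \<open>G \<le> A\<close>, whose complement has small measure, \<open>U\<close> is nearly
  constant on each cell, so on the finitely many cells of a large ball \<open>U\<close> is described up to a small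
  error by finitely many rounded values. Far away invariance takes over: a ball there has many disjoint
  copies under \<open>H\<close>, all carrying the same share of the integral of \<open>\<bar>U\<bar> powr P\<close>, so this share is tiny. If \<open>U\<close> were
  not small at some point of a distant cell with \<open>G \<le> A\<close>, it would be bounded below on the whole part of the cell where
  \<open>G \<le> A\<close>; this part then has less than half the measure of the cell and is outweighed by the part where
  \<open>A < G\<close> (\<open>cell_tail\<close>). Summing over the cells, the exceptional set has measure at most that of
  \<open>A < G\<close>.\<close>

section \<open>Powers, modulars and quasi-norms\<close>

lemma enn_powr_ennreal: "0 \<le> a \<Longrightarrow> enn_powr (ennreal a) t = ennreal (a powr t)"
  unfolding enn_powr_def by simp

lemma enn_powr_mono:
  assumes "a \<le> c" "0 \<le> t" shows "enn_powr a t \<le> enn_powr c t"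
proof (cases "c = \<infinity>")
  case False
  then have "c < top" by (simp add: less_top)
  then have "enn2real a \<le> enn2real c" "a \<noteq> \<infinity>" using assms(1) by (auto simp: enn2real_mono)
  then show ?thesis using False assms(2) unfolding enn_powr_def by (auto intro!: ennreal_leI powr_mono2)
qed (simp add: enn_powr_def)

lemma enn_powr_inverse:
  assumes "0 < t" shows "enn_powr (enn_powr a t) (1/t) = a"
proof (cases a)
  case (real c)
  then show ?thesis using assms by (simp add: enn_powr_ennreal powr_powr)
qed (simp add: enn_powr_def)

lemma enn_powr_mult:
  assumes "0 < c" "0 < t" shows "enn_powr (ennreal c * a) t = ennreal (c powr t) * enn_powr a t"
proof (cases a)
  case (real d)
  then show ?thesis using assms by (simp add: enn_powr_ennreal ennreal_mult[symmetric] powr_mult)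
next
  case top
  then show ?thesis using assms by (simp add: enn_powr_def ennreal_mult_top)
qed

lemma enn_powr_measurable [measurable]:
  assumes [measurable]: "f \<in> borel_measurable M" "T \<in> borel_measurable M"
  shows "(\<lambda>x. enn_powr (f x) (T x)) \<in> borel_measurable M"
proof -
  have "enn_powr a t = (if a < top then ennreal (enn2real a powr t) else \<infinity>)" for a t
    unfolding enn_powr_def by (simp add: less_top)
  then show ?thesis by simp
qed

lemma enn_powr_max_le: "enn_powr (max a c) t \<le> enn_powr a t + enn_powr c t"
  by (simp add: max_def)

text \<open>Each \<open>f n\<close> is the \<open>t\<close>-th root of a term of the series, hence below the \<open>t\<close>-th root of its sum; so is
  the supremum.\<close>
lemma enn_powr_SUP_le_suminf:
  assumes "0 < t" shows "enn_powr (SUP n::nat. f n) t \<le> (\<Sum>n. enn_powr (f n) t)"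
proof -
  let ?Y = "\<Sum>n. enn_powr (f n) t"
  have "f n \<le> enn_powr ?Y (1/t)" for n
  proof -
    have "enn_powr (f n) t \<le> ?Y" using sum_le_suminf[of "\<lambda>n. enn_powr (f n) t" "{n}"] by simp
    then have "enn_powr (enn_powr (f n) t) (1/t) \<le> enn_powr ?Y (1/t)" using assms by (intro enn_powr_mono) auto
    then show ?thesis using assms by (simp add: enn_powr_inverse)
  qed
  then have "(SUP n. f n) \<le> enn_powr ?Y (1/t)" by (rule SUP_least)
  then have "enn_powr (SUP n. f n) t \<le> enn_powr (enn_powr ?Y (1/t)) t" using assms by (intro enn_powr_mono) auto
  also have "\<dots> = ?Y" using enn_powr_inverse[of "1/t" ?Y] assms by simp
  finally show ?thesis .
qed

lemma le_infsum_ennreal: "(f :: 'b \<Rightarrow> ennreal) k \<le> (\<Sum>\<^sub>\<infinity>k. f k)"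
proof -
  have "infsum f {k} \<le> (\<Sum>\<^sub>\<infinity>k. f k)"
    by (rule infsum_mono_neutral) (auto intro: nonneg_summable_on_complete)
  then show ?thesis by simp
qed

text \<open>Through this bound, the same for every \<open>q\<close>, the supremum of a sequence can stand in for its inner norm.\<close>
lemma le_lq_norm:
  assumes "0 < q" shows "a k \<le> lq_norm q a"
proof (cases "q = \<infinity>")
  case True
  then show ?thesis unfolding lq_norm_def by (simp add: SUP_upper)
next
  case False
  then obtain t where t: "q = ereal t" "0 < t" using assms by (cases q) auto
  have "enn_powr (a k) t \<le> (\<Sum>\<^sub>\<infinity>k. enn_powr (a k) t)" by (rule le_infsum_ennreal)
  then have "enn_powr (enn_powr (a k) t) (1/t) \<le> enn_powr (\<Sum>\<^sub>\<infinity>k. enn_powr (a k) t) (1/t)"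
    using t(2) by (intro enn_powr_mono) auto
  then show ?thesis unfolding lq_norm_def using t by (simp add: enn_powr_inverse)
qed

lemma modular_mono_AE:
  assumes "AE x in M. f x \<le> g x" "\<And>x. 0 < p x"
  shows "modular M p f \<le> modular M p g"
  unfolding modular_def
proof (rule nn_integral_mono_AE)
  show "AE x in M. enn_powr (f x) (real_of_ereal (p x)) \<le> enn_powr (g x) (real_of_ereal (p x))"
    using assms(1)
  proof eventually_elim
    case (elim x)
    then show ?case using assms(2)[of x] by (intro enn_powr_mono real_of_ereal_pos) auto
  qed
qed

lemma divide_ennreal_mono: "0 < c \<Longrightarrow> c \<le> d \<Longrightarrow> (a::ennreal) / ennreal d \<le> a / ennreal c"
  unfolding divide_ennreal_def
  by (intro mult_left_mono) (auto simp: inverse_ennreal intro!: ennreal_leI le_imp_inverse_le)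

text \<open>The infimum defining the norm need not be attained, but the modular is monotone and so every larger constant
  is admissible in it.\<close>
lemma modular_le_of_Lp_norm_less:
  assumes "Lp_norm M p f < ennreal c" "\<And>x. 0 < p x"
  shows "modular M p (\<lambda>x. f x / ennreal c) \<le> 1"
proof -
  obtain d where d: "0 < d" "modular M p (\<lambda>x. f x / ennreal d) \<le> 1" "ennreal d < ennreal c"
    using assms(1) unfolding Lp_norm_def Inf_less_iff by auto
  then have "d \<le> c" by (simp add: ennreal_less_iff)
  then have "modular M p (\<lambda>x. f x / ennreal c) \<le> modular M p (\<lambda>x. f x / ennreal d)"
    using d(1) assms(2) by (intro modular_mono_AE) (auto intro: divide_ennreal_mono)
  then show ?thesis using d(2) by simp
qed

lemma Lp_norm_le:
  assumes "0 < c" "modular M p (\<lambda>x. f x / ennreal c) \<le> 1" shows "Lp_norm M p f \<le> ennreal c"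
  unfolding Lp_norm_def using assms by (intro Inf_lower) auto

section \<open>Bounded and log-Hoelder continuous exponents\<close>

lemma AE_essinf_le: "AE x in M. essinf M f \<le> f x"
proof -
  have "AE x in M. - f x \<le> esssup M (\<lambda>x. - f x)" by (rule esssup_AE)
  then show ?thesis unfolding essinf_def by eventually_elim (simp add: ereal_uminus_le_reorder)
qed

lemma essinf_posD:
  assumes "0 < essinf M f" shows "\<exists>d>0. AE x in M. ereal d \<le> f x"
proof -
  obtain d where d: "0 < ereal d" "ereal d < essinf M f" using ereal_dense2[OF assms] by blast
  have "AE x in M. ereal d \<le> f x"
    using AE_essinf_le[of M f] by eventually_elim (use d in auto)
  then show ?thesis using d by auto
qed

lemma bdd_exponents_bounds:
  assumes "p \<in> bdd_exponents M"
  shows "\<exists>pm pM. 0 < pm \<and> 0 < pM \<and> (AE x in M. ereal pm \<le> p x \<and> p x \<le> ereal pM)"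
proof -
  have "0 < essinf M p" and sup: "esssup M p < \<infinity>"
    using assms unfolding bdd_exponents_def exponents_def by auto
  from essinf_posD[OF this(1)] obtain pm where pm: "0 < pm" "AE x in M. ereal pm \<le> p x" by blast
  have "max 1 (esssup M p) < \<infinity>" using sup by (simp add: max_def)
  then obtain pM where pM: "max 1 (esssup M p) < ereal pM" using ereal_dense2 by blast
  have "AE x in M. p x \<le> ereal pM"
    using esssup_AE[of p M] by eventually_elim (use pM in auto)
  with pm(2) have "AE x in M. ereal pm \<le> p x \<and> p x \<le> ereal pM" by eventually_elim auto
  moreover have "ereal 1 < ereal pM" using pM by (simp add: one_ereal_def)
  then have "0 < pM" by simp
  ultimately show ?thesis using pm(1) by blast
qed

text \<open>Log-Hoelder continuity of \<open>1/p\<close> enters the proof only through this consequence. Where \<open>p\<close> is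
  bounded, \<open>\<bar>a - c\<bar> = a * c * \<bar>1/a - 1/c\<bar>\<close> transfers the modulus of continuity from \<open>1/p\<close> to \<open>p\<close>.\<close>
lemma log_exponents_uniform:
  assumes p: "p \<in> log_exponents M" and Z: "\<And>x. x \<notin> Z \<Longrightarrow> ereal pm \<le> p x \<and> p x \<le> ereal pM"
    and pm: "0 < pm" and \<epsilon>: "0 < \<epsilon>"
  shows "\<exists>\<rho>>0. \<forall>x\<in>-Z. \<forall>y\<in>-Z. dist x y < \<rho> \<longrightarrow> \<bar>real_of_ereal (p x) - real_of_ereal (p y)\<bar> < \<epsilon>"
proof -
  obtain C where C: "0 < C" "\<And>x y. \<bar>1 / p x - 1 / p y\<bar> \<le> ereal (C / ln (exp 1 + 1 / dist x y))"
    using p unfolding log_exponents_def by auto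
  \<comment> \<open>The radius \<open>exp (-K)\<close> makes the logarithm exceed \<open>K\<close>, and \<open>K\<close> is where the bound equals \<open>\<epsilon>\<close>.\<close>
  define K where "K = C * (\<bar>pM\<bar> + 1)^2 / \<epsilon>"
  have K: "0 < K" unfolding K_def using C(1) \<epsilon> by (intro divide_pos_pos mult_pos_pos) auto
  show ?thesis
  proof (intro exI[of _ "exp (-K)"] conjI ballI impI)
    fix x y assume xy: "x \<in> -Z" "y \<in> -Z" "dist x y < exp (-K)"
    obtain a c where ac: "p x = ereal a" "pm \<le> a" "a \<le> pM" "p y = ereal c" "pm \<le> c" "c \<le> pM"
      using Z[of x] Z[of y] xy by (cases "p x"; cases "p y") auto
    show "\<bar>real_of_ereal (p x) - real_of_ereal (p y)\<bar> < \<epsilon>"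
    proof (cases "x = y")
      case False
      define l where "l = ln (exp 1 + 1 / dist x y)"
      have "exp K < 1 / dist x y" using xy(3) False by (simp add: exp_minus field_simps)
      also have "\<dots> < exp 1 + 1 / dist x y" by simp
      finally have "ln (exp K) < l" unfolding l_def by (subst ln_less_cancel_iff) (auto simp: add_pos_nonneg)
      then have l: "K < l" by simp
      have "\<bar>1/a - 1/c\<bar> \<le> C / l" using C(2)[of x y] ac pm unfolding l_def by (simp add: one_ereal_def)
      moreover have "a - c = a * c * (1/c - 1/a)" using ac pm by (simp add: field_simps)
      ultimately have "\<bar>a - c\<bar> \<le> a * c * (C / l)"
        using ac pm by (simp only: abs_mult abs_minus_commute[of "1/c"]) (intro mult_mono, auto)
      also have "\<dots> \<le> (\<bar>pM\<bar> + 1) * (\<bar>pM\<bar> + 1) * (C / l)"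
        using ac pm C(1) l K by (intro mult_right_mono mult_mono) auto
      also have "\<dots> < (\<bar>pM\<bar> + 1) * (\<bar>pM\<bar> + 1) * (C / K)"
        using l K C(1) by (intro mult_strict_left_mono divide_strict_left_mono) auto
      also have "\<dots> = \<epsilon>" unfolding K_def using C(1) \<epsilon> by (simp add: power2_eq_square add_pos_nonneg)
      finally show ?thesis using ac by simp
    qed (use \<epsilon> in simp)
  qed simp
qed

lemma ex_dyadic_scale:
  assumes "0 < d" "d < 1"
  shows "\<exists>n::nat. (2::real) powi (- int n - 1) \<le> d \<and> d < 2 powi (- int n)"
proof -
  have ex: "\<exists>n. (1/2::real) ^ n \<le> d" using real_arch_pow_inv[OF assms(1), of "1/2"] by (auto intro: less_imp_le)
  define n where "n = (LEAST n. (1/2::real) ^ n \<le> d)"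
  have n: "(1/2::real) ^ n \<le> d" unfolding n_def using ex by (rule LeastI_ex)
  have "n \<noteq> 0" using n assms by (cases n) auto
  then obtain m where m: "n = Suc m" by (cases n) auto
  have "\<not> (1/2::real) ^ m \<le> d" using not_less_Least[of m "\<lambda>n. (1/2::real) ^ n \<le> d"] m unfolding n_def by auto
  then show ?thesis using n m
    by (intro exI[of _ m]) (simp add: power_int_minus power_int_diff power_divide power_one_over field_simps)
qed

section \<open>Partitions of doubling spaces into cells\<close>

text \<open>Iterating the doubling condition \<open>k\<close> times covers a ball of radius \<open>R\<close> by finitely many of radius
  \<open>R / 2 ^ k\<close>.\<close>
lemma doubling_totally_bounded:
  assumes dbl: "geometrically_doubling TYPE('a::metric_space)" and e: "0 < e"
  shows "\<exists>C. finite C \<and> ball (x::'a) R \<subseteq> (\<Union>c\<in>C. ball c e)"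
proof -
  from dbl have step: "\<exists>C. finite C \<and> ball y t \<subseteq> (\<Union>c\<in>C. ball c (t/2))" if "0 < t" for y :: 'a and t
    using that unfolding geometrically_doubling_def by meson
  show ?thesis
  proof (cases "0 < R")
    case R: True
    have cover: "\<exists>C. finite C \<and> ball x R \<subseteq> (\<Union>c\<in>C. ball c (R / 2 ^ k))" for k
    proof (induction k)
      case 0
      show ?case by (rule exI[of _ "{x}"]) auto
    next
      case (Suc k)
      then obtain C where C: "finite C" "ball x R \<subseteq> (\<Union>c\<in>C. ball c (R / 2 ^ k))" by auto
      have "\<forall>c::'a. \<exists>D. finite D \<and> ball c (R / 2 ^ k) \<subseteq> (\<Union>d\<in>D. ball d (R / 2 ^ k / 2))"
        by (intro allI step) (use R in simp)
      from choice[OF this] obtain D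
        where D: "\<forall>c::'a. finite (D c) \<and> ball c (R / 2 ^ k) \<subseteq> (\<Union>d\<in>D c. ball d (R / 2 ^ k / 2))" ..
      have "ball x R \<subseteq> (\<Union>d\<in>(\<Union>c\<in>C. D c). ball d (R / 2 ^ k / 2))"
      proof
        fix y assume "y \<in> ball x R"
        then obtain c where "c \<in> C" "y \<in> ball c (R / 2 ^ k)" using C(2) by auto
        then obtain d where "d \<in> D c" "y \<in> ball d (R / 2 ^ k / 2)" using D by (meson UN_iff subsetD)
        then show "y \<in> (\<Union>d\<in>(\<Union>c\<in>C. D c). ball d (R / 2 ^ k / 2))" using \<open>c \<in> C\<close> by blast
      qed
      then show ?case using C(1) D by (intro exI[of _ "\<Union>c\<in>C. D c"]) (simp add: mult.commute)
    qed
    obtain k where k: "R / e < 2 ^ k" using real_arch_pow[of 2 "R / e"] by auto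
    obtain C where C: "finite C" "ball x R \<subseteq> (\<Union>c\<in>C. ball c (R / 2 ^ k))" using cover[of k] by blast
    have "R / 2 ^ k \<le> e" using k e by (simp add: field_simps)
    then have "(\<Union>c\<in>C. ball c (R / 2 ^ k)) \<subseteq> (\<Union>c\<in>C. ball c e)" by (intro UN_mono subset_ball) auto
    from order_trans[OF C(2) this] show ?thesis using C(1) by (intro exI[of _ C] conjI)
  next
    case False
    then have "ball x R = {}" by simp
    then show ?thesis by (intro exI[of _ "{}"]) auto
  qed
qed

lemma ex_maximal_separated:
  "\<exists>A. (\<forall>a\<in>A. \<forall>c\<in>A. a \<noteq> c \<longrightarrow> \<rho> \<le> dist a c) \<and> (\<forall>x::'a::metric_space. \<exists>a\<in>A. dist a x < \<rho>)" if "0 < \<rho>"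
proof -
  let ?sep = "\<lambda>A::'a set. \<forall>a\<in>A. \<forall>c\<in>A. a \<noteq> c \<longrightarrow> \<rho> \<le> dist a c"
  have "\<exists>A\<in>{A. ?sep A}. \<forall>B\<in>{A. ?sep A}. A \<subseteq> B \<longrightarrow> B = A"
  proof (rule subset_Zorn)
    fix \<C> assume "subset.chain {A. ?sep A} \<C>"
    then have ch: "\<C> \<subseteq> {A. ?sep A}" "\<And>A B. A \<in> \<C> \<Longrightarrow> B \<in> \<C> \<Longrightarrow> A \<subseteq> B \<or> B \<subseteq> A"
      unfolding subset.chain_def by blast+
    have "?sep (\<Union>\<C>)"
    proof (intro ballI impI)
      fix a c assume "a \<in> \<Union>\<C>" "c \<in> \<Union>\<C>" "a \<noteq> c"
      then obtain A B where "A \<in> \<C>" "B \<in> \<C>" "a \<in> A" "c \<in> B" by auto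
      then show "\<rho> \<le> dist a c" using ch(1) ch(2)[of A B] \<open>a \<noteq> c\<close> by blast
    qed
    then show "\<exists>U\<in>{A. ?sep A}. \<forall>X\<in>\<C>. X \<subseteq> U" by (intro bexI[of _ "\<Union>\<C>"]) auto
  qed
  then obtain A where A: "?sep A" "\<And>B. ?sep B \<Longrightarrow> A \<subseteq> B \<Longrightarrow> B = A" by auto
  have "\<exists>a\<in>A. dist a x < \<rho>" for x
  proof (rule ccontr)
    assume "\<not> ?thesis"
    then have far: "\<rho> \<le> dist a x" if "a \<in> A" for a using that by force
    then have "?sep (insert x A)" using A(1) by (auto simp: dist_commute)
    then have "x \<in> A" using A(2)[of "insert x A"] by blast
    then show False using far[of x] that by simp
  qed
  then show ?thesis using A(1) by blast
qed

text \<open>A Voronoi-like partition around a maximal separated set. Each cell keeps the ball of half the radius around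
  its centre, which bounds its measure from below; points in none of these balls go to the first centre,
  in an enumeration, that is close enough. Disjointness of the cells replaces bounded overlap of balls.\<close>
lemma ex_cell_partition:
  assumes dbl: "geometrically_doubling TYPE('a::metric_space)" and \<rho>: "0 < \<rho>"
  shows "\<exists>(A::'a set) V. countable A \<and> (\<forall>x R. finite (A \<inter> ball x R)) \<and>
    (\<forall>a\<in>A. V a \<in> sets borel \<and> ball a (\<rho>/2) \<subseteq> V a \<and> V a \<subseteq> ball a \<rho>) \<and>
    disjoint_family_on V A \<and> (\<Union>a\<in>A. V a) = UNIV"
proof -
  obtain A :: "'a set" where sep: "\<And>a c. a \<in> A \<Longrightarrow> c \<in> A \<Longrightarrow> a \<noteq> c \<Longrightarrow> \<rho> \<le> dist a c"
    and max: "\<And>x. \<exists>a\<in>A. dist a x < \<rho>"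
    using ex_maximal_separated[OF \<rho>] by metis
  have fin: "finite (A \<inter> ball x R)" for x R
  proof -
    obtain C where C: "finite C" "ball x R \<subseteq> (\<Union>c\<in>C. ball c (\<rho>/2))"
      using doubling_totally_bounded[OF dbl, of "\<rho>/2" x R] \<rho> by auto
    then have "\<forall>a\<in>A \<inter> ball x R. \<exists>c\<in>C. dist c a < \<rho>/2" by (auto simp: subset_iff)
    then obtain f where f: "\<And>a. a \<in> A \<inter> ball x R \<Longrightarrow> f a \<in> C \<and> dist (f a) a < \<rho>/2" by metis
    have "inj_on f (A \<inter> ball x R)"
    proof (rule inj_onI, rule ccontr)
      fix a c assume ac: "a \<in> A \<inter> ball x R" "c \<in> A \<inter> ball x R" "f a = f c" "a \<noteq> c"
      have "dist a c \<le> dist (f a) a + dist (f a) c" by (rule dist_triangle3)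
      then show False using f[OF ac(1)] f[OF ac(2)] ac(3) sep[of a c] ac by auto
    qed
    then show ?thesis using f C(1) by (rule_tac inj_on_finite[of f _ C]) auto
  qed
  have "A = (\<Union>n::nat. A \<inter> ball undefined (real n))"
    using reals_Archimedean2 by fastforce
  moreover have "countable (\<Union>n::nat. A \<inter> ball undefined (real n))"
    using fin by (intro countable_UN) (auto intro: countable_finite)
  ultimately have cA: "countable A" by simp
  define idx where "idx = to_nat_on A"
  have idx: "inj_on idx A" unfolding idx_def using cA by (rule inj_on_to_nat_on)
  define V where "V a = ball a (\<rho>/2) \<union>
    (ball a \<rho> - (\<Union>c\<in>A. ball c (\<rho>/2)) - (\<Union>c\<in>{c\<in>A. idx c < idx a}. ball c \<rho>))" for a
  have "V a \<in> sets borel" for a unfolding V_def by (intro sets.Un sets.Diff borel_open open_UN) auto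
  moreover have "ball a (\<rho>/2) \<subseteq> V a" "V a \<subseteq> ball a \<rho>" for a unfolding V_def using \<rho> by auto
  moreover have "disjoint_family_on V A"
    unfolding disjoint_family_on_def
  proof (intro ballI impI)
    fix a c assume ac: "a \<in> A" "c \<in> A" "a \<noteq> c"
    have "ball a (\<rho>/2) \<inter> ball c (\<rho>/2) = {}"
    proof (rule ccontr)
      assume "\<not> ?thesis"
      then obtain x where x: "dist a x < \<rho>/2" "dist c x < \<rho>/2" by auto
      have "dist a c \<le> dist a x + dist c x" by (rule dist_triangle2)
      then show False using x sep[OF ac] by simp
    qed
    moreover have "idx a < idx c \<or> idx c < idx a" using idx ac by (metis inj_onD linorder_neqE_nat)
    moreover have V_iff: "x \<in> V a' \<longleftrightarrow> x \<in> ball a' (\<rho>/2) \<or>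
        x \<in> ball a' \<rho> \<and> (\<forall>c\<in>A. x \<notin> ball c (\<rho>/2)) \<and> (\<forall>c\<in>A. idx c < idx a' \<longrightarrow> x \<notin> ball c \<rho>)" for x a'
      unfolding V_def by blast
    have "ball d (\<rho>/2) \<subseteq> ball d \<rho>" for d :: 'a using \<rho> by (intro subset_ball) auto
    ultimately have "\<not> (x \<in> V a \<and> x \<in> V c)" for x using ac V_iff[of x a] V_iff[of x c] by blast
    then show "V a \<inter> V c = {}" by blast
  qed
  moreover have "x \<in> (\<Union>a\<in>A. V a)" for x
  proof (cases "x \<in> (\<Union>c\<in>A. ball c (\<rho>/2))")
    case True
    then show ?thesis unfolding V_def by blast
  next
    case False
    obtain a where a: "a \<in> A" "dist a x < \<rho>" "\<And>c. c \<in> A \<and> dist c x < \<rho> \<Longrightarrow> idx a \<le> idx c"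
      using ex_has_least_nat[of "\<lambda>a. a \<in> A \<and> dist a x < \<rho>" _ idx] max[of x] by blast
    have "x \<notin> (\<Union>c\<in>{c\<in>A. idx c < idx a}. ball c \<rho>)" using a(3) by force
    then have "x \<in> V a" unfolding V_def using False a(2) by auto
    then show ?thesis using a(1) by blast
  qed
  then have "(\<Union>a\<in>A. V a) = UNIV" by blast
  ultimately show ?thesis using cA fin by (intro exI[of _ A] exI[of _ V] conjI allI ballI)
qed

section \<open>Functions with a gradient: the pointwise estimate\<close>

text \<open>The exponents are real functions here. The bounds and the uniform continuity hold only off a null set
  \<open>Z\<close>, because the extended exponents that they come from are bounded almost everywhere;
  \<open>gap\<close> is the subcriticality \<open>S P \<lless> Q\<close>.\<close>
locale gradient_space =
  fixes M :: "'a::metric_space measure"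
    and P Q S :: "'a \<Rightarrow> real"
    and pm pM QM sm \<delta> b :: real
    and Z :: "'a set"
  assumes sets_M [measurable_cong]: "sets M = sets borel"
    and ball_pos: "\<And>x r. 0 < r \<Longrightarrow> 0 < emeasure M (ball x r)"
    and P_measurable [measurable]: "P \<in> borel_measurable M"
    and pm_pos: "0 < pm" and sm_pos: "0 < sm" and \<delta>_pos: "0 < \<delta>" and b_pos: "0 < b"
    and Z_null: "Z \<in> null_sets M"
    and P_bounds: "\<And>x. x \<notin> Z \<Longrightarrow> pm \<le> P x \<and> P x \<le> pM"
    and S_bounds: "\<And>x. x \<notin> Z \<Longrightarrow> sm \<le> S x \<and> S x \<le> 1"
    and Q_le: "\<And>x. x \<notin> Z \<Longrightarrow> Q x \<le> QM"
    and gap: "\<And>x. x \<notin> Z \<Longrightarrow> S x * P x + \<delta> \<le> Q x"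
    and P_uniform: "\<And>\<epsilon>. 0 < \<epsilon> \<Longrightarrow> \<exists>\<rho>>0. \<forall>x\<in>-Z. \<forall>y\<in>-Z. dist x y < \<rho> \<longrightarrow> \<bar>P x - P y\<bar> < \<epsilon>"
    and Q_uniform: "\<And>\<epsilon>. 0 < \<epsilon> \<Longrightarrow> \<exists>\<rho>>0. \<forall>x\<in>-Z. \<forall>y\<in>-Z. dist x y < \<rho> \<longrightarrow> \<bar>Q x - Q y\<bar> < \<epsilon>"
    and S_uniform: "\<And>\<epsilon>. 0 < \<epsilon> \<Longrightarrow> \<exists>\<rho>>0. \<forall>x\<in>-Z. \<forall>y\<in>-Z. dist x y < \<rho> \<longrightarrow> \<bar>S x - S y\<bar> < \<epsilon>"
    and lower_regular:
      "\<And>x r. 0 < r \<Longrightarrow> r \<le> 1 \<Longrightarrow> ennreal (b * r powr Q x) \<le> emeasure M (ball x r)"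
begin

lemma space_M: "space M = UNIV"
  using sets_eq_imp_space_eq[OF sets_M] by simp

text \<open>Only distances below \<open>1\<close> matter: the functions are controlled at a fixed scale by the condition
  \<open>\<bar>U\<bar> \<le> G\<close> below.\<close>
definition gradient_off :: "'a set \<Rightarrow> ('a \<Rightarrow> real) \<Rightarrow> ('a \<Rightarrow> real) \<Rightarrow> bool" where
  "gradient_off N U G \<longleftrightarrow>
     (\<forall>x\<in>-N. \<forall>y\<in>-N. dist x y < 1 \<longrightarrow>
        \<bar>U x - U y\<bar> \<le> dist x y powr S x * G x + dist x y powr S y * G y)"

text \<open>Requiring \<open>\<bar>U\<bar> \<le> G\<close> absorbs the bound for \<open>U\<close> in \<open>L\<^sup>P\<close> into the one for the gradient: at a
  point where \<open>G\<close> is bounded, so is \<open>U\<close>.\<close>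
definition admissible :: "('a \<Rightarrow> real) \<Rightarrow> ('a \<Rightarrow> real) \<Rightarrow> real \<Rightarrow> bool" where
  "admissible U G L \<longleftrightarrow>
     U \<in> borel_measurable M \<and> G \<in> borel_measurable M \<and> (\<forall>x. \<bar>U x\<bar> \<le> G x) \<and>
     (\<integral>\<^sup>+x. ennreal (G x powr P x) \<partial>M) \<le> ennreal L \<and>
     (\<exists>N\<in>null_sets M. gradient_off N U G)"

text \<open>Chebyshev against lower regularity: were \<open>G\<close> above the level \<open>\<tau>\<close> on almost all of the ball, the
  ball alone would contribute \<open>b * r powr q' * \<tau> powr p'\<close> to the integral, which exceeds \<open>L\<close>.\<close>
lemma ex_good_point:
  assumes G [measurable]: "G \<in> borel_measurable M" and GL: "(\<integral>\<^sup>+x. ennreal (G x powr P x) \<partial>M) \<le> ennreal L"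
    and N: "N \<in> null_sets M" and L: "0 \<le> L"
    and r: "0 < r" "r \<le> 1" and Qz: "Q z \<le> q'"
    and P': "\<And>y. y \<in> ball z r \<Longrightarrow> y \<notin> N \<Longrightarrow> p' \<le> P y"
    and p': "0 \<le> p'" and lam: "1 \<le> \<tau>"
    and large: "L < b * r powr q' * \<tau> powr p'"
  shows "\<exists>y\<in>ball z r. y \<notin> N \<and> G y \<le> \<tau>"
proof (rule ccontr)
  assume "\<not> ?thesis"
  then have big: "\<tau> < G y" if "y \<in> ball z r" "y \<notin> N" for y
    using that by force
  have "ennreal (b * r powr q' * \<tau> powr p') \<le> ennreal (b * r powr Q z) * ennreal (\<tau> powr p')"
  proof -
    have "r powr q' \<le> r powr Q z"
      using r Qz by (intro powr_mono') auto
    then have "b * r powr q' * \<tau> powr p' \<le> b * r powr Q z * \<tau> powr p'"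
      using b_pos by (intro mult_right_mono mult_left_mono) auto
    then show ?thesis
      using b_pos by (subst ennreal_mult[symmetric]) (auto intro!: ennreal_leI)
  qed
  also have "\<dots> \<le> emeasure M (ball z r) * ennreal (\<tau> powr p')"
    using lower_regular[OF r] by (intro mult_right_mono) auto
  also have "\<dots> = (\<integral>\<^sup>+x. ennreal (\<tau> powr p') * indicator (ball z r) x \<partial>M)"
    using sets_M by (subst nn_integral_cmult_indicator) (auto simp: mult.commute)
  also have "\<dots> \<le> (\<integral>\<^sup>+x. ennreal (G x powr P x) \<partial>M)"
  proof (rule nn_integral_mono_AE)
    have "AE x in M. x \<notin> N"
      using N by (rule AE_not_in)
    then show "AE x in M. ennreal (\<tau> powr p') * indicator (ball z r) x \<le> ennreal (G x powr P x)"
    proof eventually_elim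
      case (elim x)
      show ?case
      proof (cases "x \<in> ball z r")
        case True
        have "\<tau> powr p' \<le> \<tau> powr P x"
          using P'[OF True elim] lam by (intro powr_mono) auto
        also have "\<dots> \<le> G x powr P x"
          using big[OF True elim] P'[OF True elim] p' lam by (intro powr_mono2) auto
        finally show ?thesis
          using True by (simp add: ennreal_leI)
      qed auto
    qed
  qed
  also have "\<dots> \<le> ennreal L" by (rule GL)
  finally show False
    using large L by (simp add: ennreal_le_iff)
qed

text \<open>The walk from a point with \<open>G \<le> \<Lambda> * 2 ^ n\<close> down to one with \<open>G \<le> \<Lambda>\<close>. To pass from level \<open>2 * l\<close> to
  level \<open>l\<close> a step of length \<open>r = B * l powr (-a)\<close> suffices by \<open>ex_good_point\<close>, and it changes \<open>U\<close> by at most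
  \<open>r powr s' * 3 * l\<close>, a multiple of \<open>l powr \<kappa>\<close>. The induction carries closed forms in place of the geometric
  sums: \<open>lam_large\<close> says that a step fits into the decrease of the allowed distance from
  \<open>x\<close>, and \<open>c_large\<close> that it fits into the increase of \<open>c * (\<Lambda> * 2 ^ n) powr \<kappa>\<close>.\<close>
lemma descent:
  assumes G [measurable]: "G \<in> borel_measurable M" and GL: "(\<integral>\<^sup>+x. ennreal (G x powr P x) \<partial>M) \<le> ennreal L"
    and UG: "\<And>x. \<bar>U x\<bar> \<le> G x" and L: "0 \<le> L"
    and N: "N \<in> null_sets M" and grad: "gradient_off N U G"
    and loc: "\<And>y. dist x y < \<rho> \<Longrightarrow> y \<notin> N \<Longrightarrow> p' \<le> P y \<and> Q y \<le> q' \<and> s' \<le> S y"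
    and \<rho>: "0 < \<rho>" "\<rho> \<le> 1"
    and p': "0 < p'" and q': "0 < q'" and s': "0 < s'" and lam: "1 \<le> \<Lambda>" and B: "0 < B" and c: "0 \<le> c"
    and B_large: "L < b * B powr q'"
    and a: "a = p' / q'" and \<kappa>: "\<kappa> = 1 - s' * a"
    and lam_large: "B * \<Lambda> powr (-a) \<le> (\<rho>/2) * (1 - 2 powr (-a))"
    and c_large: "3 * B powr s' \<le> c * (2 powr \<kappa> - 1)"
  shows "z \<notin> N \<Longrightarrow> dist x z < (\<rho>/2) * (1 + 2 powr (- a * real n)) \<Longrightarrow> G z \<le> \<Lambda> * 2 ^ n \<Longrightarrow>
    \<bar>U z\<bar> \<le> \<Lambda> + c * (\<Lambda> * 2 ^ n) powr \<kappa>"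
proof (induction n arbitrary: z)
  case 0
  have "\<bar>U z\<bar> \<le> \<Lambda>" using UG[of z] 0 by simp
  moreover have "0 \<le> c * (\<Lambda> * 2 ^ 0) powr \<kappa>" using c by simp
  ultimately show ?case by linarith
next
  case (Suc n)
  have a0: "0 < a" using a p' q' by simp
  define l where "l = \<Lambda> * 2 ^ n"
  have l1: "1 \<le> l" unfolding l_def using lam by (simp add: mult_ge1_I)
  define r where "r = B * l powr (-a)"
  have r0: "0 < r" unfolding r_def using B l1 by simp
  have l_powr: "l powr t = \<Lambda> powr t * 2 powr (t * real n)" for t
    unfolding l_def using lam by (simp add: powr_mult powr_realpow[symmetric] powr_powr mult.commute)
  have step: "r \<le> (\<rho>/2) * (2 powr (- a * real n) - 2 powr (- a * real (Suc n)))"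
  proof -
    have "r = (B * \<Lambda> powr (-a)) * 2 powr (- a * real n)"
      unfolding r_def l_powr by simp
    also have "\<dots> \<le> ((\<rho>/2) * (1 - 2 powr (-a))) * 2 powr (- a * real n)"
      using lam_large by (intro mult_right_mono) auto
    also have "\<dots> = (\<rho>/2) * (2 powr (- a * real n) - 2 powr (- a * real (Suc n)))"
      by (simp add: algebra_simps powr_add[symmetric])
    finally show ?thesis .
  qed
  have "2 powr (- a * real n) \<le> 2 powr 0" using a0 by (intro powr_mono) auto
  then have le1: "2 powr (- a * real n) \<le> 1" by simp
  have inside: "dist x y < (\<rho>/2) * (1 + 2 powr (- a * real n))" if "dist z y < r" for y
  proof -
    have "dist x y \<le> dist x z + dist z y" by (rule dist_triangle)
    also have "\<dots> < (\<rho>/2) * (1 + 2 powr (- a * real (Suc n))) + r" using Suc.prems(2) that by linarith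
    also have "\<dots> \<le> (\<rho>/2) * (1 + 2 powr (- a * real n))" using step by (simp add: algebra_simps)
    finally show ?thesis .
  qed
  have inside': "dist x y < \<rho>" if "dist z y < r" for y
  proof -
    have "(\<rho>/2) * (1 + 2 powr (- a * real n)) \<le> (\<rho>/2) * 2" using le1 \<rho> by (intro mult_left_mono) auto
    then show ?thesis using inside[OF that] by simp
  qed
  have "(\<rho>/2) * (2 powr (- a * real n) - 2 powr (- a * real (Suc n))) \<le> (\<rho>/2) * 1"
    using le1 \<rho> by (intro mult_left_mono) (auto intro: add_increasing2 order_trans[OF _ le1])
  then have r1: "r \<le> 1" using step \<rho> by linarith
  \<comment> \<open>The length \<open>r\<close> is chosen such that the level cancels in the condition of \<open>ex_good_point\<close>.\<close>
  have rq: "b * r powr q' * l powr p' = b * B powr q'"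
  proof -
    have "(l powr (-a)) powr q' * l powr p' = l powr 0"
      unfolding powr_powr powr_add[symmetric] using q' by (simp add: a)
    then show ?thesis using B l1 unfolding r_def by (simp add: powr_mult)
  qed
  have zloc: "p' \<le> P z" "Q z \<le> q'" "s' \<le> S z"
    using loc[of z] inside'[of z] r0 Suc.prems(1) by auto
  obtain y where y: "y \<in> ball z r" "y \<notin> N" "G y \<le> l"
    using ex_good_point[OF G GL N L r0 r1 zloc(2), of p' l] loc inside' p' l1 B_large rq by auto
  then have zy: "dist z y < r" by simp
  have Uy: "\<bar>U y\<bar> \<le> \<Lambda> + c * l powr \<kappa>"
    using Suc.IH[OF y(2) inside[OF zy]] y(3) unfolding l_def by simp
  have yloc: "s' \<le> S y" using loc[OF inside'[OF zy] y(2)] by simp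
  have dr: "dist z y powr t \<le> r powr s'" if "s' \<le> t" for t
  proof -
    have "dist z y powr t \<le> r powr t" using zy that s' by (intro powr_mono2) auto
    also have "\<dots> \<le> r powr s'" using that r0 r1 by (intro powr_mono') auto
    finally show ?thesis .
  qed
  have G0: "0 \<le> G t" for t using UG[of t] by linarith
  have "\<bar>U z - U y\<bar> \<le> dist z y powr S z * G z + dist z y powr S y * G y"
    using grad Suc.prems(1) y(2) zy r1 unfolding gradient_off_def by auto
  also have "\<dots> \<le> r powr s' * (2 * l) + r powr s' * l"
    using dr[OF zloc(3)] dr[OF yloc] y(3) Suc.prems(3) G0
    by (intro add_mono mult_mono) (auto simp: l_def)
  also have "\<dots> = 3 * (r powr s' * l)" by simp
  also have "r powr s' * l = B powr s' * l powr \<kappa>"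
  proof -
    have "l powr \<kappa> = l powr (- a * s') * l powr 1"
      unfolding powr_add[symmetric] \<kappa> by (simp add: algebra_simps)
    then show ?thesis
      unfolding r_def using B l1 by (simp add: powr_mult powr_powr)
  qed
  finally have "\<bar>U z - U y\<bar> \<le> (3 * B powr s') * l powr \<kappa>" by simp
  also have "\<dots> \<le> c * (2 powr \<kappa> - 1) * l powr \<kappa>" using c_large by (intro mult_right_mono) auto
  also have "\<dots> = c * (\<Lambda> * 2 ^ Suc n) powr \<kappa> - c * l powr \<kappa>"
    unfolding l_def using lam by (simp add: powr_mult algebra_simps)
  finally show ?case using Uy by linarith
qed

text \<open>In a ball of uniform radius \<open>\<rho>\<close> around \<open>x\<close> the exponents differ from their values at \<open>x\<close> by at most \<open>e\<close>, so
  \<open>descent\<close> applies with \<open>P x - e\<close>, \<open>Q x + e\<close> and \<open>S x - e\<close>. All constants must be independent of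
  \<open>x\<close>; they are expressed through the worst values \<open>a0\<close> and \<open>\<kappa>0\<close> of the two rates
  \<open>a\<close> and \<open>\<kappa>\<close>. Replacing the exponents costs at most \<open>\<epsilon>\<close> in the power of \<open>1 + G x\<close>.\<close>
lemma pointwise_bound:
  assumes \<epsilon>: "0 < \<epsilon>" and L: "0 \<le> L"
  shows "\<exists>C\<ge>1. \<forall>U G. admissible U G L \<longrightarrow>
    (AE x in M. \<bar>U x\<bar> \<le> C * (1 + G x) powr (1 - S x * P x / Q x + \<epsilon>))"
proof -
  obtain x1 where x1: "x1 \<notin> Z"
  proof -
    have "Z \<noteq> UNIV" using Z_null ball_pos[of 1 undefined] 
      by (metis emeasure_eq_0 less_irrefl null_setsD1 null_setsD2 subset_UNIV zero_less_one)
    then show ?thesis using that by blast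
  qed
  have pM: "0 < pM" using P_bounds[OF x1] pm_pos by linarith
  have SP0: "0 \<le> S x * P x" if "x \<notin> Z" for x
    using S_bounds[OF that] P_bounds[OF that] sm_pos pm_pos by simp
  have QM: "\<delta> \<le> QM" using gap[OF x1] SP0[OF x1] Q_le[OF x1] by linarith
  define e where "e = Min {1, pm/2, sm/2, \<epsilon> * \<delta> / (2 + pM)}"
  have e: "0 < e" "e \<le> 1" "e \<le> pm/2" "e \<le> sm/2" "e \<le> \<epsilon> * \<delta> / (2 + pM)"
  proof -
    show "0 < e" unfolding e_def using \<epsilon> \<delta>_pos pm_pos sm_pos pM by auto
    have m: "e \<le> t" if "t \<in> {1, pm/2, sm/2, \<epsilon> * \<delta> / (2 + pM)}" for t
      unfolding e_def by (rule Min_le[OF _ that]) simp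
    show "e \<le> 1" "e \<le> pm/2" "e \<le> sm/2" "e \<le> \<epsilon> * \<delta> / (2 + pM)" by (rule m; simp)+
  qed
  obtain \<rho>1 \<rho>2 \<rho>3 where \<rho>s: "0 < \<rho>1" "0 < \<rho>2" "0 < \<rho>3"
    "\<And>x y. x \<notin> Z \<Longrightarrow> y \<notin> Z \<Longrightarrow> dist x y < \<rho>1 \<Longrightarrow> \<bar>P x - P y\<bar> < e"
    "\<And>x y. x \<notin> Z \<Longrightarrow> y \<notin> Z \<Longrightarrow> dist x y < \<rho>2 \<Longrightarrow> \<bar>Q x - Q y\<bar> < e"
    "\<And>x y. x \<notin> Z \<Longrightarrow> y \<notin> Z \<Longrightarrow> dist x y < \<rho>3 \<Longrightarrow> \<bar>S x - S y\<bar> < e"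
    using P_uniform[OF e(1)] Q_uniform[OF e(1)] S_uniform[OF e(1)] by auto
  define \<rho> where "\<rho> = Min {1, \<rho>1, \<rho>2, \<rho>3}"
  have \<rho>: "0 < \<rho>" "\<rho> \<le> 1" "\<rho> \<le> \<rho>1" "\<rho> \<le> \<rho>2" "\<rho> \<le> \<rho>3"
    unfolding \<rho>_def using \<rho>s(1-3) by auto
  define a0 where "a0 = (pm/2) / (QM + 1)"
  have a0: "0 < a0" unfolding a0_def using pm_pos QM \<delta>_pos by simp
  define \<kappa>0 where "\<kappa>0 = \<delta> / QM"
  have \<kappa>0: "0 < \<kappa>0" unfolding \<kappa>0_def using \<delta>_pos QM by simp
  \<comment> \<open>As \<open>\<delta> \<le> q'\<close>, this gives \<open>b * B powr q' \<ge> b + L\<close> for every \<open>q'\<close> that occurs.\<close>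
  define B where "B = (1 + L / b) powr (1 / \<delta>)"
  have Lb: "1 \<le> 1 + L / b" using L b_pos by simp
  have B1: "1 \<le> B" unfolding B_def using Lb \<delta>_pos by (intro ge_one_powr_ge_zero) auto
  define D where "D = (\<rho>/2) * (1 - 2 powr (-a0))"
  have "2 powr (-a0) < 2 powr 0" using a0 by (intro powr_less_mono) auto
  then have D: "0 < D" unfolding D_def using \<rho> by simp
  \<comment> \<open>At least the solution of \<open>B * \<Lambda> powr (-a0) = D\<close>: the last step of the walk, the longest one, is then short enough.\<close>
  define \<Lambda> where "\<Lambda> = max 1 ((B / D) powr (1 / a0))"
  have lam: "1 \<le> \<Lambda>" "(B / D) powr (1 / a0) \<le> \<Lambda>" unfolding \<Lambda>_def by auto
  have "2 powr 0 < 2 powr \<kappa>0" using \<kappa>0 by (intro powr_less_mono) auto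
  then have two: "0 < 2 powr \<kappa>0 - 1" by simp
  define c where "c = 3 * B / (2 powr \<kappa>0 - 1)"
  have c: "0 < c" unfolding c_def using B1 two by simp
  define C where "C = \<Lambda> + c * (2 * \<Lambda>)"
  have C: "1 \<le> C" unfolding C_def using lam c by (simp add: add_increasing2)
  have main: "\<bar>U x\<bar> \<le> C * (1 + G x) powr (1 - S x * P x / Q x + \<epsilon>)"
    if adm: "admissible U G L" and N: "N \<in> null_sets M" "gradient_off N U G" and ZN: "Z \<subseteq> N"
      and x: "x \<notin> N" for U G N x
  proof -
    have xZ: "x \<notin> Z" using x ZN by auto
    have Gm: "G \<in> borel_measurable M" and GL: "(\<integral>\<^sup>+x. ennreal (G x powr P x) \<partial>M) \<le> ennreal L"
      and UG: "\<And>x. \<bar>U x\<bar> \<le> G x"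
      using adm unfolding admissible_def by auto
    have Gx: "0 \<le> G x" using UG[of x] by linarith
    have Px: "pm \<le> P x" "P x \<le> pM" and Sx: "sm \<le> S x" "S x \<le> 1" and Qx: "Q x \<le> QM" "S x * P x + \<delta> \<le> Q x"
      using P_bounds[OF xZ] S_bounds[OF xZ] Q_le[OF xZ] gap[OF xZ] by auto
    have Qd: "\<delta> \<le> Q x" using Qx SP0[OF xZ] by linarith
    define p' where "p' = P x - e"
    define q' where "q' = Q x + e"
    define s' where "s' = S x - e"
    define a where "a = p' / q'"
    define \<kappa> where "\<kappa> = 1 - s' * a"
    have p': "pm/2 \<le> p'" "0 < p'" and q': "\<delta> \<le> q'" "q' \<le> QM + 1" "0 < q'" and s': "0 < s'" "s' \<le> 1"
      unfolding p'_def q'_def s'_def using Px Qx Sx Qd e pm_pos sm_pos \<delta>_pos by auto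
    have loc: "p' \<le> P y \<and> Q y \<le> q' \<and> s' \<le> S y" if "dist x y < \<rho>" "y \<notin> N" for y
      using \<rho>s(4)[of x y] \<rho>s(5)[of x y] \<rho>s(6)[of x y] that xZ ZN \<rho> unfolding p'_def q'_def s'_def by force
    have a0a: "a0 \<le> a" unfolding a0_def a_def using p' q' pm_pos by (intro frac_le) auto
    have B_large: "L < b * B powr q'"
    proof -
      have "1 + L / b = B powr \<delta>" unfolding B_def using Lb \<delta>_pos by (simp add: powr_powr)
      also have "\<dots> \<le> B powr q'" using q' B1 by (intro powr_mono) auto
      finally have "b * (1 + L / b) \<le> b * B powr q'" using b_pos by (intro mult_left_mono) auto
      moreover have "b * (1 + L / b) = b + L" using b_pos by (simp add: distrib_left)
      ultimately show ?thesis using b_pos by linarith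
    qed
    have lam_large: "B * \<Lambda> powr (-a) \<le> (\<rho>/2) * (1 - 2 powr (-a))"
    proof -
      have "B / D = ((B / D) powr (1 / a0)) powr a0" using a0 B1 D by (simp add: powr_powr)
      also have "\<dots> \<le> \<Lambda> powr a0" using lam a0 by (intro powr_mono2) auto
      finally have "B \<le> D * \<Lambda> powr a0" using D by (simp add: field_simps)
      then have "B * \<Lambda> powr (-a0) \<le> D" using lam by (simp add: powr_minus field_simps)
      moreover have "B * \<Lambda> powr (-a) \<le> B * \<Lambda> powr (-a0)" using a0a lam B1 by (intro mult_left_mono powr_mono) auto
      moreover have "D \<le> (\<rho>/2) * (1 - 2 powr (-a))"
        unfolding D_def using a0a \<rho> by (intro mult_left_mono diff_mono powr_mono) auto
      ultimately show ?thesis by linarith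
    qed
    have sp: "s' * a \<le> S x * P x / Q x"
    proof -
      have "s' * p' \<le> S x * P x" using s' p' e Sx unfolding s'_def p'_def by (intro mult_mono) auto
      then have "s' * p' / q' \<le> S x * P x / Q x"
        using SP0[OF xZ] Qd \<delta>_pos e s' p' unfolding q'_def by (intro frac_le) auto
      then show ?thesis unfolding a_def by simp
    qed
    have SPQ: "S x * P x / Q x \<le> 1 - \<kappa>0"
    proof -
      have "S x * P x / Q x \<le> (Q x - \<delta>) / Q x" using Qx Qd \<delta>_pos by (intro divide_right_mono) auto
      also have "\<dots> = 1 - \<delta> / Q x" using Qd \<delta>_pos by (simp add: field_simps)
      also have "\<dots> \<le> 1 - \<kappa>0" unfolding \<kappa>0_def using Qx Qd \<delta>_pos by (simp add: frac_le)
      finally show ?thesis .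
    qed
    have \<kappa>: "\<kappa>0 \<le> \<kappa>" "\<kappa> \<le> 1" unfolding \<kappa>_def using sp SPQ s' a0 a0a by auto
    have \<kappa>_le: "\<kappa> \<le> 1 - S x * P x / Q x + \<epsilon>"
    proof -
      define w where "w = S x * P x"
      have w: "0 \<le> w" "w \<le> Q x" using SP0[OF xZ] Qx \<delta>_pos unfolding w_def by auto
      have "w / Q x - s' * p' / q' = (w * q' - s' * p' * Q x) / (Q x * q')"
        using Qd \<delta>_pos q' by (simp add: field_simps)
      also have "\<dots> \<le> (e * (1 + S x + P x) * Q x) / (Q x * q')"
      proof (rule divide_right_mono)
        have eq: "s' * p' = w - e * (S x + P x) + e * e" unfolding s'_def p'_def w_def by (simp add: algebra_simps)
        have "w * q' - s' * p' * Q x = w * e + e * (S x + P x) * Q x - e * e * Q x"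
          unfolding eq q'_def by (simp add: algebra_simps)
        also have "\<dots> \<le> Q x * e + e * (S x + P x) * Q x"
        proof -
          have "w * e \<le> Q x * e" using w e by (intro mult_right_mono) auto
          moreover have "0 \<le> e * e * Q x" using e Qd \<delta>_pos by simp
          ultimately show ?thesis by linarith
        qed
        finally show "w * q' - s' * p' * Q x \<le> e * (1 + S x + P x) * Q x" by (simp add: algebra_simps)
      qed (use Qd q' \<delta>_pos in auto)
      also have "\<dots> = e * (1 + S x + P x) / q'" using Qd \<delta>_pos by simp
      also have "\<dots> \<le> e * (2 + pM) / \<delta>"
        using e Sx Px q' \<delta>_pos pM by (intro frac_le mult_left_mono) auto
      also have "\<dots> \<le> \<epsilon>" using e(5) pM \<delta>_pos by (simp add: field_simps)
      finally show ?thesis unfolding \<kappa>_def a_def w_def by simp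
    qed
    have c_large: "3 * B powr s' \<le> c * (2 powr \<kappa> - 1)"
    proof -
      have "B powr s' \<le> B powr 1" using s' B1 by (intro powr_mono) auto
      then have "3 * B powr s' \<le> 3 * B" using B1 by simp
      also have "\<dots> = c * (2 powr \<kappa>0 - 1)" unfolding c_def using two \<kappa>0 by simp
      also have "\<dots> \<le> c * (2 powr \<kappa> - 1)" using \<kappa> c by (intro mult_left_mono diff_mono powr_mono) auto
      finally show ?thesis .
    qed
    have ex: "\<exists>n. G x \<le> \<Lambda> * 2 ^ n"
    proof -
      obtain n where "G x < 2 ^ n" using real_arch_pow[of 2 "G x"] by auto
      then have "G x \<le> 1 * 2 ^ n" by simp
      also have "\<dots> \<le> \<Lambda> * 2 ^ n" using lam by (intro mult_right_mono) auto
      finally show ?thesis by blast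
    qed
    \<comment> \<open>Minimality makes \<open>\<Lambda> * 2 ^ n\<close> comparable to \<open>1 + G x\<close>.\<close>
    define n where "n = (LEAST n. G x \<le> \<Lambda> * 2 ^ n)"
    have n: "G x \<le> \<Lambda> * 2 ^ n" unfolding n_def using ex by (rule LeastI_ex)
    have n2: "\<Lambda> * 2 ^ n \<le> 2 * \<Lambda> * (1 + G x)"
    proof (cases n)
      case 0
      have "\<Lambda> * 1 \<le> (2 * \<Lambda>) * (1 + G x)" using Gx lam by (intro mult_mono) auto
      then show ?thesis using 0 by simp
    next
      case (Suc m)
      then have "\<not> G x \<le> \<Lambda> * 2 ^ m" unfolding n_def using not_less_Least[of m] by (metis lessI n_def)
      then have "\<Lambda> * 2 ^ n \<le> 2 * G x" using Suc by simp
      also have "\<dots> \<le> 2 * \<Lambda> * (1 + G x)" using lam Gx by (intro mult_mono) auto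
      finally show ?thesis .
    qed
    have start: "dist x x < (\<rho>/2) * (1 + 2 powr (- a * real n))"
      using \<rho> by (simp add: add_pos_pos)
    have "\<bar>U x\<bar> \<le> \<Lambda> + c * (\<Lambda> * 2 ^ n) powr \<kappa>"
      by (rule descent[OF Gm GL UG L N loc \<rho>(1,2) p'(2) q'(3) s'(1) lam(1) _ _ B_large a_def \<kappa>_def lam_large c_large x start n])
        (use B1 c in auto)
    also have "\<dots> \<le> \<Lambda> * (1 + G x) powr \<kappa> + c * (2 * \<Lambda> * (1 + G x) powr \<kappa>)"
    proof (intro add_mono mult_left_mono)
      have "1 \<le> (1 + G x) powr \<kappa>" using Gx \<kappa> \<kappa>0 by (intro ge_one_powr_ge_zero) auto
      then show "\<Lambda> \<le> \<Lambda> * (1 + G x) powr \<kappa>" using lam by simp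
      have "(\<Lambda> * 2 ^ n) powr \<kappa> \<le> (2 * \<Lambda> * (1 + G x)) powr \<kappa>"
        using n2 \<kappa> \<kappa>0 lam by (intro powr_mono2) auto
      also have "\<dots> = (2 * \<Lambda>) powr \<kappa> * (1 + G x) powr \<kappa>" using lam Gx by (simp add: powr_mult)
      also have "\<dots> \<le> (2 * \<Lambda>) powr 1 * (1 + G x) powr \<kappa>"
        using \<kappa> lam by (intro mult_right_mono powr_mono) auto
      finally show "(\<Lambda> * 2 ^ n) powr \<kappa> \<le> 2 * \<Lambda> * (1 + G x) powr \<kappa>" using lam by simp
    qed (use c in auto)
    also have "\<dots> = C * (1 + G x) powr \<kappa>" unfolding C_def by (simp add: algebra_simps)
    also have "\<dots> \<le> C * (1 + G x) powr (1 - S x * P x / Q x + \<epsilon>)"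
      using \<kappa>_le Gx C by (intro mult_left_mono powr_mono) auto
    finally show ?thesis .
  qed
  show ?thesis
  proof (intro exI[of _ C] conjI C allI impI)
    fix U G assume adm: "admissible U G L"
    then obtain N where N: "N \<in> null_sets M" "gradient_off N U G" unfolding admissible_def by auto
    have N': "N \<union> Z \<in> null_sets M" using N Z_null by auto
    moreover have "gradient_off (N \<union> Z) U G" using N(2) unfolding gradient_off_def by auto
    ultimately have "\<bar>U x\<bar> \<le> C * (1 + G x) powr (1 - S x * P x / Q x + \<epsilon>)" if "x \<notin> N \<union> Z" for x
      using main[OF adm, of "N \<union> Z" x] that by auto
    then show "AE x in M. \<bar>U x\<bar> \<le> C * (1 + G x) powr (1 - S x * P x / Q x + \<epsilon>)"
      using AE_not_in[OF N'] by (auto elim: eventually_mono)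
  qed
qed

lemma AE_notin_Z: "AE x in M. x \<notin> Z"
  using Z_null by (rule AE_not_in)

text \<open>Where \<open>G \<le> 1\<close>, the bound \<open>\<bar>U\<bar> \<le> G\<close> and \<open>P \<le> \<beta>\<close> suffice; where \<open>1 < G\<close>, the pointwise estimate raised to
  the power \<open>\<beta> x\<close> is at most a constant times \<open>G x powr P x\<close> by the condition on \<open>\<beta>\<close>.\<close>
lemma higher_integrability:
  assumes L: "0 \<le> L" and \<epsilon>: "0 < \<epsilon>"
    and \<beta>: "AE x in M. P x \<le> \<beta> x \<and> \<beta> x \<le> bM \<and> \<beta> x * (1 - S x * P x / Q x + \<epsilon>) \<le> P x"
  shows "\<exists>C\<ge>0. \<forall>U G. admissible U G L \<longrightarrow> (\<integral>\<^sup>+x. ennreal (\<bar>U x\<bar> powr \<beta> x) \<partial>M) \<le> ennreal C"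
proof -
  obtain C where C: "1 \<le> C"
    and pw: "\<And>U G. admissible U G L \<Longrightarrow> AE x in M. \<bar>U x\<bar> \<le> C * (1 + G x) powr (1 - S x * P x / Q x + \<epsilon>)"
    using pointwise_bound[OF \<epsilon> L] by auto
  define K where "K = C powr \<bar>bM\<bar> * 2 powr \<bar>pM\<bar>"
  have "1 * 1 \<le> C powr \<bar>bM\<bar> * 2 powr \<bar>pM\<bar>"
    using C by (intro mult_mono ge_one_powr_ge_zero) auto
  then have K: "1 \<le> K" unfolding K_def by simp
  have "(\<integral>\<^sup>+x. ennreal (\<bar>U x\<bar> powr \<beta> x) \<partial>M) \<le> ennreal (K * L)" if adm: "admissible U G L" for U G
  proof -
    have G [measurable]: "G \<in> borel_measurable M" and UG: "\<And>x. \<bar>U x\<bar> \<le> G x"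
      and GL: "(\<integral>\<^sup>+x. ennreal (G x powr P x) \<partial>M) \<le> ennreal L"
      using adm unfolding admissible_def by auto
    have "AE x in M. \<bar>U x\<bar> powr \<beta> x \<le> K * (G x powr P x)"
      using pw[OF adm] \<beta> AE_notin_Z
    proof eventually_elim
      case (elim x)
      have \<beta>0: "0 \<le> \<beta> x" "0 \<le> P x" "P x \<le> \<bar>pM\<bar>" "\<beta> x \<le> \<bar>bM\<bar>" using elim P_bounds[OF elim(3)] pm_pos by auto
      have G0: "0 \<le> G x" using UG[of x] by linarith
      show ?case
      proof (cases "G x \<le> 1")
        case True
        have "\<bar>U x\<bar> powr \<beta> x \<le> G x powr \<beta> x" using UG \<beta>0 by (intro powr_mono2) auto
        also have "\<dots> \<le> G x powr P x" using elim G0 True by (intro powr_mono') auto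
        also have "\<dots> \<le> K * (G x powr P x)" using K by (simp add: mult_le_cancel_right1)
        finally show ?thesis .
      next
        case False
        have "\<bar>U x\<bar> powr \<beta> x \<le> (C * (1 + G x) powr (1 - S x * P x / Q x + \<epsilon>)) powr \<beta> x"
          using elim \<beta>0 by (intro powr_mono2) auto
        also have "\<dots> = C powr \<beta> x * (1 + G x) powr (\<beta> x * (1 - S x * P x / Q x + \<epsilon>))"
          using C G0 by (simp add: powr_mult powr_powr mult.commute)
        also have "\<dots> \<le> C powr \<bar>bM\<bar> * (2 * G x) powr P x"
        proof (rule mult_mono)
          show "C powr \<beta> x \<le> C powr \<bar>bM\<bar>" using C \<beta>0 by (intro powr_mono) auto
          have "(1 + G x) powr (\<beta> x * (1 - S x * P x / Q x + \<epsilon>)) \<le> (1 + G x) powr P x"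
            using elim G0 by (intro powr_mono) auto
          also have "\<dots> \<le> (2 * G x) powr P x" using False \<beta>0 by (intro powr_mono2) auto
          finally show "(1 + G x) powr (\<beta> x * (1 - S x * P x / Q x + \<epsilon>)) \<le> (2 * G x) powr P x" .
        qed auto
        also have "\<dots> = C powr \<bar>bM\<bar> * (2 powr P x * G x powr P x)" using G0 by (simp add: powr_mult)
        also have "\<dots> \<le> C powr \<bar>bM\<bar> * (2 powr \<bar>pM\<bar> * G x powr P x)"
          using \<beta>0 by (intro mult_left_mono mult_right_mono powr_mono) auto
        finally show ?thesis unfolding K_def by simp
      qed
    qed
    then have "(\<integral>\<^sup>+x. ennreal (\<bar>U x\<bar> powr \<beta> x) \<partial>M) \<le> (\<integral>\<^sup>+x. ennreal K * ennreal (G x powr P x) \<partial>M)"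
      using K by (intro nn_integral_mono_AE) (auto elim!: eventually_mono simp: ennreal_mult[symmetric] ennreal_leI)
    also have "\<dots> = ennreal K * (\<integral>\<^sup>+x. ennreal (G x powr P x) \<partial>M)" by (rule nn_integral_cmult) measurable
    also have "\<dots> \<le> ennreal K * ennreal L" using GL by (intro mult_left_mono) auto
    also have "\<dots> = ennreal (K * L)" using K L by (simp add: ennreal_mult)
    finally show ?thesis .
  qed
  moreover have "0 \<le> K * L" using K L by simp
  ultimately show ?thesis by blast
qed

lemma admissible_diff:
  assumes U: "admissible U G L" and V: "admissible V G' L" and L: "0 \<le> L"
  shows "admissible (\<lambda>x. U x - V x) (\<lambda>x. G x + G' x) (2 powr pM * (2 * L))"
proof -
  have [measurable]: "U \<in> borel_measurable M" "G \<in> borel_measurable M" "V \<in> borel_measurable M" "G' \<in> borel_measurable M"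
    using U V unfolding admissible_def by auto
  have UG: "\<bar>U x\<bar> \<le> G x" "\<bar>V x\<bar> \<le> G' x" for x using U V unfolding admissible_def by auto
  have G0: "0 \<le> G x" "0 \<le> G' x" for x using UG[of x] by linarith+
  have IG: "(\<integral>\<^sup>+x. ennreal (G x powr P x) \<partial>M) \<le> ennreal L" "(\<integral>\<^sup>+x. ennreal (G' x powr P x) \<partial>M) \<le> ennreal L"
    using U V unfolding admissible_def by auto
  obtain N1 N2 where N: "N1 \<in> null_sets M" "N2 \<in> null_sets M" "gradient_off N1 U G" "gradient_off N2 V G'"
    using U V unfolding admissible_def by auto
  have grad: "gradient_off (N1 \<union> N2) (\<lambda>x. U x - V x) (\<lambda>x. G x + G' x)"
    unfolding gradient_off_def
  proof (intro ballI impI)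
    fix x y assume xy: "x \<in> - (N1 \<union> N2)" "y \<in> - (N1 \<union> N2)" "dist x y < 1"
    have "\<bar>U x - U y\<bar> \<le> dist x y powr S x * G x + dist x y powr S y * G y"
      "\<bar>V x - V y\<bar> \<le> dist x y powr S x * G' x + dist x y powr S y * G' y"
      using N(3,4) xy unfolding gradient_off_def by auto
    then show "\<bar>U x - V x - (U y - V y)\<bar> \<le> dist x y powr S x * (G x + G' x) + dist x y powr S y * (G y + G' y)"
      by (simp add: algebra_simps)
  qed
  have "(\<integral>\<^sup>+x. ennreal ((G x + G' x) powr P x) \<partial>M)
      \<le> (\<integral>\<^sup>+x. ennreal (2 powr pM) * (ennreal (G x powr P x) + ennreal (G' x powr P x)) \<partial>M)"
  proof (rule nn_integral_mono_AE)
    show "AE x in M. ennreal ((G x + G' x) powr P x) \<le> ennreal (2 powr pM) * (ennreal (G x powr P x) + ennreal (G' x powr P x))"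
      using AE_notin_Z
    proof eventually_elim
      case (elim x)
      have P0: "0 \<le> P x" "P x \<le> pM" using P_bounds[OF elim] pm_pos by auto
      have "(G x + G' x) powr P x \<le> (2 * max (G x) (G' x)) powr P x"
        using P0 G0[of x] by (intro powr_mono2) auto
      also have "\<dots> = 2 powr P x * max (G x) (G' x) powr P x" using G0[of x] by (simp add: powr_mult)
      also have "\<dots> \<le> 2 powr pM * (G x powr P x + G' x powr P x)"
        using P0 by (intro mult_mono powr_mono) (auto simp: max_def)
      finally show ?case
        by (simp add: ennreal_plus[symmetric] ennreal_mult[symmetric] ennreal_leI del: ennreal_plus)
    qed
  qed
  also have "\<dots> = ennreal (2 powr pM) * ((\<integral>\<^sup>+x. ennreal (G x powr P x) \<partial>M) + (\<integral>\<^sup>+x. ennreal (G' x powr P x) \<partial>M))"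
    by (subst nn_integral_cmult, measurable, subst nn_integral_add, measurable)
  also have "\<dots> \<le> ennreal (2 powr pM) * (ennreal L + ennreal L)"
    using IG by (intro mult_left_mono add_mono) auto
  also have "\<dots> = ennreal (2 powr pM * (2 * L))"
    using L by (simp add: ennreal_plus[symmetric] ennreal_mult[symmetric] del: ennreal_plus)
  finally have "(\<integral>\<^sup>+x. ennreal ((G x + G' x) powr P x) \<partial>M) \<le> ennreal (2 powr pM * (2 * L))" .
  moreover have "\<bar>U x - V x\<bar> \<le> G x + G' x" for x using UG[of x] by linarith
  moreover have "N1 \<union> N2 \<in> null_sets M" using N by auto
  ultimately show ?thesis unfolding admissible_def using grad by (intro conjI) (auto intro!: bexI[of _ "N1 \<union> N2"])
qed

lemma admissible_scale:
  assumes U: "admissible U G L" and L: "0 \<le> L" and c: "0 < c"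
  shows "admissible (\<lambda>x. c * U x) (\<lambda>x. c * G x) (max 1 c powr pM * L)"
proof -
  have [measurable]: "U \<in> borel_measurable M" "G \<in> borel_measurable M"
    using U unfolding admissible_def by auto
  have UG: "\<bar>U x\<bar> \<le> G x" for x using U unfolding admissible_def by auto
  have G0: "0 \<le> G x" for x using UG[of x] by linarith
  have IG: "(\<integral>\<^sup>+x. ennreal (G x powr P x) \<partial>M) \<le> ennreal L" using U unfolding admissible_def by auto
  obtain N where N: "N \<in> null_sets M" "gradient_off N U G"
    using U unfolding admissible_def by auto
  have grad: "gradient_off N (\<lambda>x. c * U x) (\<lambda>x. c * G x)"
    unfolding gradient_off_def
  proof (intro ballI impI)
    fix x y assume xy: "x \<in> - N" "y \<in> - N" "dist x y < 1"
    have "\<bar>U x - U y\<bar> \<le> dist x y powr S x * G x + dist x y powr S y * G y"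
      using N xy unfolding gradient_off_def by auto
    then have "c * \<bar>U x - U y\<bar> \<le> c * (dist x y powr S x * G x + dist x y powr S y * G y)"
      using c by (intro mult_left_mono) auto
    moreover have "\<bar>c * U x - c * U y\<bar> = c * \<bar>U x - U y\<bar>"
      using c by (simp add: abs_mult right_diff_distrib[symmetric])
    ultimately show "\<bar>c * U x - c * U y\<bar> \<le> dist x y powr S x * (c * G x) + dist x y powr S y * (c * G y)"
      by (simp add: algebra_simps)
  qed
  have "(\<integral>\<^sup>+x. ennreal ((c * G x) powr P x) \<partial>M) \<le> (\<integral>\<^sup>+x. ennreal (max 1 c powr pM) * ennreal (G x powr P x) \<partial>M)"
  proof (rule nn_integral_mono_AE)
    show "AE x in M. ennreal ((c * G x) powr P x) \<le> ennreal (max 1 c powr pM) * ennreal (G x powr P x)"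
      using AE_notin_Z
    proof eventually_elim
      case (elim x)
      have P0: "0 \<le> P x" "P x \<le> pM" using P_bounds[OF elim] pm_pos by auto
      have "c powr P x \<le> max 1 c powr P x" using P0 c by (intro powr_mono2) auto
      also have "\<dots> \<le> max 1 c powr pM" using P0 by (intro powr_mono) auto
      finally have "c powr P x * G x powr P x \<le> max 1 c powr pM * G x powr P x" by (intro mult_right_mono) auto
      then show ?case using c G0[of x] by (simp add: powr_mult ennreal_mult[symmetric] ennreal_leI)
    qed
  qed
  also have "\<dots> = ennreal (max 1 c powr pM) * (\<integral>\<^sup>+x. ennreal (G x powr P x) \<partial>M)"
    by (rule nn_integral_cmult) measurable
  also have "\<dots> \<le> ennreal (max 1 c powr pM) * ennreal L" using IG by (intro mult_left_mono) auto
  also have "\<dots> = ennreal (max 1 c powr pM * L)" using L by (simp add: ennreal_mult)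
  finally have *: "(\<integral>\<^sup>+x. ennreal ((c * G x) powr P x) \<partial>M) \<le> ennreal (max 1 c powr pM * L)" .
  have "\<bar>c * U x\<bar> \<le> c * G x" for x using UG[of x] c by (simp add: abs_mult)
  then show ?thesis unfolding admissible_def using grad * N by (intro conjI) auto
qed

lemma Chebyshev_bound:
  assumes G [measurable]: "G \<in> borel_measurable M" and GL: "(\<integral>\<^sup>+x. ennreal (G x powr P x) \<partial>M) \<le> ennreal L"
    and A: "1 \<le> A"
  shows "emeasure M {x. A < G x} \<le> ennreal (L * A powr (-pm))"
proof -
  have [measurable]: "{x. A < G x} \<in> sets M"
    using measurable_sets_Collect[of G M borel "\<lambda>t. A < t"] space_M by (simp add: borel_measurable_less)
  have "ennreal (A powr pm) * emeasure M {x. A < G x} = (\<integral>\<^sup>+x. ennreal (A powr pm) * indicator {x. A < G x} x \<partial>M)"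
    by (subst nn_integral_cmult_indicator) auto
  also have "\<dots> \<le> (\<integral>\<^sup>+x. ennreal (G x powr P x) \<partial>M)"
  proof (rule nn_integral_mono_AE)
    show "AE x in M. ennreal (A powr pm) * indicator {x. A < G x} x \<le> ennreal (G x powr P x)"
      using AE_notin_Z
    proof eventually_elim
      case (elim x)
      show ?case
      proof (cases "A < G x")
        case True
        have "A powr pm \<le> A powr P x" using A P_bounds[OF elim] by (intro powr_mono) auto
        also have "\<dots> \<le> G x powr P x" using A True P_bounds[OF elim] pm_pos by (intro powr_mono2) auto
        finally show ?thesis using True by (simp add: ennreal_leI)
      qed auto
    qed
  qed
  finally have "ennreal (A powr pm) * emeasure M {x. A < G x} \<le> ennreal L" using GL by (rule order_trans)
  then have "ennreal (A powr (-pm)) * (ennreal (A powr pm) * emeasure M {x. A < G x}) \<le> ennreal (A powr (-pm)) * ennreal L"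
    by (intro mult_left_mono) auto
  moreover have "ennreal (A powr (-pm)) * ennreal (A powr pm) = 1"
    using A by (simp add: ennreal_mult[symmetric] powr_add[symmetric])
  ultimately have "emeasure M {x. A < G x} \<le> ennreal (A powr (-pm)) * ennreal L"
    by (simp add: mult.assoc[symmetric])
  also have "\<dots> = ennreal (L * A powr (-pm))"
    by (simp add: ennreal_mult'' mult.commute)
  finally show ?thesis .
qed

text \<open>The centre may lie in \<open>Z\<close>, where \<open>Q\<close> is not controlled; a point off \<open>Z\<close> within \<open>r/2\<close> takes its place.\<close>
lemma ball_measure_lower:
  assumes r: "0 < r" "r \<le> 1"
  shows "ennreal (b * (r/2) powr QM) \<le> emeasure M (ball x r)"
proof -
  have "\<not> ball x (r/2) \<subseteq> Z"
  proof
    assume "ball x (r/2) \<subseteq> Z"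
    then have "ball x (r/2) \<in> null_sets M" using Z_null null_sets_subset[of Z M "ball x (r/2)"] sets_M by auto
    then show False using ball_pos[of "r/2" x] r by (auto simp: null_setsD1)
  qed
  then obtain y where "y \<in> ball x (r/2)" and y_Z: "y \<notin> Z" by blast
  then have y: "dist x y < r/2" "y \<notin> Z" by auto
  have "(r/2) powr QM \<le> (r/2) powr Q y" using Q_le[OF y(2)] r by (intro powr_mono') auto
  then have "ennreal (b * (r/2) powr QM) \<le> ennreal (b * (r/2) powr Q y)"
    using b_pos by (intro ennreal_leI mult_left_mono) auto
  also have "\<dots> \<le> emeasure M (ball y (r/2))" using r by (intro lower_regular) auto
  also have "\<dots> \<le> emeasure M (ball x r)"
  proof (rule emeasure_mono)
    show "ball y (r/2) \<subseteq> ball x r"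
    proof
      fix z assume "z \<in> ball y (r/2)"
      then show "z \<in> ball x r" using y(1) dist_triangle[of x z y] by simp
    qed
  qed (simp add: sets_M)
  finally show ?thesis .
qed

end

section \<open>Invariant functions: total boundedness\<close>

locale invariant_gradient_space = gradient_space +
  fixes H :: "('a \<Rightarrow> 'a) set" and x0 :: 'a and r :: real
  assumes H_iso: "H \<subseteq> Iso M"
    and P_invariant: "\<And>h x. h \<in> H \<Longrightarrow> P (h x) = P x"
    and r_pos: "0 < r"
    and many_orbit_points: "\<And>m. \<exists>R. \<forall>x. x \<notin> ball x0 R \<longrightarrow> enat m < orbit_packing H x r"
    and doubling: "geometrically_doubling TYPE('a)"
begin

lemma H_measurable:
  assumes h: "h \<in> H" shows "h \<in> measurable M M"
proof -
  have "\<And>u v. dist (h u) (h v) = dist u v" using H_iso h unfolding Iso_def by auto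
  then have "continuous_on UNIV h" unfolding continuous_on_iff by auto
  then have "h \<in> borel_measurable borel" by (rule borel_measurable_continuous_onI)
  then show ?thesis using measurable_cong_sets[OF sets_M sets_M] by auto
qed

lemma integral_ball_isometry:
  fixes f :: "'a \<Rightarrow> ennreal"
  assumes h: "h \<in> H" and f [measurable]: "f \<in> borel_measurable M" and inv: "AE x in M. f (h x) = f x"
  shows "(\<integral>\<^sup>+y. f y * indicator (ball (h x) \<rho>) y \<partial>M) = (\<integral>\<^sup>+y. f y * indicator (ball x \<rho>) y \<partial>M)"
proof -
  have iso: "\<And>u v. dist (h u) (h v) = dist u v" and D: "distr M M h = M"
    using H_iso h unfolding Iso_def by auto
  have hm [measurable]: "h \<in> measurable M M" by (rule H_measurable[OF h])
  have [measurable]: "ball z \<rho> \<in> sets M" for z by (simp add: sets_M)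
  have "(\<integral>\<^sup>+y. f y * indicator (ball (h x) \<rho>) y \<partial>M) = (\<integral>\<^sup>+y. f y * indicator (ball (h x) \<rho>) y \<partial>distr M M h)"
    by (simp add: D)
  also have "\<dots> = (\<integral>\<^sup>+y. f (h y) * indicator (ball (h x) \<rho>) (h y) \<partial>M)"
    by (rule nn_integral_distr) measurable
  also have "\<dots> = (\<integral>\<^sup>+y. f y * indicator (ball x \<rho>) y \<partial>M)"
    using inv by (intro nn_integral_cong_AE) (auto elim!: eventually_mono simp: indicator_def iso)
  finally show ?thesis .
qed

lemma ex_separated_orbit_points:
  assumes "enat m < orbit_packing H x r"
  shows "\<exists>A. finite A \<and> card A = m \<and> A \<subseteq> orbit_of H x \<and> (\<forall>\<xi>\<in>A. \<forall>\<eta>\<in>A. \<xi> \<noteq> \<eta> \<longrightarrow> ball \<xi> r \<inter> ball \<eta> r = {})"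
proof -
  obtain A where A: "A \<subseteq> orbit_of H x" "\<forall>\<xi>\<in>A. \<forall>\<eta>\<in>A. \<xi> \<noteq> \<eta> \<longrightarrow> ball \<xi> r \<inter> ball \<eta> r = {}"
    and m: "enat m < (if finite A then enat (card A) else \<infinity>)"
    using assms unfolding orbit_packing_def less_SUP_iff
    by (elim bexE) (simp only: mem_Collect_eq, elim conjE, rule that)
  have "\<exists>B. B \<subseteq> A \<and> finite B \<and> card B = m"
  proof (cases "finite A")
    case True
    then have "m \<le> card A" using m by simp
    then show ?thesis using True by (meson obtain_subset_with_card_n finite_subset)
  next
    case False
    then show ?thesis using infinite_arbitrarily_large[OF False] by blast
  qed
  then obtain B where B: "B \<subseteq> A" "finite B" "card B = m" by blast
  show ?thesis
  proof (intro exI[of _ B] conjI ballI impI)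
    show "B \<subseteq> orbit_of H x" using B(1) A(1) by (rule order_trans)
    show "ball \<xi> r \<inter> ball \<eta> r = {}" if "\<xi> \<in> B" "\<eta> \<in> B" "\<xi> \<noteq> \<eta>" for \<xi> \<eta>
      using A(2)[rule_format, of \<xi> \<eta>] that B(1) by (simp add: subsetD)
  qed (use B in simp_all)
qed

text \<open>The \<open>m\<close> disjoint balls around points of the orbit of \<open>x\<close> all carry the same mass as the one around \<open>x\<close>.\<close>
lemma small_mass_of_ball:
  fixes f :: "'a \<Rightarrow> ennreal"
  assumes f [measurable]: "f \<in> borel_measurable M" and inv: "\<And>h. h \<in> H \<Longrightarrow> AE x in M. f (h x) = f x"
    and m: "enat m < orbit_packing H x r" and \<rho>: "\<rho> \<le> r"
  shows "of_nat m * (\<integral>\<^sup>+y. f y * indicator (ball x \<rho>) y \<partial>M) \<le> (\<integral>\<^sup>+y. f y \<partial>M)"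
proof -
  obtain A where A: "finite A" "card A = m" "A \<subseteq> orbit_of H x"
    "\<forall>\<xi>\<in>A. \<forall>\<eta>\<in>A. \<xi> \<noteq> \<eta> \<longrightarrow> ball \<xi> r \<inter> ball \<eta> r = {}"
    using ex_separated_orbit_points[OF m] by (elim exE conjE) (rule that)
  have [measurable]: "ball z \<rho> \<in> sets M" for z by (simp add: sets_M)
  have "(\<integral>\<^sup>+y. f y * indicator (ball \<xi> \<rho>) y \<partial>M) = (\<integral>\<^sup>+y. f y * indicator (ball x \<rho>) y \<partial>M)" if \<xi>: "\<xi> \<in> A" for \<xi>
  proof -
    obtain h where h: "h \<in> H" "\<xi> = h x" using subsetD[OF A(3) \<xi>] unfolding orbit_of_def by blast
    show ?thesis unfolding h(2) by (rule integral_ball_isometry[OF h(1) f inv[OF h(1)]])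
  qed
  then have "of_nat m * (\<integral>\<^sup>+y. f y * indicator (ball x \<rho>) y \<partial>M) = (\<Sum>\<xi>\<in>A. \<integral>\<^sup>+y. f y * indicator (ball \<xi> \<rho>) y \<partial>M)"
    using A(2) by simp
  also have "\<dots> = (\<integral>\<^sup>+y. (\<Sum>\<xi>\<in>A. f y * indicator (ball \<xi> \<rho>) y) \<partial>M)"
    by (rule nn_integral_sum[symmetric]) measurable
  also have "\<dots> \<le> (\<integral>\<^sup>+y. f y \<partial>M)"
  proof (rule nn_integral_mono)
    fix y
    show "(\<Sum>\<xi>\<in>A. f y * indicator (ball \<xi> \<rho>) y) \<le> f y"
    proof (cases "\<exists>\<xi>\<in>A. y \<in> ball \<xi> \<rho>")
      case True
      then obtain \<xi> where \<xi>: "\<xi> \<in> A" "y \<in> ball \<xi> \<rho>" by blast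
      have "y \<notin> ball \<eta> \<rho>" if "\<eta> \<in> A - {\<xi>}" for \<eta>
      proof
        assume "y \<in> ball \<eta> \<rho>"
        then have "y \<in> ball \<xi> r \<inter> ball \<eta> r" using \<xi>(2) \<rho> by auto
        moreover have "ball \<xi> r \<inter> ball \<eta> r = {}"
          using A(4)[rule_format, of \<xi> \<eta>] that \<xi>(1) by blast
        ultimately show False by (simp only: empty_iff)
      qed
      then have "(\<Sum>\<xi>\<in>A. f y * indicator (ball \<xi> \<rho>) y) = (\<Sum>\<zeta>\<in>{\<xi>}. f y * indicator (ball \<zeta> \<rho>) y)"
        using A(1) \<xi>(1) by (intro sum.mono_neutral_right) (auto simp: indicator_def)
      also have "\<dots> = f y * indicator (ball \<xi> \<rho>) y"
        by (simp only: sum.insert finite.emptyI empty_iff not_False_eq_True sum.empty add_0_right)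
      finally show ?thesis using \<xi>(2) by simp
    next
      case False
      then have "(\<Sum>\<xi>\<in>A. f y * indicator (ball \<xi> \<rho>) y) = 0" by (intro sum.neutral) auto
      then show ?thesis by simp
    qed
  qed
  finally show ?thesis .
qed

definition invariant :: "('a \<Rightarrow> real) \<Rightarrow> bool" where
  "invariant U \<longleftrightarrow> (\<forall>h\<in>H. AE x in M. U (h x) = U x)"

lemma oscillation_bound:
  assumes UG: "\<And>x. \<bar>U x\<bar> \<le> G x" and N: "Z \<subseteq> N" "gradient_off N U G"
    and \<rho>: "0 < \<rho>" "\<rho> \<le> 1/4" and xy: "x \<in> ball a \<rho>" "y \<in> ball a \<rho>" "x \<notin> N" "y \<notin> N" "G x \<le> A" "G y \<le> A"
  shows "\<bar>U x - U y\<bar> \<le> 2 * ((2 * \<rho>) powr sm * A)"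
proof -
  have "dist x y \<le> dist a x + dist a y" by (rule dist_triangle3)
  then have d: "dist x y \<le> 2 * \<rho>" using xy(1,2) by simp
  have pw: "dist x y powr S z \<le> (2 * \<rho>) powr sm" if "z \<notin> N" for z
  proof -
    have z: "sm \<le> S z" using that S_bounds[of z] N(1) by auto
    have "dist x y powr S z \<le> (2 * \<rho>) powr S z" using d z sm_pos by (intro powr_mono2) auto
    also have "\<dots> \<le> (2 * \<rho>) powr sm" using z \<rho> by (intro powr_mono') auto
    finally show ?thesis .
  qed
  have "\<bar>U x - U y\<bar> \<le> dist x y powr S x * G x + dist x y powr S y * G y"
    using N(2) xy d \<rho> unfolding gradient_off_def by auto
  also have "\<dots> \<le> (2 * \<rho>) powr sm * A + (2 * \<rho>) powr sm * A"
    using pw[OF xy(3)] pw[OF xy(4)] xy UG[of x] UG[of y] by (intro add_mono mult_mono) auto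
  finally show ?thesis by linarith
qed

text \<open>Consider a cell \<open>V\<close> that contains a point with \<open>G \<le> A\<close> and \<open>\<tau>/2 < \<bar>U\<bar>\<close>. The oscillation of \<open>U\<close> on the part
  \<open>E\<close> of the cell where \<open>G \<le> A\<close> is at most \<open>\<tau>/4\<close>, so \<open>\<tau>/4 \<le> \<bar>U\<bar>\<close> on \<open>E\<close>, and the small mass of the cell makes
  \<open>E\<close> smaller than half of it. Hence \<open>E\<close>, and with it the set on the left, is no larger than
  the rest of the cell.\<close>
lemma cell_tail:
  assumes adm: "admissible U G L" and L: "0 \<le> L" and inv: "invariant U"
    and N: "N \<in> null_sets M" "Z \<subseteq> N" "gradient_off N U G"
    and \<tau>: "0 < \<tau>" "\<tau> \<le> 1" and \<rho>: "0 < \<rho>" "\<rho> \<le> 1/4" "\<rho> \<le> r"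
    and osc: "2 * ((2 * \<rho>) powr sm * A) \<le> \<tau>/4"
    and V [measurable]: "V \<in> sets M" and V_ball: "ball a (\<rho>/2) \<subseteq> V" "V \<subseteq> ball a \<rho>"
    and m: "enat m < orbit_packing H a r" "2 * L < real m * (\<tau>/4) powr pM * (b * (\<rho>/4) powr QM)"
  shows "emeasure M (V \<inter> {x. x \<notin> N \<and> G x \<le> A \<and> \<tau>/2 < \<bar>U x\<bar>}) \<le> emeasure M (V \<inter> {x. A < G x})"
proof (cases "V \<inter> {x. x \<notin> N \<and> G x \<le> A \<and> \<tau>/2 < \<bar>U x\<bar>} = {}")
  case True
  then show ?thesis by simp
next
  case False
  then obtain y where y: "y \<in> V" "y \<notin> N" "G y \<le> A" "\<tau>/2 < \<bar>U y\<bar>" by auto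
  have [measurable]: "U \<in> borel_measurable M" "G \<in> borel_measurable M" and UG: "\<And>x. \<bar>U x\<bar> \<le> G x"
    and GL: "(\<integral>\<^sup>+x. ennreal (G x powr P x) \<partial>M) \<le> ennreal L"
    using adm unfolding admissible_def by auto
  have "{x\<in>space M. A < G x} \<in> sets M" "{x\<in>space M. G x \<le> A} \<in> sets M" by measurable
  then have sets: "{x. A < G x} \<in> sets M" "{x. G x \<le> A} \<in> sets M" "N \<in> sets M"
    using N(1) by (auto simp: space_M)
  define E where "E = V \<inter> {x. G x \<le> A} - N"
  have E_sets [measurable]: "E \<in> sets M" unfolding E_def using sets V by (intro sets.Diff sets.Int)
  have lowU: "\<tau>/4 \<le> \<bar>U z\<bar>" if z: "z \<in> E" for z
  proof -
    have zV: "z \<in> V" "z \<notin> N" "G z \<le> A" using z unfolding E_def by auto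
    have "\<bar>U z - U y\<bar> \<le> 2 * ((2 * \<rho>) powr sm * A)"
      using zV y subsetD[OF V_ball(2)] by (intro oscillation_bound[OF UG N(2,3) \<rho>(1,2)])
    then show ?thesis using osc y(4) by linarith
  qed
  define f where "f x = ennreal (\<bar>U x\<bar> powr P x)" for x
  have [measurable]: "f \<in> borel_measurable M" unfolding f_def by measurable
  define J where "J = (\<integral>\<^sup>+y. f y * indicator (ball a \<rho>) y \<partial>M)"
  have fL: "(\<integral>\<^sup>+y. f y \<partial>M) \<le> ennreal L"
  proof (rule order_trans[OF nn_integral_mono_AE GL])
    show "AE x in M. f x \<le> ennreal (G x powr P x)"
      using AE_notin_Z
    proof eventually_elim
      case (elim x)
      then show ?case unfolding f_def using UG[of x] P_bounds[OF elim] pm_pos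
        by (intro ennreal_leI powr_mono2) auto
    qed
  qed
  have "AE x in M. f (h x) = f x" if "h \<in> H" for h
    using inv that P_invariant[OF that] unfolding invariant_def f_def by (auto elim!: eventually_mono)
  then have mJ: "of_nat m * J \<le> ennreal L"
    unfolding J_def using small_mass_of_ball[OF _ _ m(1) \<rho>(3), of f] fL by (auto intro: order_trans)
  have EJ: "ennreal ((\<tau>/4) powr pM) * emeasure M E \<le> J"
  proof -
    have "ennreal ((\<tau>/4) powr pM) * emeasure M E = (\<integral>\<^sup>+x. ennreal ((\<tau>/4) powr pM) * indicator E x \<partial>M)"
      by (subst nn_integral_cmult_indicator) auto
    also have "\<dots> \<le> J"
      unfolding J_def
    proof (rule nn_integral_mono)
      fix x
      show "ennreal ((\<tau>/4) powr pM) * indicator E x \<le> f x * indicator (ball a \<rho>) x"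
      proof (cases "x \<in> E")
        case True
        then have xZ: "x \<notin> Z" and xa: "x \<in> ball a \<rho>" using N(2) V_ball(2) unfolding E_def by auto
        have "(\<tau>/4) powr pM \<le> (\<tau>/4) powr P x" using P_bounds[OF xZ] \<tau> by (intro powr_mono') auto
        also have "\<dots> \<le> \<bar>U x\<bar> powr P x" using lowU[OF True] P_bounds[OF xZ] pm_pos \<tau> by (intro powr_mono2) auto
        finally show ?thesis using True xa unfolding f_def by (simp add: ennreal_leI)
      qed auto
    qed
    finally show ?thesis .
  qed
  show ?thesis
  proof (rule ccontr)
    assume "\<not> ?thesis"
    then have "emeasure M (V \<inter> {x. A < G x}) \<le> emeasure M (V \<inter> {x. x \<notin> N \<and> G x \<le> A \<and> \<tau>/2 < \<bar>U x\<bar>})"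
      by simp
    also have "\<dots> \<le> emeasure M E" by (rule emeasure_mono[OF _ E_sets]) (auto simp: E_def)
    finally have bad: "emeasure M (V \<inter> {x. A < G x}) \<le> emeasure M E" .
    have "ennreal (b * (\<rho>/4) powr QM) \<le> emeasure M (ball a (\<rho>/2))"
      using ball_measure_lower[of "\<rho>/2" a] \<rho> by simp
    also have "\<dots> \<le> emeasure M ((E \<union> (V \<inter> {x. A < G x})) \<union> N)"
      using V_ball(1) sets V by (intro emeasure_mono sets.Un sets.Int E_sets) (auto simp: E_def)
    also have "\<dots> = emeasure M (E \<union> (V \<inter> {x. A < G x}))"
      using N(1) by (intro emeasure_Un_null_set sets.Un sets.Int E_sets sets V) auto
    also have "\<dots> \<le> emeasure M E + emeasure M (V \<inter> {x. A < G x})"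
      by (intro emeasure_subadditive sets.Int E_sets sets V)
    also have "\<dots> \<le> emeasure M E + emeasure M E" using bad by (intro add_left_mono)
    finally have low: "ennreal (b * (\<rho>/4) powr QM) \<le> 2 * emeasure M E" by (simp add: mult_2)
    have "ennreal (real m * (\<tau>/4) powr pM * (b * (\<rho>/4) powr QM))
        = of_nat m * ennreal ((\<tau>/4) powr pM) * ennreal (b * (\<rho>/4) powr QM)"
      using b_pos by (simp add: ennreal_mult ennreal_of_nat_eq_real_of_nat)
    also have "\<dots> \<le> of_nat m * ennreal ((\<tau>/4) powr pM) * (2 * emeasure M E)"
      using low by (intro mult_left_mono) auto
    also have "\<dots> = 2 * (of_nat m * (ennreal ((\<tau>/4) powr pM) * emeasure M E))"
      by (simp add: ac_simps)
    also have "\<dots> \<le> 2 * (of_nat m * J)" using EJ by (intro mult_left_mono) auto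
    also have "\<dots> \<le> 2 * ennreal L" using mJ by (intro mult_left_mono) auto
    also have "\<dots> = ennreal (2 * L)" using L by (simp add: ennreal_mult)
    finally show False using m(2) L by (simp add: ennreal_le_iff)
  qed
qed

text \<open>The parameters are fixed in the order \<open>A\<close>, \<open>\<rho>\<close>, \<open>m\<close>, \<open>R\<close>: first the level \<open>A\<close>, so that \<open>A < G\<close> on a set of small
  measure only; then the size \<open>\<rho>\<close> of the cells, so that \<open>U\<close> oscillates little on \<open>G \<le> A\<close>; then the number \<open>m\<close> of disjoint
  copies needed in \<open>cell_tail\<close> for cells of this size; and last the radius \<open>R\<close> beyond which there are that many.\<close>
lemma totally_bounded_in_measure:
  fixes F :: "'i set" and u g :: "'i \<Rightarrow> 'a \<Rightarrow> real"
  assumes adm: "\<And>i. i \<in> F \<Longrightarrow> admissible (u i) (g i) L" and L: "0 \<le> L"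
    and inv: "\<And>i. i \<in> F \<Longrightarrow> invariant (u i)"
    and \<tau>: "0 < \<tau>" "\<tau> \<le> 1" and \<eta>: "0 < \<eta>"
  shows "\<exists>F0\<subseteq>F. finite F0 \<and> (\<forall>i\<in>F. \<exists>j\<in>F0. emeasure M {x. \<tau> < \<bar>u i x - u j x\<bar>} \<le> ennreal \<eta>)"
proof -
  define A where "A = max 1 ((4 * L / \<eta>) powr (1 / pm))"
  have A1: "1 \<le> A" unfolding A_def by simp
  have LA: "4 * (L * A powr (-pm)) \<le> \<eta>"
  proof -
    have "4 * L / \<eta> = ((4 * L / \<eta>) powr (1 / pm)) powr pm" using pm_pos L \<eta> by (simp add: powr_powr)
    also have "\<dots> \<le> A powr pm" unfolding A_def using pm_pos by (intro powr_mono2) auto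
    finally have "4 * L \<le> \<eta> * A powr pm" using \<eta> by (simp add: field_simps)
    then show ?thesis using A1 by (simp add: powr_minus field_simps)
  qed
  define \<rho> where "\<rho> = Min {1/4, r, (\<tau> / (8 * A)) powr (1 / sm) / 2}"
  have \<rho>0: "0 < \<rho>" unfolding \<rho>_def using r_pos \<tau> A1 by simp
  have \<rho>m: "\<rho> \<le> t" if "t \<in> {1/4, r, (\<tau> / (8 * A)) powr (1 / sm) / 2}" for t
    unfolding \<rho>_def by (rule Min_le[OF _ that]) simp
  have \<rho>: "\<rho> \<le> 1/4" "\<rho> \<le> r" "\<rho> \<le> (\<tau> / (8 * A)) powr (1 / sm) / 2" by (rule \<rho>m; simp)+
  have osc: "2 * ((2 * \<rho>) powr sm * A) \<le> \<tau>/4"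
  proof -
    have "(2 * \<rho>) powr sm \<le> ((\<tau> / (8 * A)) powr (1 / sm)) powr sm"
      using \<rho>(3) \<rho>0 sm_pos by (intro powr_mono2) auto
    also have "\<dots> = \<tau> / (8 * A)" using sm_pos \<tau> A1 by (simp add: powr_powr)
    finally have "(2 * \<rho>) powr sm * A \<le> \<tau> / (8 * A) * A" using A1 by (intro mult_right_mono) auto
    then show ?thesis using A1 by simp
  qed
  obtain C :: "'a set" and V where CV: "countable C \<and> (\<forall>x R. finite (C \<inter> ball x R)) \<and>
      (\<forall>a\<in>C. V a \<in> sets borel \<and> ball a (\<rho>/2) \<subseteq> V a \<and> V a \<subseteq> ball a \<rho>) \<and>
      disjoint_family_on V C \<and> (\<Union>a\<in>C. V a) = UNIV"
    using ex_cell_partition[OF doubling \<rho>0] by (elim exE) (rule that)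
  then have cC: "countable C" and finC: "\<And>x R. finite (C \<inter> ball x R)"
    and V: "\<And>a. a \<in> C \<Longrightarrow> V a \<in> sets borel" "\<And>a. a \<in> C \<Longrightarrow> ball a (\<rho>/2) \<subseteq> V a" "\<And>a. a \<in> C \<Longrightarrow> V a \<subseteq> ball a \<rho>"
    and disj: "disjoint_family_on V C" and cov: "(\<Union>a\<in>C. V a) = UNIV"
    by (elim conjE, simp)+
  have VM: "V a \<in> sets M" if "a \<in> C" for a using V(1)[OF that] sets_M by simp
  define w where "w = (\<tau>/4) powr pM * (b * (\<rho>/4) powr QM)"
  have w: "0 < w" unfolding w_def using \<tau> \<rho>0 b_pos by simp
  obtain m :: nat where "2 * L / w < real m" using reals_Archimedean2 by blast
  then have m: "2 * L < real m * (\<tau>/4) powr pM * (b * (\<rho>/4) powr QM)"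
    using w unfolding w_def[symmetric] mult.assoc by (simp add: field_simps)
  obtain R where R: "\<And>x. x \<notin> ball x0 R \<Longrightarrow> enat m < orbit_packing H x r"
    using many_orbit_points by blast
  define I where "I = C \<inter> ball x0 R"
  have I: "finite I" "I \<subseteq> C" unfolding I_def using finC by auto
  have "\<forall>i\<in>F. \<exists>N. N \<in> null_sets M \<and> Z \<subseteq> N \<and> gradient_off N (u i) (g i)"
  proof
    fix i assume "i \<in> F"
    then obtain N where "N \<in> null_sets M" "gradient_off N (u i) (g i)" using adm unfolding admissible_def by blast
    then show "\<exists>N. N \<in> null_sets M \<and> Z \<subseteq> N \<and> gradient_off N (u i) (g i)"
      using Z_null by (intro exI[of _ "N \<union> Z"]) (auto simp: gradient_off_def)
  qed
  from bchoice[OF this] obtain N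
    where N: "\<And>i. i \<in> F \<Longrightarrow> N i \<in> null_sets M" "\<And>i. i \<in> F \<Longrightarrow> Z \<subseteq> N i" "\<And>i. i \<in> F \<Longrightarrow> gradient_off (N i) (u i) (g i)"
    by blast
  have meas: "u i \<in> borel_measurable M" "g i \<in> borel_measurable M" "N i \<in> sets M" if "i \<in> F" for i
    using adm[OF that] N(1)[OF that] unfolding admissible_def by auto
  have ug: "\<bar>u i x\<bar> \<le> g i x" if "i \<in> F" for i x using adm[OF that] unfolding admissible_def by auto
  define E where "E i = {x. x \<notin> N i \<and> g i x \<le> A}" for i
  define pt where "pt i a = (SOME y. y \<in> V a \<inter> E i)" for i a
  have pt: "pt i a \<in> V a \<inter> E i" if "x \<in> V a \<inter> E i" for i a x
    unfolding pt_def using that by (rule someI)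
  \<comment> \<open>The code of a function records, for each cell with centre in the large ball, a value on the good part of
  the cell rounded to a multiple of \<open>\<tau>/4\<close>. There are finitely many codes, since these values are bounded by \<open>A\<close>; a cell without good points gets the
  dummy value \<open>0\<close>.\<close>
  define code where "code i = restrict (\<lambda>a. if V a \<inter> E i = {} then 0 else \<lfloor>u i (pt i a) * (4/\<tau>)\<rfloor>) I" for i
  define K where "K = \<lceil>A * (4/\<tau>)\<rceil>"
  have "0 \<le> A * (4/\<tau>)" using A1 \<tau> by simp
  then have K0: "0 \<le> K" unfolding K_def by linarith
  have "code i \<in> PiE I (\<lambda>_. {-K..K})" if i: "i \<in> F" for i
  proof -
    have "\<lfloor>u i (pt i a) * (4/\<tau>)\<rfloor> \<in> {-K..K}" if ne: "V a \<inter> E i \<noteq> {}" for a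
    proof -
      have "pt i a \<in> E i" using pt ne by blast
      then have "\<bar>u i (pt i a)\<bar> \<le> A" using ug[OF i, of "pt i a"] unfolding E_def by auto
      then have "\<bar>u i (pt i a)\<bar> * (4/\<tau>) \<le> A * (4/\<tau>)" using \<tau> by (intro mult_right_mono) auto
      then have "\<bar>u i (pt i a) * (4/\<tau>)\<bar> \<le> A * (4/\<tau>)" using \<tau> by (simp add: abs_mult)
      moreover have "- \<lceil>v\<rceil> \<le> \<lfloor>t\<rfloor> \<and> \<lfloor>t\<rfloor> \<le> \<lceil>v\<rceil>" if "\<bar>t\<bar> \<le> v" for t v :: real
        using that by linarith
      ultimately show ?thesis unfolding K_def by auto
    qed
    then show ?thesis unfolding code_def using K0 by auto
  qed
  then have "code ` F \<subseteq> PiE I (\<lambda>_. {-K..K})" by blast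
  then have finF: "finite (code ` F)" by (rule finite_subset) (intro finite_PiE I(1), auto)
  define F0 where "F0 = inv_into F code ` (code ` F)"
  have F0: "F0 \<subseteq> F" "finite F0" unfolding F0_def using finF by (auto intro: inv_into_into)
  have tail: "emeasure M {x. A < g i x} \<le> ennreal (\<eta>/4)" if i: "i \<in> F" for i
  proof -
    have "emeasure M {x. A < g i x} \<le> ennreal (L * A powr (-pm))"
      using adm[OF i] A1 unfolding admissible_def by (intro Chebyshev_bound) auto
    also have "\<dots> \<le> ennreal (\<eta>/4)" using LA by (intro ennreal_leI) auto
    finally show ?thesis .
  qed
  \<comment> \<open>The part of the good set outside the large ball where \<open>u i\<close> is not small.\<close>
  define T where "T i = (\<Union>a\<in>C - I. V a \<inter> {x. x \<notin> N i \<and> g i x \<le> A \<and> \<tau>/2 < \<bar>u i x\<bar>})" for i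
  have Gm: "{x. A < g k x} \<in> sets M" if "k \<in> F" for k
  proof -
    note [measurable] = meas[OF that]
    have "{x\<in>space M. A < g k x} \<in> sets M" by measurable
    then show ?thesis by (simp add: space_M)
  qed
  have pieces: "V a \<inter> {x. x \<notin> N i \<and> g i x \<le> A \<and> \<tau>/2 < \<bar>u i x\<bar>} \<in> sets M" "V a \<inter> {x. A < g i x} \<in> sets M"
    if "i \<in> F" "a \<in> C" for i a
  proof -
    note [measurable] = meas[OF that(1)]
    have "{x\<in>space M. g i x \<le> A \<and> \<tau>/2 < \<bar>u i x\<bar>} \<in> sets M" by measurable
    then have "V a \<inter> ({x\<in>space M. g i x \<le> A \<and> \<tau>/2 < \<bar>u i x\<bar>} - N i) \<in> sets M"
      using VM[OF that(2)] meas(3)[OF that(1)] by (intro sets.Int sets.Diff)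
    also have "V a \<inter> ({x\<in>space M. g i x \<le> A \<and> \<tau>/2 < \<bar>u i x\<bar>} - N i) =
        V a \<inter> {x. x \<notin> N i \<and> g i x \<le> A \<and> \<tau>/2 < \<bar>u i x\<bar>}"
      by (auto simp: space_M)
    finally show "V a \<inter> {x. x \<notin> N i \<and> g i x \<le> A \<and> \<tau>/2 < \<bar>u i x\<bar>} \<in> sets M" .
    show "V a \<inter> {x. A < g i x} \<in> sets M" using VM[OF that(2)] Gm[OF that(1)] by (intro sets.Int)
  qed
  have Tm: "T i \<in> sets M" if "i \<in> F" for i
    unfolding T_def using cC pieces(1)[OF that] by (intro sets.countable_UN'') auto
  have T: "emeasure M (T i) \<le> ennreal (\<eta>/4)" if i: "i \<in> F" for i
  proof -
    have cCI: "countable (C - I)" using cC by simp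
    have "emeasure M (T i) = (\<integral>\<^sup>+a. emeasure M (V a \<inter> {x. x \<notin> N i \<and> g i x \<le> A \<and> \<tau>/2 < \<bar>u i x\<bar>}) \<partial>count_space (C - I))"
      unfolding T_def using pieces(1)[OF i] cCI disj
      by (intro emeasure_UN_countable) (auto simp: disjoint_family_on_def)
    also have "\<dots> \<le> (\<integral>\<^sup>+a. emeasure M (V a \<inter> {x. A < g i x}) \<partial>count_space (C - I))"
    proof (rule nn_integral_mono)
      fix a assume "a \<in> space (count_space (C - I))"
      then have a: "a \<in> C" "a \<notin> ball x0 R" unfolding I_def by auto
      show "emeasure M (V a \<inter> {x. x \<notin> N i \<and> g i x \<le> A \<and> \<tau>/2 < \<bar>u i x\<bar>}) \<le> emeasure M (V a \<inter> {x. A < g i x})"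
        by (rule cell_tail[OF adm[OF i] L inv[OF i] N(1)[OF i] N(2)[OF i] N(3)[OF i] \<tau> \<rho>0 \<rho>(1,2) osc])
          (use VM[OF a(1)] V(2,3)[OF a(1)] R[OF a(2)] m in simp_all)
    qed
    also have "\<dots> = emeasure M (\<Union>a\<in>C - I. V a \<inter> {x. A < g i x})"
      using pieces(2)[OF i] cCI disj
      by (intro emeasure_UN_countable[symmetric]) (auto simp: disjoint_family_on_def)
    also have "\<dots> \<le> emeasure M {x. A < g i x}"
      by (rule emeasure_mono[OF _ Gm[OF i]]) auto
    also have "\<dots> \<le> ennreal (\<eta>/4)" by (rule tail[OF i])
    finally show ?thesis .
  qed
  have close: "emeasure M {x. \<tau> < \<bar>u i x - u j x\<bar>} \<le> ennreal \<eta>" if ij: "i \<in> F" "j \<in> F" and eq: "code i = code j" for i j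
  proof -
    have cell: "\<bar>u k x - u k (pt k a)\<bar> \<le> \<tau>/4" if k: "k \<in> F" and a: "a \<in> C" and x: "x \<in> V a \<inter> E k" for k a x
    proof -
      let ?y = "pt k a"
      have y: "?y \<in> V a" "?y \<in> E k" using pt[OF x] by auto
      have xN: "x \<notin> N k" "g k x \<le> A" "?y \<notin> N k" "g k ?y \<le> A" using x y unfolding E_def by auto
      have "\<bar>u k x - u k ?y\<bar> \<le> 2 * ((2 * \<rho>) powr sm * A)"
        using xN x y(1) subsetD[OF V(3)[OF a]]
        by (intro oscillation_bound[OF ug[OF k] N(2,3)[OF k] \<rho>0 \<rho>(1)]) auto
      then show ?thesis using osc by linarith
    qed
    have "{x. \<tau> < \<bar>u i x - u j x\<bar>} \<subseteq> ((N i \<union> N j) \<union> ({x. A < g i x} \<union> {x. A < g j x})) \<union> (T i \<union> T j)"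
    proof
      fix x assume "x \<in> {x. \<tau> < \<bar>u i x - u j x\<bar>}"
      then have x: "\<tau> < \<bar>u i x - u j x\<bar>" by simp
      show "x \<in> ((N i \<union> N j) \<union> ({x. A < g i x} \<union> {x. A < g j x})) \<union> (T i \<union> T j)"
      proof (cases "x \<in> E i \<and> x \<in> E j")
        case False
        then show ?thesis unfolding E_def by auto
      next
        case True
        obtain a where a: "a \<in> C" "x \<in> V a" using cov by blast
        show ?thesis
        proof (cases "a \<in> I")
          case aI: True
          have "V a \<inter> E i \<noteq> {}" "V a \<inter> E j \<noteq> {}" using a(2) True by auto
          then have "\<lfloor>u i (pt i a) * (4/\<tau>)\<rfloor> = \<lfloor>u j (pt j a) * (4/\<tau>)\<rfloor>"
            using fun_cong[OF eq, of a] aI unfolding code_def by auto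
          then have "\<bar>u i (pt i a) * (4/\<tau>) - u j (pt j a) * (4/\<tau>)\<bar> < 1" by linarith
          moreover have "\<bar>u i (pt i a) * (4/\<tau>) - u j (pt j a) * (4/\<tau>)\<bar> = \<bar>u i (pt i a) - u j (pt j a)\<bar> * (4/\<tau>)"
            using \<tau> by (simp only: left_diff_distrib[symmetric] abs_mult) simp
          ultimately have "\<bar>u i (pt i a) - u j (pt j a)\<bar> * (4/\<tau>) < 1" by simp
          then have "\<bar>u i (pt i a) - u j (pt j a)\<bar> < \<tau>/4" using \<tau> by (simp add: field_simps)
          moreover have "\<bar>u i x - u i (pt i a)\<bar> \<le> \<tau>/4" "\<bar>u j x - u j (pt j a)\<bar> \<le> \<tau>/4"
            using cell[OF ij(1) a(1)] cell[OF ij(2) a(1)] a(2) True by auto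
          ultimately have "\<bar>u i x - u j x\<bar> \<le> \<tau>" using \<tau> by linarith
          then show ?thesis using x by simp
        next
          case False
          have "\<tau>/2 < \<bar>u i x\<bar> \<or> \<tau>/2 < \<bar>u j x\<bar>" using x by linarith
          then show ?thesis using a False True unfolding T_def E_def by auto
        qed
      qed
    qed
    then have "emeasure M {x. \<tau> < \<bar>u i x - u j x\<bar>} \<le> emeasure M (((N i \<union> N j) \<union> ({x. A < g i x} \<union> {x. A < g j x})) \<union> (T i \<union> T j))"
      by (rule emeasure_mono) (intro sets.Un meas(3) Gm Tm ij)
    also have "\<dots> \<le> ((emeasure M (N i) + emeasure M (N j)) + (emeasure M {x. A < g i x} + emeasure M {x. A < g j x}))
        + (emeasure M (T i) + emeasure M (T j))"
    proof -
      have sub: "emeasure M (X \<union> Y) \<le> c + d"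
        if "emeasure M X \<le> c" "emeasure M Y \<le> d" "X \<in> sets M" "Y \<in> sets M" for X Y c d
        using order_trans[OF emeasure_subadditive[OF that(3,4)] add_mono[OF that(1,2)]] .
      show ?thesis
        by (intro sub order_refl sets.Un meas(3) Gm Tm ij)
    qed
    also have "\<dots> \<le> ((0 + 0) + (ennreal (\<eta>/4) + ennreal (\<eta>/4))) + (ennreal (\<eta>/4) + ennreal (\<eta>/4))"
      using N(1) ij tail T by (intro add_mono) auto
    also have "\<dots> = ennreal \<eta>" using \<eta> by (simp add: ennreal_plus[symmetric] del: ennreal_plus)
    finally show ?thesis .
  qed
  have "\<exists>j\<in>F0. emeasure M {x. \<tau> < \<bar>u i x - u j x\<bar>} \<le> ennreal \<eta>" if i: "i \<in> F" for i
  proof (rule bexI)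
    let ?j = "inv_into F code (code i)"
    show j: "?j \<in> F0" unfolding F0_def using i by auto
    have "code ?j = code i" using i by (intro f_inv_into_f) auto
    then show "emeasure M {x. \<tau> < \<bar>u i x - u ?j x\<bar>} \<le> ennreal \<eta>"
      using close[OF i, of ?j] j F0(1) by auto
  qed
  then show ?thesis using F0 by blast
qed

end

text \<open>Between \<open>\<tau>\<close> and \<open>T\<close> the power is bounded; below \<open>\<tau>\<close> and above \<open>T\<close> the room of size \<open>d\<close> in the exponent on either
  side yields a small factor.\<close>
lemma powr_interpolation:
  fixes \<tau> T w d p \<beta> bM :: real
  assumes "0 < \<tau>" "\<tau> \<le> 1" "1 \<le> T" "0 \<le> w" "0 < d" "p + d \<le> \<beta>" "\<beta> \<le> bM" "0 \<le> p"
  shows "w powr \<beta> \<le> \<tau> powr d * w powr p + T powr (-d) * w powr (\<beta> + d) + T powr bM * (if \<tau> < w then 1 else 0)"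
proof -
  have nn: "0 \<le> \<tau> powr d * w powr p" "0 \<le> T powr (-d) * w powr (\<beta> + d)" "0 \<le> T powr bM" by auto
  consider "w = 0" | "0 < w" "w \<le> \<tau>" | "\<tau> < w" "w \<le> T" | "T < w" using assms by linarith
  then show ?thesis
  proof cases
    case 1
    then show ?thesis using assms by simp
  next
    case 2
    have "w powr \<beta> = w powr (\<beta> - p) * w powr p" using 2 by (simp add: powr_add[symmetric])
    also have "\<dots> \<le> \<tau> powr d * w powr p"
    proof (rule mult_right_mono)
      have "w powr (\<beta> - p) \<le> \<tau> powr (\<beta> - p)" using 2 assms by (intro powr_mono2) auto
      also have "\<dots> \<le> \<tau> powr d" using assms by (intro powr_mono') auto
      finally show "w powr (\<beta> - p) \<le> \<tau> powr d" .
    qed simp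
    finally show ?thesis using 2 nn by (simp add: add_increasing2)
  next
    case 3
    have "w powr \<beta> \<le> T powr \<beta>" using 3 assms by (intro powr_mono2) auto
    also have "\<dots> \<le> T powr bM" using assms by (intro powr_mono) auto
    finally show ?thesis using 3 nn by (simp add: add_increasing)
  next
    case 4
    have w: "0 < w" using 4 assms by linarith
    have "w powr \<beta> = w powr (-d) * w powr (\<beta> + d)" using w by (simp add: powr_add[symmetric])
    also have "\<dots> \<le> T powr (-d) * w powr (\<beta> + d)"
    proof (rule mult_right_mono)
      show "w powr (-d) \<le> T powr (-d)" using 4 assms w by (simp add: powr_minus le_imp_inverse_le powr_mono2)
    qed simp
    finally show ?thesis using 4 assms nn by (simp add: add_increasing add_increasing2)
  qed
qed

context invariant_gradient_space begin

text \<open>Differences of admissible functions are admissible, so their powers \<open>P\<close> and \<open>\<beta> + d\<close> have bounded integrals; by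
  \<open>powr_interpolation\<close> it remains to make the set where the difference exceeds \<open>\<tau>\<close> small. The
  numbers \<open>\<tau>\<close>, \<open>T\<close> and \<open>\<eta>\<close> are chosen such that each of the three terms is at most \<open>\<epsilon>/3\<close>.\<close>
lemma totally_bounded_in_modular:
  fixes F :: "'i set" and u g :: "'i \<Rightarrow> 'a \<Rightarrow> real"
  assumes adm: "\<And>i. i \<in> F \<Longrightarrow> admissible (u i) (g i) L" and L: "0 \<le> L"
    and inv: "\<And>i. i \<in> F \<Longrightarrow> invariant (u i)"
    and \<epsilon>: "0 < \<epsilon>" and d: "0 < d" and \<epsilon>': "0 < \<epsilon>'"
    and \<beta>_meas [measurable]: "\<beta> \<in> borel_measurable M"
    and \<beta>: "AE x in M. P x + d \<le> \<beta> x \<and> \<beta> x \<le> bM \<and> (\<beta> x + d) * (1 - S x * P x / Q x + \<epsilon>') \<le> P x"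
  shows "\<exists>F0\<subseteq>F. finite F0 \<and> (\<forall>i\<in>F. \<exists>j\<in>F0. (\<integral>\<^sup>+x. ennreal (\<bar>u i x - u j x\<bar> powr \<beta> x) \<partial>M) \<le> ennreal \<epsilon>)"
proof -
  define L' where "L' = 2 powr pM * (2 * L)"
  have L': "0 \<le> L'" unfolding L'_def using L by simp
  have diff: "admissible (\<lambda>x. u i x - u j x) (\<lambda>x. g i x + g j x) L'" if "i \<in> F" "j \<in> F" for i j
    unfolding L'_def using admissible_diff[OF adm[OF that(1)] adm[OF that(2)] L] .
  have "AE x in M. P x \<le> \<beta> x + d \<and> \<beta> x + d \<le> bM + d \<and> (\<beta> x + d) * (1 - S x * P x / Q x + \<epsilon>') \<le> P x"
    using \<beta> by eventually_elim (use d in auto)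
  from higher_integrability[OF L' \<epsilon>' this] obtain C where C: "0 \<le> C"
    and hi: "\<And>U G. admissible U G L' \<Longrightarrow> (\<integral>\<^sup>+x. ennreal (\<bar>U x\<bar> powr (\<beta> x + d)) \<partial>M) \<le> ennreal C"
    by auto
  define \<tau> where "\<tau> = min 1 ((\<epsilon> / (3 * (L' + 1))) powr (1/d))"
  have \<tau>: "0 < \<tau>" "\<tau> \<le> 1" unfolding \<tau>_def using \<epsilon> L' by auto
  have \<tau>L: "\<tau> powr d * L' \<le> \<epsilon>/3"
  proof -
    have "\<tau> powr d \<le> ((\<epsilon> / (3 * (L' + 1))) powr (1/d)) powr d" unfolding \<tau>_def using d \<epsilon> L' by (intro powr_mono2) auto
    also have "\<dots> = \<epsilon> / (3 * (L' + 1))" using d \<epsilon> L' by (simp add: powr_powr)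
    finally have "\<tau> powr d * L' \<le> \<epsilon> / (3 * (L' + 1)) * L'" using L' by (intro mult_right_mono) auto
    also have "\<dots> \<le> \<epsilon> / (3 * (L' + 1)) * (L' + 1)" using L' \<epsilon> by (intro mult_left_mono) auto
    also have "\<dots> = \<epsilon>/3"
    proof -
      have "\<epsilon> / (3 * c) * c = \<epsilon>/3" if "c \<noteq> 0" for c :: real using that by simp
      then show ?thesis using L' by (metis add_nonneg_pos less_irrefl zero_less_one)
    qed
    finally show ?thesis .
  qed
  define T where "T = max 1 ((3 * C / \<epsilon>) powr (1/d))"
  have T: "1 \<le> T" unfolding T_def by simp
  have TC: "T powr (-d) * C \<le> \<epsilon>/3"
  proof -
    have "3 * C / \<epsilon> = ((3 * C / \<epsilon>) powr (1/d)) powr d" using d C \<epsilon> by (simp add: powr_powr)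
    also have "\<dots> \<le> T powr d" unfolding T_def using d by (intro powr_mono2) auto
    finally have "3 * C \<le> \<epsilon> * T powr d" using \<epsilon> by (simp add: field_simps)
    then show ?thesis using T by (simp add: powr_minus field_simps)
  qed
  define \<eta> where "\<eta> = \<epsilon> / (3 * T powr bM)"
  have \<eta>: "0 < \<eta>" unfolding \<eta>_def using \<epsilon> T by simp
  have "\<exists>F0\<subseteq>F. finite F0 \<and> (\<forall>i\<in>F. \<exists>j\<in>F0. emeasure M {x. \<tau> < \<bar>u i x - u j x\<bar>} \<le> ennreal \<eta>)"
    by (rule totally_bounded_in_measure[OF adm L inv \<tau> \<eta>])
  then obtain F0 where F0: "F0 \<subseteq> F" "finite F0" "\<forall>i\<in>F. \<exists>j\<in>F0. emeasure M {x. \<tau> < \<bar>u i x - u j x\<bar>} \<le> ennreal \<eta>"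
    by (elim exE conjE) (rule that)
  have "(\<integral>\<^sup>+x. ennreal (\<bar>u i x - u j x\<bar> powr \<beta> x) \<partial>M) \<le> ennreal \<epsilon>"
    if ij: "i \<in> F" "j \<in> F" and close: "emeasure M {x. \<tau> < \<bar>u i x - u j x\<bar>} \<le> ennreal \<eta>" for i j
  proof -
    define W where "W x = u i x - u j x" for x
    have a: "admissible W (\<lambda>x. g i x + g j x) L'" using diff[OF ij] unfolding W_def .
    then have [measurable]: "W \<in> borel_measurable M" "(\<lambda>x. g i x + g j x) \<in> borel_measurable M"
      and Wg: "\<And>x. \<bar>W x\<bar> \<le> g i x + g j x" and gL: "(\<integral>\<^sup>+x. ennreal ((g i x + g j x) powr P x) \<partial>M) \<le> ennreal L'"
      unfolding admissible_def by auto
    have "{x\<in>space M. \<tau> < \<bar>W x\<bar>} \<in> sets M" by measurable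
    then have big [measurable]: "{x. \<tau> < \<bar>W x\<bar>} \<in> sets M" by (simp add: space_M)
    have low: "(\<integral>\<^sup>+x. ennreal (\<bar>W x\<bar> powr P x) \<partial>M) \<le> ennreal L'"
    proof (rule order_trans[OF nn_integral_mono_AE gL])
      show "AE x in M. ennreal (\<bar>W x\<bar> powr P x) \<le> ennreal ((g i x + g j x) powr P x)"
        using AE_notin_Z
      proof eventually_elim
        case (elim x)
        then show ?case using Wg[of x] P_bounds[OF elim] pm_pos by (intro ennreal_leI powr_mono2) auto
      qed
    qed
    have "(\<integral>\<^sup>+x. ennreal (\<bar>W x\<bar> powr \<beta> x) \<partial>M) \<le> (\<integral>\<^sup>+x. ennreal (\<tau> powr d) * ennreal (\<bar>W x\<bar> powr P x)
        + ennreal (T powr (-d)) * ennreal (\<bar>W x\<bar> powr (\<beta> x + d))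
        + ennreal (T powr bM) * indicator {x. \<tau> < \<bar>W x\<bar>} x \<partial>M)"
    proof (rule nn_integral_mono_AE)
      show "AE x in M. ennreal (\<bar>W x\<bar> powr \<beta> x) \<le> ennreal (\<tau> powr d) * ennreal (\<bar>W x\<bar> powr P x)
        + ennreal (T powr (-d)) * ennreal (\<bar>W x\<bar> powr (\<beta> x + d))
        + ennreal (T powr bM) * indicator {x. \<tau> < \<bar>W x\<bar>} x"
        using \<beta> AE_notin_Z
      proof eventually_elim
        case (elim x)
        have "\<bar>W x\<bar> powr \<beta> x \<le> \<tau> powr d * \<bar>W x\<bar> powr P x + T powr (-d) * \<bar>W x\<bar> powr (\<beta> x + d)
            + T powr bM * (if \<tau> < \<bar>W x\<bar> then 1 else 0)"
          using elim P_bounds[OF elim(2)] pm_pos d by (intro powr_interpolation[OF \<tau> T]) auto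
        then have "ennreal (\<bar>W x\<bar> powr \<beta> x) \<le> ennreal (\<tau> powr d * \<bar>W x\<bar> powr P x + T powr (-d) * \<bar>W x\<bar> powr (\<beta> x + d)
            + T powr bM * (if \<tau> < \<bar>W x\<bar> then 1 else 0))" by (rule ennreal_leI)
        also have "\<dots> = ennreal (\<tau> powr d) * ennreal (\<bar>W x\<bar> powr P x)
          + ennreal (T powr (-d)) * ennreal (\<bar>W x\<bar> powr (\<beta> x + d))
          + ennreal (T powr bM) * indicator {x. \<tau> < \<bar>W x\<bar>} x"
          by (simp add: ennreal_plus ennreal_mult indicator_def)
        finally show ?case .
      qed
    qed
    also have "\<dots> = ennreal (\<tau> powr d) * (\<integral>\<^sup>+x. ennreal (\<bar>W x\<bar> powr P x) \<partial>M)
        + ennreal (T powr (-d)) * (\<integral>\<^sup>+x. ennreal (\<bar>W x\<bar> powr (\<beta> x + d)) \<partial>M)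
        + ennreal (T powr bM) * emeasure M {x. \<tau> < \<bar>W x\<bar>}"
      by (simp add: nn_integral_add nn_integral_cmult nn_integral_cmult_indicator)
    also have "\<dots> \<le> ennreal (\<tau> powr d) * ennreal L' + ennreal (T powr (-d)) * ennreal C + ennreal (T powr bM) * ennreal \<eta>"
      using low hi[OF a] close unfolding W_def by (intro add_mono mult_left_mono) auto
    also have "\<dots> = ennreal (\<tau> powr d * L' + T powr (-d) * C + T powr bM * \<eta>)"
      using L' C \<eta> by (simp add: ennreal_plus ennreal_mult)
    also have "\<dots> \<le> ennreal \<epsilon>"
    proof (rule ennreal_leI)
      have "T powr bM * \<eta> = \<epsilon>/3" unfolding \<eta>_def using T by simp
      then show "\<tau> powr d * L' + T powr (-d) * C + T powr bM * \<eta> \<le> \<epsilon>" using \<tau>L TC by linarith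
    qed
    finally show ?thesis unfolding W_def .
  qed
  then show ?thesis using F0 by (intro exI[of _ F0]) blast
qed

end

section \<open>From the function spaces to pairs with a gradient\<close>

context gradient_space begin

text \<open>The integrability of \<open>h\<close> makes it finite almost everywhere; at the other points both members of the pair are
  set to \<open>0\<close>, which keeps \<open>\<bar>U\<bar> \<le> G\<close> everywhere. The factor \<open>c\<close> stays outside, so that \<open>L\<close> does not depend on it.\<close>
lemma admissible_of_extended:
  assumes w [measurable]: "w \<in> borel_measurable M" and h [measurable]: "h \<in> borel_measurable M"
    and c: "0 < c" and wh: "\<And>x. abs_fun w x \<le> ennreal c * h x"
    and hL: "(\<integral>\<^sup>+x. enn_powr (h x) (P x) \<partial>M) \<le> ennreal L"
    and N: "N \<in> null_sets M"
    and grad: "\<And>x y. x \<notin> N \<Longrightarrow> y \<notin> N \<Longrightarrow> 0 < dist x y \<Longrightarrow> dist x y < 1 \<Longrightarrow>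
      e2ennreal \<bar>w x - w y\<bar>
        \<le> ennreal c * (ennreal (dist x y powr S x) * h x + ennreal (dist x y powr S y) * h y)"
  shows "\<exists>U G. admissible U G L \<and> (AE x in M. w x = ereal (c * U x))"
proof -
  define U where "U x = (if h x < top then real_of_ereal (w x) / c else 0)" for x
  define G where "G x = enn2real (h x)" for x
  have [measurable]: "U \<in> borel_measurable M" "G \<in> borel_measurable M"
    unfolding U_def[abs_def] G_def[abs_def] by measurable
  have wU: "w x = ereal (c * U x)" if "h x < top" for x
  proof -
    have "ennreal c * h x < top" using that by (simp add: ennreal_mult_less_top)
    then have "abs_fun w x < top" using wh[of x] by (rule order.strict_trans1[rotated])
    then have "\<bar>w x\<bar> \<noteq> \<infinity>" unfolding abs_fun_def by auto
    then show ?thesis using that c unfolding U_def by (auto simp: ereal_real)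
  qed
  have UG: "\<bar>U x\<bar> \<le> G x" for x
  proof (cases "h x < top")
    case True
    then obtain a where a: "h x = ennreal a" "0 \<le> a" by (cases "h x") auto
    have "ennreal \<bar>c * U x\<bar> = abs_fun w x" unfolding abs_fun_def wU[OF True] by simp
    also have "\<dots> \<le> ennreal (c * a)" using wh[of x] a c by (simp add: ennreal_mult)
    finally have "\<bar>c * U x\<bar> \<le> c * a" using a c by (subst (asm) ennreal_le_iff) auto
    then have "\<bar>U x\<bar> \<le> a" using c by (simp add: abs_mult)
    then show ?thesis unfolding G_def using a by simp
  qed (simp add: U_def G_def)
  have fin: "AE x in M. h x < top"
  proof -
    have "(\<integral>\<^sup>+x. enn_powr (h x) (P x) \<partial>M) \<noteq> \<infinity>" using hL by (auto simp: top_unique)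
    then have "AE x in M. enn_powr (h x) (P x) \<noteq> \<infinity>" by (rule nn_integral_PInf_AE[rotated]) measurable
    then show ?thesis by eventually_elim (auto simp: enn_powr_def less_top[symmetric])
  qed
  then obtain N' where N': "{x\<in>space M. \<not> h x < top} \<subseteq> N'" "N' \<in> null_sets M"
    by (auto elim!: AE_E intro: null_setsI)
  have G_L: "(\<integral>\<^sup>+x. ennreal (G x powr P x) \<partial>M) \<le> ennreal L"
  proof (rule order_trans[OF nn_integral_mono_AE hL])
    show "AE x in M. ennreal (G x powr P x) \<le> enn_powr (h x) (P x)"
      using fin by eventually_elim (auto simp: enn_powr_def G_def)
  qed
  have "gradient_off (N \<union> N') U G"
    unfolding gradient_off_def
  proof (intro ballI impI)
    fix x y assume xy: "x \<in> - (N \<union> N')" "y \<in> - (N \<union> N')" "dist x y < 1"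
    have fx: "h x < top" and fy: "h y < top" using xy N'(1) space_M by auto
    obtain a e where a: "h x = ennreal a" "0 \<le> a" "h y = ennreal e" "0 \<le> e"
      using fx fy by (cases "h x"; cases "h y") auto
    show "\<bar>U x - U y\<bar> \<le> dist x y powr S x * G x + dist x y powr S y * G y"
    proof (cases "x = y")
      case False
      have "ennreal (c * \<bar>U x - U y\<bar>) = e2ennreal \<bar>w x - w y\<bar>"
        unfolding wU[OF fx] wU[OF fy] using c by (simp add: abs_mult right_diff_distrib[symmetric])
      also have "\<dots> \<le> ennreal c * (ennreal (dist x y powr S x) * h x + ennreal (dist x y powr S y) * h y)"
        using xy False by (intro grad) auto
      also have "\<dots> = ennreal (c * (dist x y powr S x * a + dist x y powr S y * e))"
        using a c by (simp add: ennreal_mult ennreal_plus)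
      finally have "c * \<bar>U x - U y\<bar> \<le> c * (dist x y powr S x * a + dist x y powr S y * e)"
        using a c by (subst (asm) ennreal_le_iff) auto
      then show ?thesis using c a unfolding G_def by simp
    qed simp
  qed
  moreover have "N \<union> N' \<in> null_sets M" using N N' by auto
  ultimately have "admissible U G L" unfolding admissible_def using UG G_L by auto
  moreover have "AE x in M. w x = ereal (c * U x)" using fin by eventually_elim (rule wU)
  ultimately show ?thesis by blast
qed

text \<open>With \<open>\<kappa> = 1 - S P / Q\<close> the critical exponent is \<open>P / \<kappa>\<close>, and \<open>(P / \<kappa> - d) * (\<kappa> + \<epsilon>)\<close> is below \<open>P\<close> as soon as
  \<open>P / \<kappa> * \<epsilon> \<le> d * \<kappa>\<close>. Since \<open>\<kappa>\<close> is bounded below by \<open>k\<close>, one \<open>\<epsilon>\<close> serves all points.\<close>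
lemma exponent_room:
  assumes d: "0 < d"
  shows "\<exists>\<epsilon>>0. \<forall>x a. x \<notin> Z \<longrightarrow> 0 \<le> a \<longrightarrow> a + d \<le> Q x * P x / (Q x - S x * P x) \<longrightarrow> a * (1 - S x * P x / Q x + \<epsilon>) \<le> P x"
proof -
  define k where "k = \<delta> / (\<bar>QM\<bar> + \<delta>)"
  have k: "0 < k" unfolding k_def using \<delta>_pos by (simp add: add_nonneg_pos)
  define \<epsilon> where "\<epsilon> = d * k * k / (\<bar>pM\<bar> + 1)"
  have \<epsilon>: "0 < \<epsilon>" unfolding \<epsilon>_def using d k by simp
  have "a * (1 - S x * P x / Q x + \<epsilon>) \<le> P x"
    if x: "x \<notin> Z" and a: "0 \<le> a" "a + d \<le> Q x * P x / (Q x - S x * P x)" for x a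
  proof -
    have b: "pm \<le> P x" "P x \<le> pM" "sm \<le> S x" "Q x \<le> QM" "S x * P x + \<delta> \<le> Q x"
      using P_bounds[OF x] S_bounds[OF x] Q_le[OF x] gap[OF x] by auto
    have SP: "0 \<le> S x * P x" using b pm_pos sm_pos by simp
    have Q0: "0 < Q x" "\<delta> \<le> Q x - S x * P x" using b SP \<delta>_pos by linarith+
    define \<kappa> where "\<kappa> = 1 - S x * P x / Q x"
    have \<kappa>: "\<kappa> = (Q x - S x * P x) / Q x" unfolding \<kappa>_def using Q0 by (simp add: field_simps)
    have k\<kappa>: "k \<le> \<kappa>" unfolding k_def \<kappa> using Q0 b \<delta>_pos by (intro frac_le) auto
    have g: "Q x * P x / (Q x - S x * P x) = P x / \<kappa>" unfolding \<kappa> by simp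
    have "a \<le> P x / \<kappa> - d" using a(2) g by linarith
    then have "a * (\<kappa> + \<epsilon>) \<le> (P x / \<kappa> - d) * (\<kappa> + \<epsilon>)" using k k\<kappa> \<epsilon> by (intro mult_right_mono) auto
    also have "\<dots> = (P x / \<kappa>) * \<kappa> + (P x / \<kappa>) * \<epsilon> - d * \<kappa> - d * \<epsilon>"
      by (simp only: left_diff_distrib distrib_left diff_diff_eq diff_add_eq add_diff_eq)
    also have "(P x / \<kappa>) * \<kappa> = P x" using k k\<kappa> by simp
    also have "P x + (P x / \<kappa>) * \<epsilon> - d * \<kappa> - d * \<epsilon> \<le> P x"
    proof -
      have "(P x / \<kappa>) * \<epsilon> \<le> ((\<bar>pM\<bar> + 1) / k) * \<epsilon>"
        using b k k\<kappa> \<epsilon> pm_pos by (intro mult_right_mono frac_le) auto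
      also have "\<dots> = d * k"
      proof -
        have "(m / k) * (d * k * k / m) = d * k" if "m \<noteq> 0" for m :: real using k that by simp
        then show ?thesis unfolding \<epsilon>_def by simp
      qed
      also have "\<dots> \<le> d * \<kappa>" using k\<kappa> d by simp
      finally have "(P x / \<kappa>) * \<epsilon> \<le> d * \<kappa>" .
      moreover have "0 \<le> d * \<epsilon>" using d \<epsilon> by simp
      ultimately show ?thesis by linarith
    qed
    finally show ?thesis unfolding \<kappa>_def .
  qed
  then show ?thesis using \<epsilon> by blast
qed

end

lemma modular_real_eq:
  assumes "AE x in M. w x = ereal (W x)" and "0 < e"
  shows "modular M \<beta> (\<lambda>x. abs_fun w x / ennreal e) = (\<integral>\<^sup>+x. ennreal ((\<bar>W x\<bar> / e) powr real_of_ereal (\<beta> x)) \<partial>M)"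
  unfolding modular_def
proof (rule nn_integral_cong_AE)
  show "AE x in M. enn_powr (abs_fun w x / ennreal e) (real_of_ereal (\<beta> x)) = ennreal ((\<bar>W x\<bar> / e) powr real_of_ereal (\<beta> x))"
    using assms(1)
    by eventually_elim (use assms(2) in \<open>simp add: abs_fun_def divide_ennreal enn_powr_ennreal\<close>)
qed

lemma Lp_norm_le_of_integral:
  assumes w: "AE x in M. w x = ereal (W x)" and [measurable]: "W \<in> borel_measurable M" "\<beta> \<in> borel_measurable M"
    and \<beta>: "AE x in M. 0 \<le> real_of_ereal (\<beta> x) \<and> real_of_ereal (\<beta> x) \<le> bM"
    and e: "0 < e" "e \<le> 1" and int: "(\<integral>\<^sup>+x. ennreal (\<bar>W x\<bar> powr real_of_ereal (\<beta> x)) \<partial>M) \<le> ennreal (e powr bM)"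
  shows "Lp_norm M \<beta> (abs_fun w) \<le> ennreal e"
proof (rule Lp_norm_le[OF e(1)])
  have "modular M \<beta> (\<lambda>x. abs_fun w x / ennreal e) = (\<integral>\<^sup>+x. ennreal ((\<bar>W x\<bar> / e) powr real_of_ereal (\<beta> x)) \<partial>M)"
    by (rule modular_real_eq[OF w e(1)])
  also have "\<dots> \<le> (\<integral>\<^sup>+x. ennreal (e powr (-bM)) * ennreal (\<bar>W x\<bar> powr real_of_ereal (\<beta> x)) \<partial>M)"
  proof (rule nn_integral_mono_AE)
    show "AE x in M. ennreal ((\<bar>W x\<bar> / e) powr real_of_ereal (\<beta> x))
        \<le> ennreal (e powr (-bM)) * ennreal (\<bar>W x\<bar> powr real_of_ereal (\<beta> x))"
      using \<beta>
    proof eventually_elim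
      case (elim x)
      have "(\<bar>W x\<bar> / e) powr real_of_ereal (\<beta> x) = e powr (- real_of_ereal (\<beta> x)) * \<bar>W x\<bar> powr real_of_ereal (\<beta> x)"
        using e by (simp add: powr_divide powr_minus field_simps)
      also have "\<dots> \<le> e powr (- bM) * \<bar>W x\<bar> powr real_of_ereal (\<beta> x)"
        using elim e by (intro mult_right_mono powr_mono') auto
      finally show ?case by (simp add: ennreal_mult[symmetric] ennreal_leI)
    qed
  qed
  also have "\<dots> = ennreal (e powr (-bM)) * (\<integral>\<^sup>+x. ennreal (\<bar>W x\<bar> powr real_of_ereal (\<beta> x)) \<partial>M)"
    by (rule nn_integral_cmult) measurable
  also have "\<dots> \<le> ennreal (e powr (-bM)) * ennreal (e powr bM)" using int by (intro mult_left_mono) auto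
  also have "\<dots> = 1" using e by (simp add: ennreal_mult[symmetric] powr_add[symmetric])
  finally show "modular M \<beta> (\<lambda>x. abs_fun w x / ennreal e) \<le> 1" .
qed

context invariant_gradient_space begin

text \<open>The constant \<open>L0\<close> in \<open>key\<close> does not depend on \<open>c\<close>. Small \<open>c\<close> gives continuity: a function of norm
  below \<open>c\<close> is \<open>c\<close> times an admissible function. Large \<open>c\<close> gives the inclusion and, applied to all functions of a bounded set at once,
  its total boundedness.\<close>
lemma compactly_embedded_of_admissible:
  fixes Y :: "('a \<Rightarrow> ereal) set" and nY :: "('a \<Rightarrow> ereal) \<Rightarrow> ennreal" and \<beta> :: "'a \<Rightarrow> ereal"
  assumes Y_meas: "\<And>u. u \<in> Y \<Longrightarrow> u \<in> borel_measurable M"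
    and Y_inv: "\<And>u. u \<in> Y \<Longrightarrow> H_invariant M H u"
    and Y_fin: "\<And>u. u \<in> Y \<Longrightarrow> nY u < \<infinity>"
    and L0: "0 \<le> L0"
    and key: "\<And>w c. w \<in> borel_measurable M \<Longrightarrow> 0 < c \<Longrightarrow> nY w < ennreal c \<Longrightarrow>
      \<exists>U G. admissible U G L0 \<and> (AE x in M. w x = ereal (c * U x))"
    and \<beta>_meas [measurable]: "\<beta> \<in> borel_measurable M"
    and d: "0 < d" and \<epsilon>0: "0 < \<epsilon>0"
    and \<beta>: "AE x in M. P x + d \<le> real_of_ereal (\<beta> x) \<and> real_of_ereal (\<beta> x) \<le> bM \<and>
       (real_of_ereal (\<beta> x) + d) * (1 - S x * P x / Q x + \<epsilon>0) \<le> P x"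
  shows "compactly_embedded Y nY (Lp_space M \<beta>) (\<lambda>u. Lp_norm M \<beta> (abs_fun u))"
proof -
  define B where "B x = real_of_ereal (\<beta> x)" for x
  have [measurable]: "B \<in> borel_measurable M" unfolding B_def[abs_def] by measurable
  have BB: "AE x in M. P x + d \<le> B x \<and> B x \<le> bM \<and> (B x + d) * (1 - S x * P x / Q x + \<epsilon>0) \<le> P x"
    using \<beta> unfolding B_def .
  have \<beta>0: "AE x in M. pm \<le> B x \<and> 0 \<le> B x \<and> B x \<le> bM"
    using BB AE_notin_Z
  proof eventually_elim
    case (elim x)
    then show ?case using P_bounds[OF elim(2)] pm_pos d by auto
  qed
  have hi: "\<exists>C\<ge>0. \<forall>U G. admissible U G L \<longrightarrow> (\<integral>\<^sup>+x. ennreal (\<bar>U x\<bar> powr B x) \<partial>M) \<le> ennreal C" if "0 \<le> L" for L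
  proof (rule higher_integrability[OF that \<epsilon>0])
    show "AE x in M. P x \<le> B x \<and> B x \<le> bM \<and> B x * (1 - S x * P x / Q x + \<epsilon>0) \<le> P x"
      using BB AE_notin_Z
    proof eventually_elim
      case (elim x)
      have SP0: "0 \<le> S x * P x" and Q0: "S x * P x + \<delta> \<le> Q x"
        using S_bounds[OF elim(2)] P_bounds[OF elim(2)] pm_pos sm_pos gap[OF elim(2)] by auto
      then have "S x * P x / Q x \<le> 1" using \<delta>_pos by (simp add: divide_le_eq)
      then have "B x * (1 - S x * P x / Q x + \<epsilon>0) \<le> (B x + d) * (1 - S x * P x / Q x + \<epsilon>0)"
        using d \<epsilon>0 by (intro mult_right_mono) auto
      then show ?case using elim d by linarith
    qed
  qed
  have scaled: "\<exists>V G. admissible V G (max 1 c powr pM * L0) \<and> (AE x in M. w x = ereal (V x))"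
    if "w \<in> borel_measurable M" "0 < c" "nY w < ennreal c" for w c
  proof -
    obtain U G where "admissible U G L0" "AE x in M. w x = ereal (c * U x)" using key[OF \<open>w \<in> _\<close> \<open>0 < c\<close> \<open>nY w < _\<close>] by blast
    then show ?thesis using admissible_scale[OF _ L0 \<open>0 < c\<close>] by blast
  qed
  have sub: "Y \<subseteq> Lp_space M \<beta>"
  proof
    fix u assume u: "u \<in> Y"
    obtain c where c: "nY u < ennreal c" "0 < c"
    proof -
      obtain a where a: "nY u = ennreal a" "0 \<le> a" using Y_fin[OF u] by (cases "nY u") auto
      then have "nY u < ennreal (a + 1)" by (simp add: ennreal_less_iff)
      then show ?thesis using a by (intro that[of "a + 1"]) auto
    qed
    obtain V G where V: "admissible V G (max 1 c powr pM * L0)" "AE x in M. u x = ereal (V x)"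
      using scaled[OF Y_meas[OF u] c(2,1)] by blast
    have "0 \<le> max 1 c powr pM * L0" using L0 by simp
    from hi[OF this] obtain C where "(\<integral>\<^sup>+x. ennreal (\<bar>V x\<bar> powr B x) \<partial>M) \<le> ennreal C" using V(1) by blast
    moreover have "modular M \<beta> (\<lambda>x. abs_fun u x / ennreal 1) = (\<integral>\<^sup>+x. ennreal ((\<bar>V x\<bar> / 1) powr B x) \<partial>M)"
      unfolding B_def by (rule modular_real_eq[OF V(2)]) simp
    moreover have "abs_fun u x / ennreal 1 = ennreal 1 * abs_fun u x" for x by (simp add: divide_ennreal_def)
    ultimately have "modular M \<beta> (\<lambda>x. ennreal 1 * abs_fun u x) \<le> ennreal C" by simp
    then have "modular M \<beta> (\<lambda>x. ennreal 1 * abs_fun u x) < \<infinity>"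
      by (rule le_less_trans) simp
    then show "u \<in> Lp_space M \<beta>" unfolding Lp_space_def using Y_meas[OF u] by (auto intro: exI[of _ 1])
  qed
  have small: "\<exists>e. 0 < e \<and> e \<le> 1 \<and> ennreal e < \<epsilon>" if "0 < \<epsilon>" for \<epsilon> :: ennreal
  proof -
    obtain e' where e': "0 < e'" "e' < min 1 \<epsilon>" using dense[of 0 "min 1 \<epsilon>"] \<open>0 < \<epsilon>\<close> by auto
    then obtain e where e: "e' = ennreal e" "0 \<le> e" by (cases e') auto
    then have "0 < e" "e < 1" "ennreal e < \<epsilon>" using e' by auto
    then show ?thesis by (intro exI[of _ e]) auto
  qed
  have cont: "\<exists>\<delta>'>0. \<forall>v\<in>Y. nY (v - u) < \<delta>' \<longrightarrow> Lp_norm M \<beta> (abs_fun (v - u)) < \<epsilon>"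
    if u: "u \<in> Y" and \<epsilon>: "0 < \<epsilon>" for u and \<epsilon> :: ennreal
  proof -
    obtain e where e: "0 < e" "e \<le> 1" "ennreal e < \<epsilon>" using small[OF \<epsilon>] by blast
    obtain C where C: "0 \<le> C" "\<And>U G. admissible U G L0 \<Longrightarrow> (\<integral>\<^sup>+x. ennreal (\<bar>U x\<bar> powr B x) \<partial>M) \<le> ennreal C"
      using hi[OF L0] by blast
    \<comment> \<open>Multiplication by \<open>D \<le> 1\<close> shrinks the integral of the power \<open>B\<close> by the factor \<open>D powr pm\<close> at least, as \<open>pm \<le> B\<close>.\<close>
    define D where "D = min 1 ((e powr bM / (C + 1)) powr (1/pm))"
    have D: "0 < D" "D \<le> 1" unfolding D_def using e C(1) by auto
    have DC: "D powr pm * C \<le> e powr bM"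
    proof -
      have "D powr pm \<le> ((e powr bM / (C + 1)) powr (1/pm)) powr pm"
        unfolding D_def using e C(1) pm_pos by (intro powr_mono2) auto
      also have "\<dots> = e powr bM / (C + 1)" using pm_pos C(1) by (simp add: powr_powr)
      finally have "D powr pm * C \<le> e powr bM / (C + 1) * (C + 1)" using C(1) by (intro mult_mono) auto
      then show ?thesis using C(1) by simp
    qed
    have "Lp_norm M \<beta> (abs_fun (v - u)) < \<epsilon>" if v: "v \<in> Y" and near: "nY (v - u) < ennreal D" for v
    proof -
      have wm: "v - u \<in> borel_measurable M" unfolding fun_diff_def using Y_meas[OF v] Y_meas[OF u] by measurable
      obtain U G where U: "admissible U G L0" "AE x in M. (v - u) x = ereal (D * U x)"
        using key[OF wm D(1) near] by blast
      have [measurable]: "U \<in> borel_measurable M" using U(1) unfolding admissible_def by simp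
      have "(\<integral>\<^sup>+x. ennreal (\<bar>D * U x\<bar> powr B x) \<partial>M) \<le> (\<integral>\<^sup>+x. ennreal (D powr pm) * ennreal (\<bar>U x\<bar> powr B x) \<partial>M)"
      proof (rule nn_integral_mono_AE)
        show "AE x in M. ennreal (\<bar>D * U x\<bar> powr B x) \<le> ennreal (D powr pm) * ennreal (\<bar>U x\<bar> powr B x)"
          using \<beta>0
        proof eventually_elim
          case (elim x)
          have "\<bar>D * U x\<bar> powr B x = D powr B x * \<bar>U x\<bar> powr B x" using D by (simp add: abs_mult powr_mult)
          also have "\<dots> \<le> D powr pm * \<bar>U x\<bar> powr B x" using elim D by (intro mult_right_mono powr_mono') auto
          finally show ?case by (simp add: ennreal_mult[symmetric] ennreal_leI)
        qed
      qed
      also have "\<dots> = ennreal (D powr pm) * (\<integral>\<^sup>+x. ennreal (\<bar>U x\<bar> powr B x) \<partial>M)" by (rule nn_integral_cmult) measurable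
      also have "\<dots> \<le> ennreal (D powr pm) * ennreal C" using C(2)[OF U(1)] by (intro mult_left_mono) auto
      also have "\<dots> \<le> ennreal (e powr bM)" using DC C(1) by (simp add: ennreal_mult[symmetric] ennreal_leI)
      finally have "Lp_norm M \<beta> (abs_fun (v - u)) \<le> ennreal e"
        using \<beta>0 unfolding B_def
        by (intro Lp_norm_le_of_integral[OF U(2) _ _ _ e(1,2), of \<beta> bM]) (auto elim!: eventually_mono)
      then show ?thesis using e(3) by (rule le_less_trans)
    qed
    then show ?thesis using D by (intro exI[of _ "ennreal D"]) auto
  qed
  have tb: "\<exists>F0. finite F0 \<and> F0 \<subseteq> Lp_space M \<beta> \<and> (\<forall>u\<in>F. \<exists>v\<in>F0. Lp_norm M \<beta> (abs_fun (u - v)) < \<epsilon>)"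
    if F: "F \<subseteq> Y" and K: "K < \<infinity>" "\<And>u. u \<in> F \<Longrightarrow> nY u \<le> K" and \<epsilon>: "0 < \<epsilon>" for F K and \<epsilon> :: ennreal
  proof -
    obtain e where e: "0 < e" "e \<le> 1" "ennreal e < \<epsilon>" using small[OF \<epsilon>] by blast
    obtain k where k: "K = ennreal k" "0 \<le> k" using K(1) by (cases K) auto
    define c where "c = k + 1"
    have c: "0 < c" "K < ennreal c" using k unfolding c_def by (auto simp: ennreal_less_iff)
    define L where "L = max 1 c powr pM * L0"
    have L: "0 \<le> L" unfolding L_def using L0 by simp
    have "\<forall>u\<in>F. \<exists>VG. admissible (fst VG) (snd VG) L \<and> (AE x in M. u x = ereal (fst VG x))"
    proof
      fix u assume u: "u \<in> F"
      then have uY: "u \<in> Y" using F by blast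
      have "nY u < ennreal c" using K(2)[OF u] c(2) by (rule le_less_trans)
      from scaled[OF Y_meas[OF uY] c(1) this]
      show "\<exists>VG. admissible (fst VG) (snd VG) L \<and> (AE x in M. u x = ereal (fst VG x))" unfolding L_def by auto
    qed
    from bchoice[OF this] obtain VG
      where VG: "\<forall>u\<in>F. admissible (fst (VG u)) (snd (VG u)) L \<and> (AE x in M. u x = ereal (fst (VG u) x))" by (elim exE) (rule that)
    define V where "V u = fst (VG u)" for u
    define G where "G u = snd (VG u)" for u
    have adm: "admissible (V u) (G u) L" and Veq: "AE x in M. u x = ereal (V u x)" if "u \<in> F" for u
      using VG that unfolding V_def G_def by auto
    have inv: "invariant (V u)" if u: "u \<in> F" for u
      unfolding invariant_def
    proof
      fix h assume h: "h \<in> H"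
      have D: "distr M M h = M" using H_iso h unfolding Iso_def by auto
      have hm: "h \<in> measurable M M" using H_measurable[OF h] .
      have Veq': "AE x in distr M M h. u x = ereal (V u x)" using Veq[OF u] unfolding D .
      have "AE x in M. u (h x) = ereal (V u (h x))" by (rule AE_distrD[OF hm Veq'])
      moreover have "AE x in M. u (h x) = u x" using Y_inv u F h unfolding H_invariant_def by blast
      ultimately show "AE x in M. V u (h x) = V u x" using Veq[OF u] by eventually_elim auto
    qed
    have "\<exists>F0\<subseteq>F. finite F0 \<and> (\<forall>i\<in>F. \<exists>j\<in>F0. (\<integral>\<^sup>+x. ennreal (\<bar>V i x - V j x\<bar> powr B x) \<partial>M) \<le> ennreal (e powr bM))"
      using e(1) by (intro totally_bounded_in_modular[OF adm L inv _ d \<epsilon>0 _ BB]) auto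
    then obtain F0 where F0: "F0 \<subseteq> F" "finite F0"
      "\<forall>i\<in>F. \<exists>j\<in>F0. (\<integral>\<^sup>+x. ennreal (\<bar>V i x - V j x\<bar> powr B x) \<partial>M) \<le> ennreal (e powr bM)"
      by (elim exE conjE) (rule that)
    show ?thesis
    proof (intro exI[of _ F0] conjI ballI)
      show "finite F0" by fact
      show "F0 \<subseteq> Lp_space M \<beta>" using F0(1) F sub by (meson order_trans)
      fix u assume u: "u \<in> F"
      then obtain v where v: "v \<in> F0" "(\<integral>\<^sup>+x. ennreal (\<bar>V u x - V v x\<bar> powr B x) \<partial>M) \<le> ennreal (e powr bM)"
        using F0(3) by blast
      have vF: "v \<in> F" using v F0 by blast
      have [measurable]: "V u \<in> borel_measurable M" "V v \<in> borel_measurable M"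
        using adm[OF u] adm[OF vF] unfolding admissible_def by auto
      have eq: "AE x in M. (u - v) x = ereal (V u x - V v x)"
        using Veq[OF u] Veq[OF vF] by eventually_elim simp
      have "Lp_norm M \<beta> (abs_fun (u - v)) \<le> ennreal e"
        using \<beta>0 v(2) unfolding B_def
        by (intro Lp_norm_le_of_integral[OF eq _ _ _ e(1,2), of \<beta> bM]) (auto elim!: eventually_mono)
      then show "\<exists>v\<in>F0. Lp_norm M \<beta> (abs_fun (u - v)) < \<epsilon>" using v(1) e(3) by (meson le_less_trans)
    qed
  qed
  show ?thesis
    unfolding compactly_embedded_def
  proof (intro conjI ballI allI impI)
    show "Y \<subseteq> Lp_space M \<beta>" by (rule sub)
    show "\<exists>\<delta>'>0. \<forall>v\<in>Y. nY (v - u) < \<delta>' \<longrightarrow> Lp_norm M \<beta> (abs_fun (v - u)) < \<epsilon>" if "u \<in> Y" "0 < \<epsilon>" for u \<epsilon>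
      by (rule cont[OF that])
    fix F and \<epsilon> :: ennreal
    assume F: "F \<subseteq> Y" "\<exists>K<\<infinity>. \<forall>u\<in>F. nY u \<le> K" and \<epsilon>: "0 < \<epsilon>"
    then obtain K where K: "K < \<infinity>" "\<forall>u\<in>F. nY u \<le> K" by blast
    show "\<exists>F0. finite F0 \<and> F0 \<subseteq> Lp_space M \<beta> \<and> (\<forall>u\<in>F. \<exists>v\<in>F0. Lp_norm M \<beta> (abs_fun (u - v)) < \<epsilon>)"
      by (rule tb[OF F(1) K(1) _ \<epsilon>]) (use K(2) in blast)
  qed
qed

end

lemma abs_fun_measurable [measurable]:
  assumes [measurable]: "w \<in> borel_measurable M" shows "abs_fun w \<in> borel_measurable M"
  unfolding abs_fun_def[abs_def] by measurable

lemma ennreal_mult_divide_cancel: "0 < c \<Longrightarrow> ennreal c * (a / ennreal c) = a"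
  by (simp add: divide_ennreal_def inverse_ennreal ennreal_mult[symmetric] mult.left_commute)

lemma divide_ennreal_divide: "0 < c \<Longrightarrow> 0 < d \<Longrightarrow> a / ennreal c / ennreal d = a / ennreal (c * d)"
  by (simp add: divide_ennreal_def inverse_ennreal ennreal_mult[symmetric] mult.assoc)

context gradient_space begin

text \<open>The scales \<open>2 powi (-k)\<close> exhaust all positive distances, so the supremum of a vector gradient is a gradient for all of
  them at once. It is below the inner norm, hence in \<open>L\<^sup>p\<close>.\<close>
lemma admissible_of_M_norm:
  assumes P: "P = (\<lambda>x. real_of_ereal (p x))" and S: "S = (\<lambda>x. real_of_ereal (s x))"
    and p: "\<And>x. 0 < p x" and q: "\<And>x. 0 < q x"
    and w [measurable]: "w \<in> borel_measurable M" and c: "0 < c" and norm: "M_norm M s p q w < ennreal c"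
  shows "\<exists>U G. admissible U G 2 \<and> (AE x in M. w x = ereal (c * U x))"
proof -
  have "Lp_norm M p (abs_fun w) < ennreal c" "M_seminorm M s p q w < ennreal c"
    using norm unfolding M_norm_def by (auto intro: le_less_trans[rotated])
  then obtain g where g: "g \<in> vector_gradients M s w" "Lp_lq_norm M p q g < ennreal c"
    unfolding M_seminorm_def INF_less_iff by blast
  have 1: "modular M p (\<lambda>x. abs_fun w x / ennreal c) \<le> 1"
    by (rule modular_le_of_Lp_norm_less) fact+
  have 2: "modular M p (\<lambda>x. lq_norm (q x) (\<lambda>k. g k x) / ennreal c) \<le> 1"
    using g(2) unfolding Lp_lq_norm_def by (rule modular_le_of_Lp_norm_less) fact
  have g_meas [measurable]: "g k \<in> borel_measurable M" for k using g(1) unfolding vector_gradients_def by auto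
  obtain N where N: "N \<in> null_sets M"
    "\<And>k x y. x \<notin> N \<Longrightarrow> y \<notin> N \<Longrightarrow> 2 powi (-k-1) \<le> dist x y \<Longrightarrow> dist x y < 2 powi (-k) \<Longrightarrow>
      e2ennreal \<bar>w x - w y\<bar> \<le> ennreal (dist x y powr S x) * g k x + ennreal (dist x y powr S y) * g k y"
    using g(1) unfolding vector_gradients_def S by auto
  define h1 where "h1 x = abs_fun w x / ennreal c" for x
  define h2 where "h2 x = (SUP k. g k x / ennreal c)" for x
  define h where "h x = max (h1 x) (h2 x)" for x
  have [measurable]: "h1 \<in> borel_measurable M" "h2 \<in> borel_measurable M"
    unfolding h1_def[abs_def] h2_def[abs_def] by measurable
  have hm [measurable]: "h \<in> borel_measurable M" unfolding h_def[abs_def] by measurable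
  have gh: "g k x \<le> ennreal c * h x" for k x
  proof -
    have "g k x / ennreal c \<le> h2 x" unfolding h2_def by (rule SUP_upper) simp
    then have "ennreal c * (g k x / ennreal c) \<le> ennreal c * h x" unfolding h_def by (intro mult_left_mono) (auto simp: le_max_iff_disj)
    then show ?thesis using c by (simp add: ennreal_mult_divide_cancel)
  qed
  show ?thesis
  proof (rule admissible_of_extended[OF w hm c _ _ N(1)])
    fix x
    have "ennreal c * (abs_fun w x / ennreal c) \<le> ennreal c * h x" unfolding h_def h1_def by (intro mult_left_mono) auto
    then show "abs_fun w x \<le> ennreal c * h x" using c by (simp add: ennreal_mult_divide_cancel)
  next
    have "(\<integral>\<^sup>+x. enn_powr (h x) (P x) \<partial>M) \<le> (\<integral>\<^sup>+x. enn_powr (h1 x) (P x) + enn_powr (h2 x) (P x) \<partial>M)"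
      unfolding h_def by (intro nn_integral_mono enn_powr_max_le)
    also have "\<dots> = modular M p h1 + modular M p h2"
      using P_measurable unfolding modular_def P by (subst nn_integral_add) auto
    also have "\<dots> \<le> 1 + 1"
    proof (rule add_mono)
      show "modular M p h1 \<le> 1" using 1 unfolding h1_def .
      have "h2 x \<le> lq_norm (q x) (\<lambda>k. g k x) / ennreal c" for x
        unfolding h2_def by (intro SUP_least divide_right_mono_ennreal le_lq_norm[of "q x" "\<lambda>k. g k x"] q)
      then have "modular M p h2 \<le> modular M p (\<lambda>x. lq_norm (q x) (\<lambda>k. g k x) / ennreal c)"
        by (intro modular_mono_AE[OF _ p] AE_I2)
      then show "modular M p h2 \<le> 1" using 2 by (rule order_trans)
    qed
    finally have "(\<integral>\<^sup>+x. enn_powr (h x) (P x) \<partial>M) \<le> 1 + 1" .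
    then show "(\<integral>\<^sup>+x. enn_powr (h x) (P x) \<partial>M) \<le> ennreal 2" by simp
  next
    fix x y assume xy: "x \<notin> N" "y \<notin> N" "0 < dist x y" "dist x y < 1"
    obtain n :: nat where n: "2 powi (- int n - 1) \<le> dist x y" "dist x y < 2 powi (- int n)"
      using ex_dyadic_scale[OF xy(3,4)] by blast
    have "e2ennreal \<bar>w x - w y\<bar> \<le> ennreal (dist x y powr S x) * g (int n) x + ennreal (dist x y powr S y) * g (int n) y"
      by (rule N(2)[OF xy(1,2) n])
    also have "\<dots> \<le> ennreal (dist x y powr S x) * (ennreal c * h x) + ennreal (dist x y powr S y) * (ennreal c * h y)"
      by (intro add_mono mult_left_mono gh) auto
    also have "\<dots> = ennreal c * (ennreal (dist x y powr S x) * h x + ennreal (dist x y powr S y) * h y)"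
      by (simp add: distrib_left mult.left_commute)
    finally show "e2ennreal \<bar>w x - w y\<bar>
        \<le> ennreal c * (ennreal (dist x y powr S x) * h x + ennreal (dist x y powr S y) * h y)" .
  qed
qed

text \<open>A sum that is at most \<open>1\<close> has terms below \<open>2\<close>. Since \<open>1/q\<close> is bounded by \<open>1/qm\<close>, the factor
  \<open>a powr (1/q)\<close> with \<open>a \<le> 2\<close> is bounded as well.\<close>
lemma lq_Lp_norm_less_imp_modular:
  assumes p: "\<And>x. 0 < p x" and qm: "0 < qm" "AE x in M. ereal qm \<le> q x"
    and c: "0 < c" and norm: "lq_Lp_norm M p q g < ennreal c"
  shows "modular M p (\<lambda>x. g k x / ennreal (c * 2 powr (1/qm))) \<le> 1"
proof -
  obtain m where m: "0 < m" "ennreal m < ennreal c" "lq_Lp_modular M p q (\<lambda>k x. g k x / ennreal m) \<le> 1"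
    using norm unfolding lq_Lp_norm_def Inf_less_iff by auto
  have "Inf {ennreal a |a. a > 0 \<and> modular M p (\<lambda>x. g k x / ennreal m / ennreal (a powr real_of_ereal (1 / q x))) \<le> 1}
      \<le> lq_Lp_modular M p q (\<lambda>k x. g k x / ennreal m)"
    unfolding lq_Lp_modular_def by (rule le_infsum_ennreal)
  also have "\<dots> < ennreal 2" using m(3) by (rule le_less_trans) (simp add: one_less_numeral)
  finally obtain a where a: "0 < a" "ennreal a < ennreal 2"
      "modular M p (\<lambda>x. g k x / ennreal m / ennreal (a powr real_of_ereal (1 / q x))) \<le> 1"
    unfolding Inf_less_iff by auto
  have a2: "a \<le> 2" using a by (simp add: ennreal_less_iff)
  have mc: "m \<le> c" using m by (simp add: ennreal_less_iff)
  have "modular M p (\<lambda>x. g k x / ennreal (c * 2 powr (1/qm)))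
      \<le> modular M p (\<lambda>x. g k x / ennreal m / ennreal (a powr real_of_ereal (1 / q x)))"
  proof (rule modular_mono_AE[OF _ p])
    show "AE x in M. g k x / ennreal (c * 2 powr (1/qm)) \<le> g k x / ennreal m / ennreal (a powr real_of_ereal (1 / q x))"
      using qm(2)
    proof eventually_elim
      case (elim x)
      define e where "e = real_of_ereal (1 / q x)"
      have e: "0 \<le> e" "e \<le> 1/qm"
        using elim qm(1) unfolding e_def by (cases "q x"; auto simp: one_ereal_def frac_le)+
      have "a powr e \<le> 2 powr e" using a(1) a2 e by (intro powr_mono2) auto
      also have "\<dots> \<le> 2 powr (1/qm)" using e by (intro powr_mono) auto
      finally have "m * a powr e \<le> c * 2 powr (1/qm)" using mc m(1) by (intro mult_mono) auto
      then have "g k x / ennreal (c * 2 powr (1/qm)) \<le> g k x / ennreal (m * a powr e)"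
        using m(1) a(1) by (intro divide_ennreal_mono) auto
      also have "\<dots> = g k x / ennreal m / ennreal (a powr e)"
        using m(1) a(1) by (simp add: divide_ennreal_divide)
      finally show ?case unfolding e_def .
    qed
  qed
  then show ?thesis using a(3) by (rule order_trans)
qed

text \<open>At distances below \<open>2 powi (-n)\<close> the factor \<open>dist x y powr s\<close> is at most \<open>dist x y powr t * \<alpha> ^ n\<close> with \<open>\<alpha> < 1\<close>.
  Hence the supremum over \<open>n\<close> of \<open>\<alpha> ^ n * g n\<close> is a gradient of smoothness \<open>t\<close> for distances below \<open>1\<close>, and its integral is
  bounded by a geometric series of ratio \<open>\<zeta>\<close>.\<close>
lemma admissible_of_N_norm:
  assumes P: "P = (\<lambda>x. real_of_ereal (p x))" and S: "S = (\<lambda>x. real_of_ereal (t x))"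
    and p: "\<And>x. 0 < p x" and qm: "0 < qm" "AE x in M. ereal qm \<le> q x"
    and e: "0 < e" "AE x in M. S x + e \<le> real_of_ereal (s x)"
  shows "\<exists>L0\<ge>0. \<forall>w c. w \<in> borel_measurable M \<longrightarrow> 0 < c \<longrightarrow> N_norm M s p q w < ennreal c \<longrightarrow>
    (\<exists>U G. admissible U G L0 \<and> (AE x in M. w x = ereal (c * U x)))"
proof -
  define B where "B = 2 powr (1/qm)"
  have B: "1 \<le> B" unfolding B_def using qm by (intro ge_one_powr_ge_zero) auto
  define \<alpha> where "\<alpha> = 2 powr (-e)"
  have "2 powr (-e) < 2 powr 0" using e by (intro powr_less_mono) auto
  then have \<alpha>: "0 < \<alpha>" "\<alpha> < 1" unfolding \<alpha>_def by auto
  define \<zeta> where "\<zeta> = \<alpha> powr pm"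
  have "\<alpha> powr pm < \<alpha> powr 0" using \<alpha> pm_pos by (intro powr_less_mono') auto
  then have \<zeta>: "0 < \<zeta>" "\<zeta> < 1" unfolding \<zeta>_def using \<alpha> by auto
  define L0 where "L0 = 1 + B powr pM * (1 / (1 - \<zeta>))"
  have L0: "0 \<le> L0" unfolding L0_def using \<zeta> by (intro add_nonneg_nonneg mult_nonneg_nonneg) auto
  have "\<exists>U G. admissible U G L0 \<and> (AE x in M. w x = ereal (c * U x))"
    if w [measurable]: "w \<in> borel_measurable M" and c: "0 < c" and norm: "N_norm M s p q w < ennreal c" for w c
  proof -
    have "Lp_norm M p (abs_fun w) < ennreal c" "N_seminorm M s p q w < ennreal c"
      using norm unfolding N_norm_def by (auto intro: le_less_trans[rotated])
    then obtain g where g: "g \<in> vector_gradients M s w" "lq_Lp_norm M p q g < ennreal c"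
      unfolding N_seminorm_def INF_less_iff by blast
    have 1: "modular M p (\<lambda>x. abs_fun w x / ennreal c) \<le> 1"
      by (rule modular_le_of_Lp_norm_less) fact+
    have 2: "modular M p (\<lambda>x. g k x / ennreal (c * B)) \<le> 1" for k
      unfolding B_def by (rule lq_Lp_norm_less_imp_modular[OF p qm c g(2)])
    have g_meas [measurable]: "g k \<in> borel_measurable M" for k using g(1) unfolding vector_gradients_def by auto
    obtain N where N: "N \<in> null_sets M"
      "\<And>k x y. x \<notin> N \<Longrightarrow> y \<notin> N \<Longrightarrow> 2 powi (-k-1) \<le> dist x y \<Longrightarrow> dist x y < 2 powi (-k) \<Longrightarrow>
        e2ennreal \<bar>w x - w y\<bar> \<le> ennreal (dist x y powr real_of_ereal (s x)) * g k x
          + ennreal (dist x y powr real_of_ereal (s y)) * g k y"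
      using g(1) unfolding vector_gradients_def by auto
    obtain N' where N': "{x\<in>space M. \<not> S x + e \<le> real_of_ereal (s x)} \<subseteq> N'" "N' \<in> null_sets M"
      using e(2) by (auto elim!: AE_E intro: null_setsI)
    define f where "f n x = ennreal (\<alpha> ^ n) * (g (int n) x / ennreal c)" for n x
    define h1 where "h1 x = abs_fun w x / ennreal c" for x
    define h2 where "h2 x = (SUP n. f n x)" for x
    define h where "h x = max (h1 x) (h2 x)" for x
    have f_meas [measurable]: "f n \<in> borel_measurable M" for n unfolding f_def[abs_def] by measurable
    have [measurable]: "h1 \<in> borel_measurable M" "h2 \<in> borel_measurable M"
      unfolding h1_def[abs_def] h2_def[abs_def] by measurable
    have hm [measurable]: "h \<in> borel_measurable M" unfolding h_def[abs_def] by measurable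
    have gh: "ennreal (\<alpha> ^ n) * g (int n) x \<le> ennreal c * h x" for n x
    proof -
      have "f n x \<le> h2 x" unfolding h2_def by (rule SUP_upper) simp
      then have "ennreal c * f n x \<le> ennreal c * h x" unfolding h_def by (intro mult_left_mono) (auto simp: le_max_iff_disj)
      then show ?thesis using c unfolding f_def by (simp add: mult.left_commute[of "ennreal c"] ennreal_mult_divide_cancel)
    qed
    have fn: "(\<integral>\<^sup>+x. enn_powr (f n x) (P x) \<partial>M) \<le> ennreal (B powr pM * \<zeta> ^ n)" for n
    proof -
      have "(\<integral>\<^sup>+x. enn_powr (f n x) (P x) \<partial>M)
          \<le> (\<integral>\<^sup>+x. ennreal (B powr pM * \<zeta> ^ n) * enn_powr (g (int n) x / ennreal (c * B)) (P x) \<partial>M)"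
      proof (rule nn_integral_mono_AE)
        show "AE x in M. enn_powr (f n x) (P x)
            \<le> ennreal (B powr pM * \<zeta> ^ n) * enn_powr (g (int n) x / ennreal (c * B)) (P x)"
          using AE_notin_Z
        proof eventually_elim
          case (elim x)
          have Px: "pm \<le> P x" "P x \<le> pM" "0 < P x" using P_bounds[OF elim] pm_pos by auto
          have "f n x = ennreal (\<alpha> ^ n) * (ennreal B * (g (int n) x / ennreal c / ennreal B))"
            unfolding f_def using B by (simp add: ennreal_mult_divide_cancel)
          also have "\<dots> = ennreal (\<alpha> ^ n * B) * (g (int n) x / ennreal (c * B))"
            using B c \<alpha> by (simp add: divide_ennreal_divide ennreal_mult mult.assoc)
          finally have "enn_powr (f n x) (P x) = ennreal ((\<alpha> ^ n * B) powr P x) * enn_powr (g (int n) x / ennreal (c * B)) (P x)"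
            using \<alpha> B Px by (simp add: enn_powr_mult)
          also have "\<dots> \<le> ennreal (B powr pM * \<zeta> ^ n) * enn_powr (g (int n) x / ennreal (c * B)) (P x)"
          proof (intro mult_right_mono ennreal_leI)
            have "(\<alpha> ^ n * B) powr P x = (\<alpha> ^ n) powr P x * B powr P x" using \<alpha> B by (simp add: powr_mult)
            also have "\<dots> \<le> (\<alpha> ^ n) powr pm * B powr pM"
            proof (rule mult_mono)
              show "(\<alpha> ^ n) powr P x \<le> (\<alpha> ^ n) powr pm"
                using \<alpha> Px by (intro powr_mono') (auto simp: power_le_one)
              show "B powr P x \<le> B powr pM" using B Px by (intro powr_mono) auto
            qed auto
            also have "(\<alpha> ^ n) powr pm = \<zeta> ^ n"
              unfolding \<zeta>_def using \<alpha> by (simp add: powr_realpow[symmetric] powr_powr mult.commute)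
            finally show "(\<alpha> ^ n * B) powr P x \<le> B powr pM * \<zeta> ^ n" by (simp add: mult.commute)
          qed simp
          finally show ?case .
        qed
      qed
      also have "\<dots> = ennreal (B powr pM * \<zeta> ^ n) * (\<integral>\<^sup>+x. enn_powr (g (int n) x / ennreal (c * B)) (P x) \<partial>M)"
        by (rule nn_integral_cmult) measurable
      also have "\<dots> \<le> ennreal (B powr pM * \<zeta> ^ n) * 1"
        using 2[of "int n"] unfolding modular_def P by (intro mult_left_mono) auto
      finally show ?thesis by simp
    qed
    show ?thesis
    proof (rule admissible_of_extended[OF w hm c])
      fix x
      have "ennreal c * (abs_fun w x / ennreal c) \<le> ennreal c * h x" unfolding h_def h1_def by (intro mult_left_mono) auto
      then show "abs_fun w x \<le> ennreal c * h x" using c by (simp add: ennreal_mult_divide_cancel)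
    next
      have "(\<integral>\<^sup>+x. enn_powr (h x) (P x) \<partial>M) \<le> (\<integral>\<^sup>+x. enn_powr (h1 x) (P x) + (\<Sum>n. enn_powr (f n x) (P x)) \<partial>M)"
      proof (rule nn_integral_mono_AE)
        show "AE x in M. enn_powr (h x) (P x) \<le> enn_powr (h1 x) (P x) + (\<Sum>n. enn_powr (f n x) (P x))"
          using AE_notin_Z
        proof eventually_elim
          case (elim x)
          have "enn_powr (h x) (P x) \<le> enn_powr (h1 x) (P x) + enn_powr (h2 x) (P x)" unfolding h_def by (rule enn_powr_max_le)
          also have "\<dots> \<le> enn_powr (h1 x) (P x) + (\<Sum>n. enn_powr (f n x) (P x))"
            unfolding h2_def using P_bounds[OF elim] pm_pos by (intro add_left_mono enn_powr_SUP_le_suminf) auto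
          finally show ?case .
        qed
      qed
      also have "\<dots> = modular M p h1 + (\<Sum>n. \<integral>\<^sup>+x. enn_powr (f n x) (P x) \<partial>M)"
        using P_measurable unfolding modular_def P
        by (subst nn_integral_add) (auto simp: nn_integral_suminf)
      also have "\<dots> \<le> 1 + (\<Sum>n. ennreal (B powr pM * \<zeta> ^ n))"
        using 1 unfolding h1_def by (intro add_mono suminf_le fn) auto
      also have "(\<Sum>n. ennreal (B powr pM * \<zeta> ^ n)) = ennreal (B powr pM * (1 / (1 - \<zeta>)))"
      proof -
        have "(\<lambda>n. B powr pM * \<zeta> ^ n) sums (B powr pM * (1 / (1 - \<zeta>)))"
          using \<zeta> by (intro sums_mult geometric_sums) auto
        then show ?thesis using \<zeta> by (intro suminf_ennreal_eq) auto
      qed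
      also have "1 + ennreal (B powr pM * (1 / (1 - \<zeta>))) = ennreal L0"
        unfolding L0_def using \<zeta> by (simp add: ennreal_plus)
      finally show "(\<integral>\<^sup>+x. enn_powr (h x) (P x) \<partial>M) \<le> ennreal L0" .
    next
      show "N \<union> N' \<in> null_sets M" using N(1) N'(2) by auto
    next
      fix x y assume xy: "x \<notin> N \<union> N'" "y \<notin> N \<union> N'" "0 < dist x y" "dist x y < 1"
      obtain n :: nat where n: "2 powi (- int n - 1) \<le> dist x y" "dist x y < 2 powi (- int n)"
        using ex_dyadic_scale[OF xy(3,4)] by blast
      have summand: "ennreal (dist x y powr real_of_ereal (s z)) * g (int n) z \<le> ennreal (dist x y powr S z) * (ennreal c * h z)"
        if "z \<notin> N'" for z
      proof -
        have sz: "S z + e \<le> real_of_ereal (s z)" using that N'(1) space_M by auto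
        have "dist x y powr real_of_ereal (s z) \<le> dist x y powr (S z + e)" using sz xy by (intro powr_mono') auto
        also have "\<dots> = dist x y powr S z * dist x y powr e" by (simp add: powr_add)
        also have "\<dots> \<le> dist x y powr S z * \<alpha> ^ n"
        proof (rule mult_left_mono)
          have "dist x y \<le> 2 powr (- real n)" using n(2) by (simp add: powr_minus powr_realpow power_int_minus)
          then have "dist x y powr e \<le> (2 powr (- real n)) powr e" using e by (intro powr_mono2) auto
          also have "\<dots> = \<alpha> ^ n" unfolding \<alpha>_def by (simp add: powr_powr powr_realpow[symmetric] mult.commute)
          finally show "dist x y powr e \<le> \<alpha> ^ n" .
        qed simp
        finally have "ennreal (dist x y powr real_of_ereal (s z)) * g (int n) z \<le> ennreal (dist x y powr S z * \<alpha> ^ n) * g (int n) z"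
          by (intro mult_right_mono ennreal_leI) auto
        also have "\<dots> = ennreal (dist x y powr S z) * (ennreal (\<alpha> ^ n) * g (int n) z)"
          using \<alpha> by (simp add: ennreal_mult mult.assoc)
        also have "\<dots> \<le> ennreal (dist x y powr S z) * (ennreal c * h z)" by (intro mult_left_mono gh) auto
        finally show ?thesis .
      qed
      have "e2ennreal \<bar>w x - w y\<bar> \<le> ennreal (dist x y powr real_of_ereal (s x)) * g (int n) x
          + ennreal (dist x y powr real_of_ereal (s y)) * g (int n) y"
        using xy by (intro N(2)[OF _ _ n]) auto
      also have "\<dots> \<le> ennreal (dist x y powr S x) * (ennreal c * h x) + ennreal (dist x y powr S y) * (ennreal c * h y)"
        using xy by (intro add_mono summand) auto
      also have "\<dots> = ennreal c * (ennreal (dist x y powr S x) * h x + ennreal (dist x y powr S y) * h y)"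
        by (simp add: distrib_left mult.left_commute)
      finally show "e2ennreal \<bar>w x - w y\<bar>
          \<le> ennreal c * (ennreal (dist x y powr S x) * h x + ennreal (dist x y powr S y) * h y)" .
    qed
  qed
  then show ?thesis using L0 by blast
qed

text \<open>The distance of \<open>\<beta>\<close> to the critical exponent is split into halves: one enlarges \<open>\<beta>\<close> to \<open>\<beta> + d\<close>, the other is used up by
  \<open>exponent_room\<close>.\<close>
lemma subcritical_exponent:
  assumes P: "P = (\<lambda>x. real_of_ereal (p x))" and Q: "Q = (\<lambda>x. real_of_ereal (Q' x))" and S: "S = (\<lambda>x. real_of_ereal (s x))"
    and fin: "AE x in M. \<bar>p x\<bar> \<noteq> \<infinity> \<and> \<bar>Q' x\<bar> \<noteq> \<infinity> \<and> \<bar>s x\<bar> \<noteq> \<infinity>"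
    and \<beta>: "\<beta> \<in> bdd_exponents M" "well_below M p \<beta>" "well_below M \<beta> (\<lambda>x. Q' x * p x / (Q' x - s x * p x))"
  shows "\<exists>d>0. \<exists>\<epsilon>>0. \<exists>bM. AE x in M. P x + d \<le> real_of_ereal (\<beta> x) \<and> real_of_ereal (\<beta> x) \<le> bM \<and>
    (real_of_ereal (\<beta> x) + d) * (1 - S x * P x / Q x + \<epsilon>) \<le> P x"
proof -
  obtain bm bM where b: "0 < bm" "AE x in M. ereal bm \<le> \<beta> x \<and> \<beta> x \<le> ereal bM"
    using bdd_exponents_bounds[OF \<beta>(1)] by blast
  obtain d1 where d1: "0 < d1" "AE x in M. ereal d1 \<le> \<beta> x - p x"
    using essinf_posD[OF \<beta>(2)[unfolded well_below_def]] by blast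
  obtain d2 where d2: "0 < d2" "AE x in M. ereal d2 \<le> Q' x * p x / (Q' x - s x * p x) - \<beta> x"
    using essinf_posD[OF \<beta>(3)[unfolded well_below_def]] by blast
  define d where "d = min d1 (d2/2)"
  have d: "0 < d" "d \<le> d1" "d + d \<le> d2" unfolding d_def using d1 d2 by auto
  obtain \<epsilon> where \<epsilon>: "0 < \<epsilon>" "\<And>x a. x \<notin> Z \<Longrightarrow> 0 \<le> a \<Longrightarrow> a + d \<le> Q x * P x / (Q x - S x * P x) \<Longrightarrow>
      a * (1 - S x * P x / Q x + \<epsilon>) \<le> P x"
    using exponent_room[OF d(1)] by blast
  have "AE x in M. P x + d \<le> real_of_ereal (\<beta> x) \<and> real_of_ereal (\<beta> x) \<le> bM \<and>
    (real_of_ereal (\<beta> x) + d) * (1 - S x * P x / Q x + \<epsilon>) \<le> P x"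
    using b(2) d1(2) d2(2) fin AE_notin_Z
  proof eventually_elim
    case (elim x)
    obtain \<pi> \<theta> \<sigma> \<gamma> where r: "p x = ereal \<pi>" "Q' x = ereal \<theta>" "s x = ereal \<sigma>" "\<beta> x = ereal \<gamma>"
      using elim by (cases "p x"; cases "Q' x"; cases "s x"; cases "\<beta> x") auto
    have re: "P x = \<pi>" "Q x = \<theta>" "S x = \<sigma>" "real_of_ereal (\<beta> x) = \<gamma>" using r by (auto simp: P Q S)
    have \<gamma>: "0 < \<gamma>" "\<gamma> \<le> bM" "d1 \<le> \<gamma> - \<pi>" using elim r b(1) by auto
    have "\<theta> - \<sigma> * \<pi> \<noteq> 0" using gap[OF elim(5)] re \<delta>_pos by auto
    then have "Q' x * p x / (Q' x - s x * p x) = ereal (\<theta> * \<pi> / (\<theta> - \<sigma> * \<pi>))" using r by simp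
    then have "d2 \<le> \<theta> * \<pi> / (\<theta> - \<sigma> * \<pi>) - \<gamma>" using elim(3) r by simp
    then have "(\<gamma> + d) * (1 - S x * P x / Q x + \<epsilon>) \<le> P x"
      using d \<gamma> re by (intro \<epsilon>(2) elim(5)) auto
    then show ?case using re \<gamma> d by auto
  qed
  then show ?thesis using d(1) \<epsilon>(1) by blast
qed

end

lemma ex_invariant_gradient_space:
  fixes M :: "'a::metric_space measure" and p Q s :: "'a \<Rightarrow> ereal"
  assumes mms: "metric_measure_space M"
    and doubling: "geometrically_doubling TYPE('a)"
    and Q: "Q \<in> log_exponents M"
    and lower_reg: "lower_Ahlfors_regular M Q"
    and H: "H \<subseteq> Iso M"
    and r: "r > 0"
    and packing: "((\<lambda>R::real. INF x \<in> - ball x0 R. orbit_packing H x r) \<longlongrightarrow> \<infinity>) at_top"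
    and p: "p \<in> log_exponents M \<inter> invariant_exponents M H"
    and s: "s \<in> log_exponents M"
    and s_le: "AE x in M. s x \<le> 1"
    and \<delta>: "0 < \<delta>" "AE x in M. real_of_ereal (s x) * real_of_ereal (p x) + \<delta> \<le> real_of_ereal (Q x)"
  shows "\<exists>pm pM QM sm b Z. invariant_gradient_space M (\<lambda>x. real_of_ereal (p x)) (\<lambda>x. real_of_ereal (Q x))
    (\<lambda>x. real_of_ereal (s x)) pm pM QM sm \<delta> b Z H x0 r"
proof -
  have bdd: "p \<in> bdd_exponents M" "Q \<in> bdd_exponents M" "s \<in> bdd_exponents M"
    using p Q s unfolding log_exponents_def by auto
  obtain pm pM where pb: "0 < pm" "AE x in M. ereal pm \<le> p x \<and> p x \<le> ereal pM"
    using bdd_exponents_bounds[OF bdd(1)] by blast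
  obtain Qm QM where Qb: "0 < Qm" "AE x in M. ereal Qm \<le> Q x \<and> Q x \<le> ereal QM"
    using bdd_exponents_bounds[OF bdd(2)] by blast
  obtain sm sM where sb: "0 < sm" "AE x in M. ereal sm \<le> s x \<and> s x \<le> ereal sM"
    using bdd_exponents_bounds[OF bdd(3)] by blast
  have sets: "sets M = sets borel" and balls: "\<And>x r. 0 < r \<Longrightarrow> 0 < emeasure M (ball x r)"
    using mms unfolding metric_measure_space_def by auto
  have space: "space M = UNIV" using sets_eq_imp_space_eq[OF sets] by simp
  have "AE x in M. (ereal pm \<le> p x \<and> p x \<le> ereal pM) \<and> (ereal Qm \<le> Q x \<and> Q x \<le> ereal QM) \<and>
      (ereal sm \<le> s x \<and> s x \<le> ereal sM) \<and> s x \<le> 1 \<and>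
      real_of_ereal (s x) * real_of_ereal (p x) + \<delta> \<le> real_of_ereal (Q x)" (is "AE x in M. ?good x")
    using pb(2) Qb(2) sb(2) s_le \<delta>(2) by eventually_elim auto
  then obtain Z where "{x\<in>space M. \<not> ?good x} \<subseteq> Z" and Z_null: "Z \<in> null_sets M"
    unfolding eventually_ae_filter by (elim bexE) (rule that)
  then have Z: "?good x" if "x \<notin> Z" for x using that space by blast
  obtain b where b: "0 < b" "\<And>x r. 0 < r \<Longrightarrow> r \<le> 1 \<Longrightarrow> ennreal (b * r powr real_of_ereal (Q x)) \<le> emeasure M (ball x r)"
    using lower_reg unfolding lower_Ahlfors_regular_def by blast
  have many: "\<exists>R. \<forall>x. x \<notin> ball x0 R \<longrightarrow> enat m < orbit_packing H x r" for m
  proof -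
    have "\<forall>\<^sub>F R in at_top. enat m < (INF x \<in> - ball x0 R. orbit_packing H x r)"
      using order_tendstoD(1)[OF packing, of "enat m"] by simp
    then obtain R where R: "enat m < (INF x \<in> - ball x0 R. orbit_packing H x r)"
      unfolding eventually_at_top_linorder by blast
    show ?thesis
    proof (intro exI allI impI)
      fix x assume "x \<notin> ball x0 R"
      then have "(INF x \<in> - ball x0 R. orbit_packing H x r) \<le> orbit_packing H x r" by (intro INF_lower) simp
      then show "enat m < orbit_packing H x r" using R by (rule less_le_trans[rotated])
    qed
  qed
  have "invariant_gradient_space M (\<lambda>x. real_of_ereal (p x)) (\<lambda>x. real_of_ereal (Q x))
    (\<lambda>x. real_of_ereal (s x)) pm pM QM sm \<delta> b Z H x0 r"
  proof
    show "sets M = sets borel" by (rule sets)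
    show "0 < emeasure M (ball x \<rho>)" if "0 < \<rho>" for x \<rho> by (rule balls[OF that])
    have [measurable]: "p \<in> borel_measurable M" using bdd(1) unfolding bdd_exponents_def exponents_def by auto
    show "(\<lambda>x. real_of_ereal (p x)) \<in> borel_measurable M" by measurable
    show "0 < pm" "0 < sm" "0 < \<delta>" "0 < b" "Z \<in> null_sets M" by fact+
    fix x assume x: "x \<notin> Z"
    show "pm \<le> real_of_ereal (p x) \<and> real_of_ereal (p x) \<le> pM" using Z[OF x] by (cases "p x") auto
    show "sm \<le> real_of_ereal (s x) \<and> real_of_ereal (s x) \<le> 1" using Z[OF x] by (cases "s x") (auto simp: one_ereal_def)
    show "real_of_ereal (Q x) \<le> QM" using Z[OF x] by (cases "Q x") auto
    show "real_of_ereal (s x) * real_of_ereal (p x) + \<delta> \<le> real_of_ereal (Q x)" using Z[OF x] by auto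
  next
    fix \<epsilon> :: real assume \<epsilon>: "0 < \<epsilon>"
    show "\<exists>\<rho>>0. \<forall>x\<in>-Z. \<forall>y\<in>-Z. dist x y < \<rho> \<longrightarrow> \<bar>real_of_ereal (p x) - real_of_ereal (p y)\<bar> < \<epsilon>"
      using p Z pb(1) \<epsilon> by (intro log_exponents_uniform[of p M Z pm pM]) auto
    show "\<exists>\<rho>>0. \<forall>x\<in>-Z. \<forall>y\<in>-Z. dist x y < \<rho> \<longrightarrow> \<bar>real_of_ereal (Q x) - real_of_ereal (Q y)\<bar> < \<epsilon>"
      using Q Z Qb(1) \<epsilon> by (intro log_exponents_uniform[of Q M Z Qm QM]) auto
    show "\<exists>\<rho>>0. \<forall>x\<in>-Z. \<forall>y\<in>-Z. dist x y < \<rho> \<longrightarrow> \<bar>real_of_ereal (s x) - real_of_ereal (s y)\<bar> < \<epsilon>"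
      using s Z sb(1) \<epsilon> by (intro log_exponents_uniform[of s M Z sm sM]) auto
  next
    show "ennreal (b * \<rho> powr real_of_ereal (Q x)) \<le> emeasure M (ball x \<rho>)" if "0 < \<rho>" "\<rho> \<le> 1" for x \<rho>
      by (rule b(2)[OF that])
    show "H \<subseteq> Iso M" by (rule H)
    show "real_of_ereal (p (h x)) = real_of_ereal (p x)" if "h \<in> H" for h x
      using p that unfolding invariant_exponents_def by (auto dest!: bspec fun_cong[where x = x])
    show "0 < r" by (rule r)
    show "\<exists>R. \<forall>x. x \<notin> ball x0 R \<longrightarrow> enat m < orbit_packing H x r" for m by (rule many)
    show "geometrically_doubling TYPE('a)" by (rule doubling)
  qed
  then show ?thesis by blast
qed

text \<open>Membership only provides a finite modular for some multiple of \<open>u\<close>; dividing further by \<open>a\<close> with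
  \<open>a powr pm = k + 1\<close> brings it below \<open>1\<close>.\<close>
lemma Lp_norm_finite:
  assumes p: "p \<in> bdd_exponents M" and u: "u \<in> Lp_space M p"
  shows "Lp_norm M p (abs_fun u) < \<infinity>"
proof -
  obtain pm pM where pb: "0 < pm" "AE x in M. ereal pm \<le> p x \<and> p x \<le> ereal pM"
    using bdd_exponents_bounds[OF p] by blast
  have [measurable]: "p \<in> borel_measurable M" "u \<in> borel_measurable M"
    using p u unfolding bdd_exponents_def exponents_def Lp_space_def by auto
  obtain c where c: "0 < c" "modular M p (\<lambda>x. ennreal c * abs_fun u x) < \<infinity>" using u unfolding Lp_space_def by auto
  obtain k where k: "modular M p (\<lambda>x. ennreal c * abs_fun u x) = ennreal k" "0 \<le> k" using c(2) by (cases "modular M p (\<lambda>x. ennreal c * abs_fun u x)") auto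
  define a where "a = (k + 1) powr (1/pm)"
  have a: "1 \<le> a" unfolding a_def using k pb(1) by (intro ge_one_powr_ge_zero) auto
  have apm: "a powr pm = k + 1" unfolding a_def using k pb(1) by (simp add: powr_powr)
  have "modular M p (\<lambda>x. abs_fun u x / ennreal (a / c))
      \<le> (\<integral>\<^sup>+x. ennreal (1 / (k + 1)) * enn_powr (ennreal c * abs_fun u x) (real_of_ereal (p x)) \<partial>M)"
    unfolding modular_def
  proof (rule nn_integral_mono_AE)
    show "AE x in M. enn_powr (abs_fun u x / ennreal (a / c)) (real_of_ereal (p x))
        \<le> ennreal (1 / (k + 1)) * enn_powr (ennreal c * abs_fun u x) (real_of_ereal (p x))"
      using pb(2)
    proof eventually_elim
      case (elim x)
      then obtain t where t: "p x = ereal t" "pm \<le> t" by (cases "p x") auto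
      have "abs_fun u x / ennreal (a / c) = ennreal (1 / a) * (ennreal c * abs_fun u x)"
        using a c by (simp add: divide_ennreal_def inverse_ennreal ennreal_mult[symmetric] mult.assoc[symmetric] mult.commute field_simps)
      then have "enn_powr (abs_fun u x / ennreal (a / c)) t = ennreal ((1 / a) powr t) * enn_powr (ennreal c * abs_fun u x) t"
        using a t pb(1) by (simp add: enn_powr_mult)
      also have "\<dots> \<le> ennreal (1 / (k + 1)) * enn_powr (ennreal c * abs_fun u x) t"
      proof (intro mult_right_mono ennreal_leI)
        have "(1 / a) powr t \<le> (1 / a) powr pm" using a t by (intro powr_mono') auto
        also have "\<dots> = 1 / (k + 1)" using a apm by (simp add: powr_divide)
        finally show "(1 / a) powr t \<le> 1 / (k + 1)" .
      qed simp
      finally show ?case using t by simp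
    qed
  qed
  also have "\<dots> = ennreal (1 / (k + 1)) * modular M p (\<lambda>x. ennreal c * abs_fun u x)"
    unfolding modular_def by (rule nn_integral_cmult) measurable
  also have "\<dots> \<le> 1"
    unfolding k(1) using k(2) by (simp add: ennreal_mult[symmetric] divide_le_eq)
  finally have "modular M p (\<lambda>x. abs_fun u x / ennreal (a / c)) \<le> 1" .
  then have "Lp_norm M p (abs_fun u) \<le> ennreal (a / c)" using a c by (intro Lp_norm_le) auto
  then show ?thesis by (rule le_less_trans) simp
qed

section \<open>The compact embeddings\<close>

lemma log_exponents_facts:
  assumes "p \<in> log_exponents M"
  shows "p \<in> bdd_exponents M" "\<And>x. 0 < p x" "AE x in M. \<bar>p x\<bar> \<noteq> \<infinity>"
proof -
  show p: "p \<in> bdd_exponents M" using assms unfolding log_exponents_def by auto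
  then show "\<And>x. 0 < p x" unfolding bdd_exponents_def exponents_def by auto
  obtain pm pM where "AE x in M. ereal pm \<le> p x \<and> p x \<le> ereal pM" using bdd_exponents_bounds[OF p] by blast
  then show "AE x in M. \<bar>p x\<bar> \<noteq> \<infinity>" by eventually_elim auto
qed

theorem theorem3p12:
  fixes M :: "'a::metric_space measure"
    and Q p q s :: "'a \<Rightarrow> ereal"
    and H :: "('a \<Rightarrow> 'a) set"
    and x0 :: 'a and r :: real
  assumes mms: "metric_measure_space M"
    and doubling: "geometrically_doubling TYPE('a)"
    and unit_balls: "(SUP x. emeasure M (ball x 1)) < \<infinity>"
    and Q: "Q \<in> log_exponents M"
    and lower_reg: "lower_Ahlfors_regular M Q"
    and H: "H \<subseteq> Iso M"
    and r: "r > 0"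
    and packing: "((\<lambda>R::real. INF x \<in> - ball x0 R. orbit_packing H x r) \<longlongrightarrow> \<infinity>) at_top"
    and p: "p \<in> log_exponents M \<inter> invariant_exponents M H"
    and q: "q \<in> exponents M"
    and s: "s \<in> log_exponents M"
    and s_le: "esssup M s \<le> 1"
    and sp: "well_below M (\<lambda>x. s x * p x) Q"
  shows "(\<forall>\<beta> \<in> bdd_exponents M.
            well_below M p \<beta> \<and> well_below M \<beta> (\<lambda>x. Q x * p x / (Q x - s x * p x)) \<longrightarrow>
            compactly_embedded
              (M_space_inv M s p q H) (M_norm M s p q)
              (Lp_space M \<beta>) (\<lambda>u. Lp_norm M \<beta> (abs_fun u)))
       \<and> (\<forall>t \<in> log_exponents M. well_below M t s \<longrightarrow>
            (\<forall>\<beta> \<in> bdd_exponents M.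
               well_below M p \<beta> \<and> well_below M \<beta> (\<lambda>x. Q x * p x / (Q x - t x * p x)) \<longrightarrow>
               compactly_embedded
                 (N_space_inv M s p q H) (N_norm M s p q)
                 (Lp_space M \<beta>) (\<lambda>u. Lp_norm M \<beta> (abs_fun u))))"
proof (intro conjI ballI impI)
  have p': "p \<in> log_exponents M" and q_pos: "\<And>x. 0 < q x" and q_inf: "0 < essinf M q"
    using p q unfolding exponents_def by auto
  note pf = log_exponents_facts[OF p'] and Qf = log_exponents_facts[OF Q] and sf = log_exponents_facts[OF s]
  have s1: "AE x in M. s x \<le> 1"
    using esssup_AE[of s M] by eventually_elim (use s_le in auto)
  obtain \<delta> where \<delta>: "0 < \<delta>" "AE x in M. ereal \<delta> \<le> Q x - s x * p x"
    using essinf_posD[OF sp[unfolded well_below_def]] by blast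
  have gap: "AE x in M. real_of_ereal (s x) * real_of_ereal (p x) + \<delta> \<le> real_of_ereal (Q x)"
    using \<delta>(2) pf(3) Qf(3) sf(3)
  proof eventually_elim
    case (elim x)
    then show ?case by (cases "p x"; cases "Q x"; cases "s x") auto
  qed
  show "compactly_embedded (M_space_inv M s p q H) (M_norm M s p q) (Lp_space M \<beta>) (\<lambda>u. Lp_norm M \<beta> (abs_fun u))"
    if \<beta>: "\<beta> \<in> bdd_exponents M"
      and b: "well_below M p \<beta> \<and> well_below M \<beta> (\<lambda>x. Q x * p x / (Q x - s x * p x))" for \<beta>
  proof -
    obtain pm pM QM sm b Z where "invariant_gradient_space M (\<lambda>x. real_of_ereal (p x)) (\<lambda>x. real_of_ereal (Q x))
        (\<lambda>x. real_of_ereal (s x)) pm pM QM sm \<delta> b Z H x0 r"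
      using ex_invariant_gradient_space[OF mms doubling Q lower_reg H r packing p s s1 \<delta>(1) gap] by blast
    then interpret invariant_gradient_space M "\<lambda>x. real_of_ereal (p x)" "\<lambda>x. real_of_ereal (Q x)"
        "\<lambda>x. real_of_ereal (s x)" pm pM QM sm \<delta> b Z H x0 r .
    have "AE x in M. \<bar>p x\<bar> \<noteq> \<infinity> \<and> \<bar>Q x\<bar> \<noteq> \<infinity> \<and> \<bar>s x\<bar> \<noteq> \<infinity>"
      using pf(3) Qf(3) sf(3) by eventually_elim auto
    from subcritical_exponent[OF refl refl refl this \<beta>] \<open>well_below M p \<beta> \<and> _\<close>
    obtain d \<epsilon> bM where d: "0 < d" "0 < \<epsilon>"
      "AE x in M. real_of_ereal (p x) + d \<le> real_of_ereal (\<beta> x) \<and> real_of_ereal (\<beta> x) \<le> bM \<and>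
        (real_of_ereal (\<beta> x) + d) * (1 - real_of_ereal (s x) * real_of_ereal (p x) / real_of_ereal (Q x) + \<epsilon>)
          \<le> real_of_ereal (p x)"
      by blast
    show ?thesis
    proof (rule compactly_embedded_of_admissible[OF _ _ _ _ _ _ d])
      fix u assume u: "u \<in> M_space_inv M s p q H"
      then have uL: "u \<in> Lp_space M p" and "M_seminorm M s p q u < \<infinity>" and "H_invariant M H u"
        unfolding M_space_inv_def M_space_def by auto
      then show "u \<in> borel_measurable M" "H_invariant M H u" unfolding Lp_space_def by auto
      show "M_norm M s p q u < \<infinity>"
        using Lp_norm_finite[OF pf(1) uL] \<open>M_seminorm M s p q u < \<infinity>\<close> unfolding M_norm_def by simp
    next
      show "(0::real) \<le> 2" by simp
      show "\<exists>U G. admissible U G 2 \<and> (AE x in M. w x = ereal (c * U x))"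
        if "w \<in> borel_measurable M" "0 < c" "M_norm M s p q w < ennreal c" for w c
        by (rule admissible_of_M_norm[OF refl refl pf(2) q_pos that])
      show "\<beta> \<in> borel_measurable M" using \<beta> unfolding bdd_exponents_def exponents_def by auto
    qed
  qed
  show "compactly_embedded (N_space_inv M s p q H) (N_norm M s p q) (Lp_space M \<beta>) (\<lambda>u. Lp_norm M \<beta> (abs_fun u))"
    if t: "t \<in> log_exponents M" and ts: "well_below M t s" and \<beta>: "\<beta> \<in> bdd_exponents M"
      and b: "well_below M p \<beta> \<and> well_below M \<beta> (\<lambda>x. Q x * p x / (Q x - t x * p x))" for t \<beta>
  proof -
    note tf = log_exponents_facts[OF t]
    obtain e where e: "0 < e" "AE x in M. ereal e \<le> s x - t x"
      using essinf_posD[OF ts[unfolded well_below_def]] by blast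
    have e': "AE x in M. real_of_ereal (t x) + e \<le> real_of_ereal (s x)"
      using e(2) tf(3) sf(3)
    proof eventually_elim
      case (elim x)
      then show ?case by (cases "t x"; cases "s x") auto
    qed
    have t1: "AE x in M. t x \<le> 1"
      using e(2) s1 tf(3) sf(3)
    proof eventually_elim
      case (elim x)
      then show ?case using e(1) by (cases "t x"; cases "s x") (auto simp: one_ereal_def)
    qed
    have gap_t: "AE x in M. real_of_ereal (t x) * real_of_ereal (p x) + \<delta> \<le> real_of_ereal (Q x)"
      using gap e'
    proof eventually_elim
      case (elim x)
      have "0 \<le> real_of_ereal (p x)" using pf(2)[of x] by (intro real_of_ereal_pos) auto
      then have "real_of_ereal (t x) * real_of_ereal (p x) \<le> real_of_ereal (s x) * real_of_ereal (p x)"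
        using elim e(1) by (intro mult_right_mono) auto
      then show ?case using elim by linarith
    qed
    obtain qm where qm: "0 < qm" "AE x in M. ereal qm \<le> q x" using essinf_posD[OF q_inf] by blast
    obtain pm pM QM sm b Z where "invariant_gradient_space M (\<lambda>x. real_of_ereal (p x)) (\<lambda>x. real_of_ereal (Q x))
        (\<lambda>x. real_of_ereal (t x)) pm pM QM sm \<delta> b Z H x0 r"
      using ex_invariant_gradient_space[OF mms doubling Q lower_reg H r packing p t t1 \<delta>(1) gap_t] by blast
    then interpret invariant_gradient_space M "\<lambda>x. real_of_ereal (p x)" "\<lambda>x. real_of_ereal (Q x)"
        "\<lambda>x. real_of_ereal (t x)" pm pM QM sm \<delta> b Z H x0 r .
    have "AE x in M. \<bar>p x\<bar> \<noteq> \<infinity> \<and> \<bar>Q x\<bar> \<noteq> \<infinity> \<and> \<bar>t x\<bar> \<noteq> \<infinity>"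
      using pf(3) Qf(3) tf(3) by eventually_elim auto
    from subcritical_exponent[OF refl refl refl this \<beta>] \<open>well_below M p \<beta> \<and> _\<close>
    obtain d \<epsilon> bM where d: "0 < d" "0 < \<epsilon>"
      "AE x in M. real_of_ereal (p x) + d \<le> real_of_ereal (\<beta> x) \<and> real_of_ereal (\<beta> x) \<le> bM \<and>
        (real_of_ereal (\<beta> x) + d) * (1 - real_of_ereal (t x) * real_of_ereal (p x) / real_of_ereal (Q x) + \<epsilon>)
          \<le> real_of_ereal (p x)"
      by blast
    obtain L0 where L0: "0 \<le> L0" "\<And>w c. w \<in> borel_measurable M \<Longrightarrow> 0 < c \<Longrightarrow> N_norm M s p q w < ennreal c \<Longrightarrow>
        \<exists>U G. admissible U G L0 \<and> (AE x in M. w x = ereal (c * U x))"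
      using admissible_of_N_norm[OF refl refl pf(2) qm e(1) e'] by blast
    show ?thesis
    proof (rule compactly_embedded_of_admissible[OF _ _ _ L0 _ d])
      fix u assume u: "u \<in> N_space_inv M s p q H"
      then have uL: "u \<in> Lp_space M p" and "N_seminorm M s p q u < \<infinity>" and "H_invariant M H u"
        unfolding N_space_inv_def N_space_def by auto
      then show "u \<in> borel_measurable M" "H_invariant M H u" unfolding Lp_space_def by auto
      show "N_norm M s p q u < \<infinity>"
        using Lp_norm_finite[OF pf(1) uL] \<open>N_seminorm M s p q u < \<infinity>\<close> unfolding N_norm_def by simp
    next
      show "\<beta> \<in> borel_measurable M" using \<beta> unfolding bdd_exponents_def exponents_def by auto
    qed
  qed
qed

end
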